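(* Assume $0\in\overline{\Omega}$ and $a>1$. If $\lambda_a<\frac14$, then $\lambda_a$ is attained, i.e. there exists a function admissible in the minimization problem defining $\lambda_a$ whose quotient equals $\lambda_a$.
   Context: $\Omega\subset\mathbb{R}^2$ is a smooth bounded domain with $0\in\overline{\Omega}$ and $\sup_{x\in\Omega}|x|=1$. Define $$\lambda_a=\inf\left\{\frac{\int_{\Omega}|\nabla u|^2\,dx}{\int_{\Omega}\frac{|u|^2}{|x|^2\left(\log\frac{a}{|x|}\right)^2}\,dx}\ \middle|\ u\in H^1(\Omega)\setminus\{0\},\ \int_{\Omega}\frac{u}{|x|^2\left(\log\frac{a}{|x|}\right)^2}\,dx=0\right\}.$$ *)

theory Defs
  imports "HOL-Analysis.Analysis"
begin

definition dir_deriv :: "'a::euclidean_space \<Rightarrow> ('a \<Rightarrow> real) \<Rightarrow> 'a \<Rightarrow> real" where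
  "dir_deriv v f = (\<lambda>x. frechet_derivative f (at x) v)"

text \<open>
  Infinitely differentiable on the whole space: every iterated directional derivative
  exists and is again (Frechet) differentiable, hence continuous.
\<close>
definition smooth_fun :: "('a::euclidean_space \<Rightarrow> real) \<Rightarrow> bool" where
  "smooth_fun f \<longleftrightarrow> (\<forall>vs x. foldr dir_deriv vs f differentiable (at x))"

definition test_fun :: "'a::euclidean_space set \<Rightarrow> ('a \<Rightarrow> real) \<Rightarrow> bool" where
  "test_fun \<Omega> \<phi> \<longleftrightarrow> smooth_fun \<phi> \<and>
     compact (closure {x. \<phi> x \<noteq> 0}) \<and> closure {x. \<phi> x \<noteq> 0} \<subseteq> \<Omega>"

definition L2_on :: "'a::euclidean_space set \<Rightarrow> ('a \<Rightarrow> 'b::euclidean_space) \<Rightarrow> bool" where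
  "L2_on \<Omega> f \<longleftrightarrow> f \<in> borel_measurable (lebesgue_on \<Omega>) \<and>
     integrable (lebesgue_on \<Omega>) (\<lambda>x. (norm (f x))\<^sup>2)"

definition has_weak_grad ::
    "'a::euclidean_space set \<Rightarrow> ('a \<Rightarrow> real) \<Rightarrow> ('a \<Rightarrow> 'a) \<Rightarrow> bool" where
  "has_weak_grad \<Omega> u g \<longleftrightarrow> L2_on \<Omega> g \<and>
     (\<forall>\<phi>. test_fun \<Omega> \<phi> \<longrightarrow>
        (\<forall>i\<in>Basis. (LINT x|lebesgue_on \<Omega>. u x * dir_deriv i \<phi> x)
                  = - (LINT x|lebesgue_on \<Omega>. (g x \<bullet> i) * \<phi> x)))"

text \<open>
  Elements of \<open>H1 \<Omega>\<close> are representatives: only the values on \<open>\<Omega>\<close> up to null sets matter.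
\<close>
definition H1 :: "'a::euclidean_space set \<Rightarrow> ('a \<Rightarrow> real) set" where
  "H1 \<Omega> = {u. L2_on \<Omega> u \<and> (\<exists>g. has_weak_grad \<Omega> u g)}"

text \<open>The weak gradient is unique up to null sets, so the choice is immaterial in integrals.\<close>
definition weak_grad :: "'a::euclidean_space set \<Rightarrow> ('a \<Rightarrow> real) \<Rightarrow> 'a \<Rightarrow> 'a" where
  "weak_grad \<Omega> u = (SOME g. has_weak_grad \<Omega> u g)"

text \<open>
  The boundary is locally, after an orthogonal change of coordinates, the graph of a smooth
  function, with the set lying strictly on one side of it.
\<close>
definition smooth_boundary :: "(real^2) set \<Rightarrow> bool" where
  "smooth_boundary \<Omega> \<longleftrightarrow>
     (\<forall>p\<in>frontier \<Omega>. \<exists>r>0. \<exists>T :: real^2 \<Rightarrow> real^2. \<exists>\<gamma> :: real \<Rightarrow> real.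
        orthogonal_transformation T \<and> smooth_fun \<gamma> \<and>
        \<Omega> \<inter> ball p r = {x \<in> ball p r. T x $ 2 > \<gamma> (T x $ 1)})"

definition smooth_bounded_domain :: "(real^2) set \<Rightarrow> bool" where
  "smooth_bounded_domain \<Omega> \<longleftrightarrow>
     open \<Omega> \<and> connected \<Omega> \<and> \<Omega> \<noteq> {} \<and> bounded \<Omega> \<and> smooth_boundary \<Omega>"

definition hardy_weight :: "real \<Rightarrow> real^2 \<Rightarrow> real" where
  "hardy_weight a x = 1 / ((norm x)\<^sup>2 * (ln (a / norm x))\<^sup>2)"

text \<open>
  \<open>has_bochner_integral\<close> says that the integral in the side condition exists and vanishes.
\<close>
definition admissible :: "real \<Rightarrow> (real^2) set \<Rightarrow> (real^2 \<Rightarrow> real) set" where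
  "admissible a \<Omega> = {u \<in> H1 \<Omega>. \<not> (AE x in lebesgue_on \<Omega>. u x = 0) \<and>
     has_bochner_integral (lebesgue_on \<Omega>) (\<lambda>x. u x * hardy_weight a x) 0}"

text \<open>
  Integrals of nonnegative functions are taken with values in \<open>[0, \<infinity>]\<close>, so that no
  integrability convention enters the quotient or its infimum.
\<close>
definition rayleigh :: "real \<Rightarrow> (real^2) set \<Rightarrow> (real^2 \<Rightarrow> real) \<Rightarrow> ennreal" where
  "rayleigh a \<Omega> u =
     (\<integral>\<^sup>+x. ennreal ((norm (weak_grad \<Omega> u x))\<^sup>2) \<partial>lebesgue_on \<Omega>) /
     (\<integral>\<^sup>+x. ennreal (\<bar>u x\<bar>\<^sup>2 * hardy_weight a x) \<partial>lebesgue_on \<Omega>)"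

definition hardy_lambda :: "real \<Rightarrow> (real^2) set \<Rightarrow> ennreal" where
  "hardy_lambda a \<Omega> = (INF u\<in>admissible a \<Omega>. rayleigh a \<Omega> u)"

end

theory Submission
  imports Defs "HOL-Library.Diagonal_Subsequence"
begin

text \<open>
  Take a minimizing sequence \<open>u\<^sub>n\<close> with weighted norm one. The quadratic form
  \<open>E - \<lambda>\<^sub>a N\<close> (Dirichlet integral minus weighted square integral) is nonnegative on the
  constraint space, so the parallelogram law makes it tend to zero on the differences \<open>u\<^sub>m - u\<^sub>n\<close>.
  Near the origin the Hardy inequality holds with constant \<open>1/4 - \<epsilon>\<close> up to a multiple of the
  \<open>L\<^sup>2\<close> norm, and along a subsequence the differences tend to zero in \<open>L\<^sup>2\<close> by Rellich compactness;
  since \<open>\<lambda>\<^sub>a < 1/4\<close>, the subsequence is Cauchy in the Dirichlet and in the weighted norm. Its limit is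
  the minimizer, and no weak convergence is needed.
\<close>

section \<open>Mollification\<close>

text \<open>The constraint space is linear and \<open>q = E - \<lambda>\<^sub>a N\<close> is
  nonnegative on it, so \<open>q(u\<^sub>m - u\<^sub>n) \<le> 2 q(u\<^sub>m) + 2
  q(u\<^sub>n)\<close>, the term \<open>q(u\<^sub>m + u\<^sub>n)\<close> being dropped. The obstacle
  is the boundary. Functions in \<open>H1\<close> carry no boundary condition and the origin may be
  a boundary point, so extension by zero in general leaves the Sobolev space and straight rays from
  the origin may leave the domain. The Hardy inequality is therefore integrated along curved rays
  that follow the boundary and tend to the origin inside the domain; their distortion tends to one
  near the origin, so the constant 4 of the one-dimensional inequality survives up to \<epsilon>.
  Its term at the inner endpoint has a favourable sign, and this is why functions that do not vanish
  at the origin are covered. Mollifications have a controlled gradient only at a positive distance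
  from the boundary: each estimate is proved for them on compact subsets, with constants independent
  of the subset, and passes to the limit by Fatou's lemma and monotone convergence.\<close>

definition flat :: "nat \<Rightarrow> real \<Rightarrow> real" where
  "flat k t = (if t > 0 then exp (- (1 / t)) / t ^ k else 0)"

lemma flat_nonneg: "0 \<le> flat k t"
  by (simp add: flat_def)

text \<open>With \<open>s = 1 / t\<close> this is \<open>s ^ k / exp s\<close> tending to 0 at
  infinity; from the left the function is zero.\<close>

lemma flat_tendsto_0: "(flat k \<longlongrightarrow> 0) (at 0)"
proof -
  have *: "((\<lambda>t::real. (inverse t) ^ k / exp (inverse t)) \<longlongrightarrow> 0) (at_right 0)"
    by (rule filterlim_compose[OF tendsto_power_div_exp_0 filterlim_inverse_at_top_right])
  have "(flat k \<longlongrightarrow> 0) (at_right 0)"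
    by (rule Lim_transform_eventually[OF *])
       (auto simp: eventually_at_filter flat_def exp_minus field_simps power_inverse)
  moreover have "(flat k \<longlongrightarrow> 0) (at_left 0)"
    by (rule Lim_transform_eventually[OF tendsto_const])
       (auto simp: eventually_at_filter flat_def)
  ultimately show ?thesis
    by (simp add: filterlim_split_at)
qed

text \<open>Differentiation multiplies \<open>exp (- (1 / t))\<close> by
  \<open>1 / t\<^sup>2\<close> and \<open>1 / t ^ k\<close> by \<open>- k / t\<close>. Carrying the
  power of \<open>t\<close> as an index closes the family under differentiation up to linear
  combinations, and smoothness of every order follows from this single formula.\<close>

lemma flat_deriv: "(flat k has_real_derivative (flat (k+2) t - real k * flat (k+1) t)) (at t)"
proof -
  consider "t > 0" | "t < 0" | "t = 0" by linarith
  then show ?thesis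
  proof cases
    case 1
    have "((\<lambda>t. exp (- (1 / t)) / t ^ k) has_real_derivative
        (exp (- (1 / t)) * (1 / t\<^sup>2) * t ^ k - exp (- (1 / t)) * (real k * t ^ (k - 1))) / (t ^ k * t ^ k)) (at t)"
      using 1 by (auto intro!: derivative_eq_intros simp: power2_eq_square)
    also have "(exp (- (1 / t)) * (1 / t\<^sup>2) * t ^ k - exp (- (1 / t)) * (real k * t ^ (k - 1))) / (t ^ k * t ^ k) =
        exp (- (1 / t)) * (1 / t\<^sup>2 / t ^ k - real k * t ^ (k - 1) / t ^ k / t ^ k)"
      using 1 by (simp add: diff_divide_distrib right_diff_distrib)
    \<comment> \<open>The split on \<open>k\<close> separates the truncated exponent
      \<open>k - 1\<close> at \<open>k = 0\<close>, where the coefficient \<open>real k\<close>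
      vanishes.\<close>
    also have "\<dots> = flat (k+2) t - real k * flat (k+1) t"
      using 1 by (cases k) (simp_all add: flat_def right_diff_distrib power_add power2_eq_square mult_ac)
    finally show ?thesis
      by (rule DERIV_cong_ev[THEN iffD1, rotated 3])
         (use 1 in \<open>auto simp: flat_def intro!: eventually_mono[OF eventually_nhds_in_open[of "{0<..}"]]\<close>)
  next
    case 2
    have "((\<lambda>t. 0) has_real_derivative (flat (k+2) t - real k * flat (k+1) t)) (at t)"
      using 2 by (simp add: flat_def)
    then show ?thesis
      by (rule DERIV_cong_ev[THEN iffD1, rotated 3])
         (use 2 in \<open>auto simp: flat_def intro!: eventually_mono[OF eventually_nhds_in_open[of "{..<0}"]]\<close>)
  next
    case 3
    \<comment> \<open>At 0 the difference quotient of \<open>flat k\<close> is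
      \<open>flat (k+1)\<close> itself, so the existence of the derivative and its value 0 both come
      from the limit at 0.\<close>
    have "((\<lambda>h. (flat k (0 + h) - flat k 0) / h) \<longlongrightarrow> 0) (at 0)"
      by (rule Lim_transform_eventually[OF flat_tendsto_0[of "k+1"]])
         (auto simp: flat_def eventually_at_filter)
    then show ?thesis
      using 3 by (simp add: DERIV_def flat_def)
  qed
qed

lemma flat_continuous [continuous_intros]:
  "continuous_on S f \<Longrightarrow> continuous_on S (\<lambda>x. flat k (f x))"
  by (rule continuous_on_compose2[of UNIV "flat k"])
     (auto intro!: DERIV_isCont flat_deriv continuous_at_imp_continuous_on)

text \<open>The closure under differentiation of the radial bumps centred at \<open>c\<close>.\<close>
inductive bump_class :: "'a::euclidean_space \<Rightarrow> real \<Rightarrow> ('a \<Rightarrow> real) \<Rightarrow> bool" for c r where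
  flat: "bump_class c r (\<lambda>x. flat k (r - (norm (x - c))\<^sup>2))"
| inner: "bump_class c r (\<lambda>x. (x - c) \<bullet> v)"
| const: "bump_class c r (\<lambda>x. b)"
| add: "bump_class c r f \<Longrightarrow> bump_class c r g \<Longrightarrow> bump_class c r (\<lambda>x. f x + g x)"
| mult: "bump_class c r f \<Longrightarrow> bump_class c r g \<Longrightarrow> bump_class c r (\<lambda>x. f x * g x)"

lemma flat_radial_deriv:
  fixes c :: "'a::euclidean_space"
  shows "((\<lambda>x. flat k (r - (norm (x - c))\<^sup>2)) has_derivative
    (\<lambda>v. (flat (k+2) (r - (norm (x - c))\<^sup>2) - real k * flat (k+1) (r - (norm (x - c))\<^sup>2)) * (- 2 * ((x - c) \<bullet> v)))) (at x)"
proof -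
  have "((\<lambda>x. r - (x - c) \<bullet> (x - c)) has_derivative (\<lambda>v. - 2 * ((x - c) \<bullet> v))) (at x)"
    by (auto intro!: derivative_eq_intros simp: inner_commute)
  from has_derivative_compose[OF this flat_deriv[of k, unfolded has_field_derivative_def]]
  show ?thesis by (simp add: power2_norm_eq_inner)
qed

text \<open>Existence of the derivative and membership of all directional derivatives in the class
  are proved together, since the case of products uses both for each factor.\<close>

lemma bump_class_deriv:
  assumes "bump_class c r f"
  shows "\<exists>D. (\<forall>v. bump_class c r (\<lambda>x. D x v)) \<and> (\<forall>x. (f has_derivative D x) (at x))"
  using assms
proof induction
  case (flat k)
  have "bump_class c r (\<lambda>x. (flat (k+2) (r - (norm (x - c))\<^sup>2) + (- real k) * flat (k+1) (r - (norm (x - c))\<^sup>2))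
        * (- 2 * ((x - c) \<bullet> v)))" for v
    by (intro bump_class.intros)
  then show ?case
    using flat_radial_deriv[of k r c]
    by (intro exI[of _ "\<lambda>x v. (flat (k+2) (r - (norm (x - c))\<^sup>2) - real k * flat (k+1) (r - (norm (x - c))\<^sup>2))
        * (- 2 * ((x - c) \<bullet> v))"]) auto
next
  case (inner v)
  have "((\<lambda>x. (x - c) \<bullet> v) has_derivative (\<lambda>w. w \<bullet> v)) (at x)" for x
    by (auto intro!: derivative_eq_intros)
  moreover have "bump_class c r (\<lambda>x. w \<bullet> v)" for w by (rule bump_class.const)
  ultimately show ?case
    by (intro exI[of _ "\<lambda>x w. w \<bullet> v"]) auto
next
  case (const b)
  then show ?case by (intro exI[of _ "\<lambda>x v. 0"]) (auto intro: bump_class.intros)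
next
  case (add f g)
  then obtain D E where "\<forall>v. bump_class c r (\<lambda>x. D x v)" "\<forall>x. (f has_derivative D x) (at x)"
    "\<forall>v. bump_class c r (\<lambda>x. E x v)" "\<forall>x. (g has_derivative E x) (at x)" by blast
  then show ?case
    by (intro exI[of _ "\<lambda>x v. D x v + E x v"]) (auto intro: bump_class.intros has_derivative_add)
next
  case (mult f g)
  then obtain D E where "\<forall>v. bump_class c r (\<lambda>x. D x v)" "\<forall>x. (f has_derivative D x) (at x)"
    "\<forall>v. bump_class c r (\<lambda>x. E x v)" "\<forall>x. (g has_derivative E x) (at x)" by blast
  then show ?case using mult
    by (intro exI[of _ "\<lambda>x v. f x * E x v + D x v * g x"]) (auto intro!: bump_class.intros has_derivative_mult)
qed

text \<open>\<open>smooth_fun\<close> ranges over all words of directional derivatives; a class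
  closed under \<open>dir_deriv\<close> whose members are differentiable settles all words by
  induction.\<close>

lemma bump_class_smooth:
  assumes "bump_class c r f"
  shows "smooth_fun f"
proof -
  have step: "bump_class c r (dir_deriv v f)" "f differentiable (at x)" if f: "bump_class c r f" for f v x
  proof -
    obtain D where D: "\<forall>v. bump_class c r (\<lambda>x. D x v)" "\<forall>x. (f has_derivative D x) (at x)"
      using bump_class_deriv[OF f] by blast
    have "dir_deriv v f = (\<lambda>x. D x v)"
      unfolding dir_deriv_def using D(2) frechet_derivative_at by metis
    then show "bump_class c r (dir_deriv v f)" using D(1) by metis
    show "f differentiable (at x)" using D(2) differentiableI by blast
  qed
  have "bump_class c r (foldr dir_deriv vs f)" for vs
    by (induction vs) (use assms step in auto)
  then show ?thesis unfolding smooth_fun_def using step(2) by blast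
qed

text \<open>The type argument carries the dimension, on which the normalizing integral depends but
  which no other argument shows.\<close>

definition flat_mass :: "'a::euclidean_space itself \<Rightarrow> real \<Rightarrow> real" where
  "flat_mass _ r = (LINT z|lborel. flat 0 (r\<^sup>2 - (norm (z::'a))\<^sup>2))"

definition eta :: "real \<Rightarrow> 'a::euclidean_space \<Rightarrow> real" where
  "eta r z = flat 0 (r\<^sup>2 - (norm z)\<^sup>2) / flat_mass TYPE('a) r"

text \<open>Only \<open>flat 2\<close> occurs because the \<open>flat 1\<close> term in the
  derivative of \<open>flat 0\<close> has coefficient 0; the factor \<open>- 2\<close> and the
  vector \<open>z\<close> come from the derivative of the squared norm.\<close>

definition eta_grad :: "real \<Rightarrow> 'a::euclidean_space \<Rightarrow> 'a" where
  "eta_grad r z = (- 2 * flat 2 (r\<^sup>2 - (norm z)\<^sup>2) / flat_mass TYPE('a) r) *\<^sub>R z"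

lemma flat_radial_zero: "r > 0 \<Longrightarrow> r \<le> norm z \<Longrightarrow> flat k (r\<^sup>2 - (norm z)\<^sup>2) = 0"
  unfolding flat_def by (rule if_not_P) (simp add: not_less power_mono)

lemma eta_zero: "r > 0 \<Longrightarrow> r \<le> norm z \<Longrightarrow> eta r z = 0"
  by (simp add: eta_def flat_radial_zero)

lemma eta_grad_zero: "r > 0 \<Longrightarrow> r \<le> norm z \<Longrightarrow> eta_grad r z = 0"
  by (simp add: eta_grad_def flat_radial_zero)

text \<open>Heine-Cantor on the ball of radius \<open>R + 1\<close>: the margin 1 guarantees that
  two points at distance below 1 lie either both in this ball or both where \<open>f\<close>
  vanishes.\<close>

lemma compact_support_uniform:
  fixes f :: "'a::euclidean_space \<Rightarrow> 'b::real_normed_vector"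
  assumes c: "continuous_on UNIV f" and z: "\<And>x. R \<le> norm x \<Longrightarrow> f x = 0"
  shows "uniformly_continuous_on UNIV f" "\<exists>B>0. \<forall>x. norm (f x) \<le> B"
proof -
  have u: "uniformly_continuous_on (cball 0 (R+1)) f"
    by (rule compact_uniformly_continuous[OF continuous_on_subset[OF c]]) auto
  show "uniformly_continuous_on UNIV f"
    unfolding uniformly_continuous_on_def
  proof (intro allI impI)
    fix e :: real assume "e > 0"
    then obtain d where d: "d > 0" "\<And>x y. x \<in> cball 0 (R+1) \<Longrightarrow> y \<in> cball 0 (R+1) \<Longrightarrow> dist y x < d \<Longrightarrow> dist (f y) (f x) < e"
      using u unfolding uniformly_continuous_on_def by metis
    show "\<exists>d>0. \<forall>x\<in>UNIV. \<forall>x'\<in>UNIV. dist x' x < d \<longrightarrow> dist (f x') (f x) < e"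
    proof (intro exI[of _ "min d 1"] conjI ballI impI)
      fix x y :: 'a assume xy: "dist y x < min d 1"
      show "dist (f y) (f x) < e"
      proof (cases "x \<in> cball 0 (R+1) \<and> y \<in> cball 0 (R+1)")
        case True then show ?thesis using d xy by auto
      next
        case False
        have "norm x \<le> norm y + dist y x" "norm y \<le> norm x + dist y x"
          by (metis dist_norm norm_minus_commute norm_triangle_sub add.commute)+
        then have "R \<le> norm x" "R \<le> norm y" using False xy by (auto simp: dist_norm)
        then show ?thesis using z \<open>e > 0\<close> by simp
      qed
    qed (use d in auto)
  qed
  have "bounded (f ` cball 0 R)"
    by (rule compact_imp_bounded[OF compact_continuous_image[OF continuous_on_subset[OF c]]]) auto
  then obtain B where "B > 0" "\<forall>x\<in>cball 0 R. norm (f x) \<le> B" unfolding bounded_pos by auto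
  then show "\<exists>B>0. \<forall>x. norm (f x) \<le> B"
    by (metis less_imp_le mem_cball_0 norm_zero z linear)
qed

lemma integrable_compact_support:
  fixes f :: "'a::euclidean_space \<Rightarrow> real"
  assumes c: "continuous_on UNIV f" and z: "\<And>x. R \<le> norm x \<Longrightarrow> f x = 0"
  shows "integrable lborel f"
proof -
  have "set_integrable lborel (cball 0 R) f"
    unfolding set_integrable_def
    by (rule borel_integrable_compact) (auto intro: continuous_on_subset[OF c])
  moreover have "(\<lambda>x. indicator (cball 0 R) x *\<^sub>R f x) = f"
    using z by (auto simp: indicator_def fun_eq_iff)
  ultimately show ?thesis by (simp add: set_integrable_def)
qed

text \<open>A zero integral would force the nonnegative integrand to vanish almost everywhere, but
  it is positive on a ball of positive measure.\<close>

lemma flat_mass_pos: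
  assumes "r > 0" shows "flat_mass TYPE('a::euclidean_space) r > 0"
proof -
  let ?f = "\<lambda>z::'a. flat 0 (r\<^sup>2 - (norm z)\<^sup>2)"
  have int: "integrable lborel ?f"
    by (rule integrable_compact_support[of _ r]) (auto intro!: continuous_intros flat_radial_zero assms)
  have "flat_mass TYPE('a) r \<noteq> 0"
  proof
    assume "flat_mass TYPE('a) r = 0"
    then have "AE z in lborel. ?f z = 0"
      using integral_nonneg_eq_0_iff_AE[OF int] by (simp add: flat_mass_def flat_nonneg)
    then have "AE z in lborel. (z::'a) \<notin> ball 0 r"
    proof eventually_elim
      case (elim z)
      show ?case
      proof
        assume "z \<in> ball 0 r"
        then have "(norm z)\<^sup>2 < r\<^sup>2" by (simp add: power_strict_mono)
        then show False using elim by (simp add: flat_def)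
      qed
    qed
    then have "emeasure lborel (ball (0::'a) r) = 0"
      by (subst (asm) AE_iff_measurable[of "ball 0 r"]) auto
    then show False using emeasure_lborel_ball_finite[of "0::'a" r] assms
      using content_ball_pos[OF assms, of "0::'a"] by (simp add: measure_def)
  qed
  moreover have "flat_mass TYPE('a) r \<ge> 0"
    unfolding flat_mass_def by (intro Bochner_Integration.integral_nonneg) (auto simp: flat_nonneg)
  ultimately show ?thesis by simp
qed

lemma eta_nonneg: "0 \<le> eta r (z::'a::euclidean_space)"
  unfolding eta_def flat_mass_def
  by (intro divide_nonneg_nonneg Bochner_Integration.integral_nonneg) (auto simp: flat_nonneg)

lemma eta_continuous: "continuous_on UNIV (eta r)"
  unfolding eta_def divide_inverse by (intro continuous_intros)

lemma eta_grad_continuous: "continuous_on UNIV (eta_grad r)"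
  unfolding eta_grad_def divide_inverse by (intro continuous_intros)

lemma eta_has_derivative: "(eta r has_derivative (\<lambda>h. eta_grad r z \<bullet> h)) (at z)"
proof -
  have "((\<lambda>x. flat 0 (r\<^sup>2 - (norm (x - 0))\<^sup>2) * inverse (flat_mass TYPE('a) r)) has_derivative
     (\<lambda>h. ((flat (0+2) (r\<^sup>2 - (norm (z - 0))\<^sup>2) - real 0 * flat (0+1) (r\<^sup>2 - (norm (z - 0))\<^sup>2)) * (- 2 * ((z - 0) \<bullet> h))) *
       inverse (flat_mass TYPE('a) r))) (at z)"
    by (rule has_derivative_mult_left[OF flat_radial_deriv])
  then show ?thesis
    by (simp add: eta_def[abs_def] eta_grad_def divide_inverse mult_ac numeral_2_eq_2)
qed

lemma eta_measurable [measurable]: "eta r \<in> borel_measurable borel"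
  by (rule borel_measurable_continuous_onI[OF eta_continuous])

lemma eta_grad_measurable [measurable]: "eta_grad r \<in> borel_measurable borel"
  by (rule borel_measurable_continuous_onI[OF eta_grad_continuous])

lemma eta_integrable: "r > 0 \<Longrightarrow> integrable lborel (eta r)"
  by (rule integrable_compact_support[of _ r]) (auto intro: eta_continuous eta_zero)

lemma eta_integral:
  assumes "r > 0" shows "(LINT z|lborel. eta r (z::'a::euclidean_space)) = 1"
  using flat_mass_pos[where 'a='a, OF assms] unfolding eta_def by (simp add: flat_mass_def)

lemma nn_integral_lborel_shift:
  fixes c :: "'a::euclidean_space"
  assumes "f \<in> borel_measurable borel"
  shows "(\<integral>\<^sup>+ x. f (c + x) \<partial>lborel) = (\<integral>\<^sup>+ x. f x \<partial>lborel)"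
  using assms by (subst (2) lborel_distr_plus[of c, symmetric]) (simp add: nn_integral_distr)

lemma nn_integral_lborel_reflect:
  fixes c :: "'a::euclidean_space"
  assumes [measurable]: "f \<in> borel_measurable borel"
  shows "(\<integral>\<^sup>+ x. f (c - x) \<partial>lborel) = (\<integral>\<^sup>+ x. f x \<partial>lborel)"
proof -
  have "lborel = distr lborel borel (\<lambda>x::'a. c + (-1) *\<^sub>R x)"
    by (subst lborel_affine[of "-1" c]) (simp_all add: density_1)
  then have "(\<integral>\<^sup>+ x. f x \<partial>lborel) = (\<integral>\<^sup>+ x. f x \<partial>distr lborel borel (\<lambda>x::'a. c + (-1) *\<^sub>R x))"
    by simp
  also have "\<dots> = (\<integral>\<^sup>+ x. f (c + (-1) *\<^sub>R x) \<partial>lborel)"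
    by (rule nn_integral_distr) auto
  finally show ?thesis by simp
qed

lemma eta_nn_integral:
  fixes x y :: "'a::euclidean_space"
  assumes "r > 0"
  shows "(\<integral>\<^sup>+ x. ennreal (eta r (x - y)) \<partial>lborel) = 1" "(\<integral>\<^sup>+ y. ennreal (eta r (x - y)) \<partial>lborel) = 1"
proof -
  have *: "(\<integral>\<^sup>+ x. ennreal (eta r (x::'a)) \<partial>lborel) = 1"
    by (subst nn_integral_eq_integral[OF eta_integrable[OF assms]])
      (simp_all add: eta_nonneg eta_integral[OF assms])
  show "(\<integral>\<^sup>+ x. ennreal (eta r (x - y)) \<partial>lborel) = 1"
    using nn_integral_lborel_shift[of "\<lambda>x. ennreal (eta r x)" "- y"] * by (simp add: add.commute)
  show "(\<integral>\<^sup>+ y. ennreal (eta r (x - y)) \<partial>lborel) = 1"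
    using nn_integral_lborel_reflect[of "\<lambda>x. ennreal (eta r x)" x] * by simp
qed

lemma eta_shift_integrable: "r > 0 \<Longrightarrow> integrable lborel (\<lambda>y. eta r (x - y))"
  by (rule integrableI_bounded) (auto simp: eta_nonneg eta_nn_integral)

lemma eta_shift_integral: "r > 0 \<Longrightarrow> (LINT y|lborel. eta r (x - y)) = 1"
  using nn_integral_eq_integral[OF eta_shift_integrable, of r x] eta_nn_integral(2)[of r x]
  by (simp add: eta_nonneg ennreal_eq_1)

text \<open>The kernel centred at \<open>x\<close> is the test function through which the weak
  gradient enters all estimates. The closed ball appears because \<open>test_fun\<close> speaks of
  the closure of the support.\<close>

lemma eta_test_fun:
  assumes "r > 0" "cball x r \<subseteq> \<Omega>"
  shows "test_fun \<Omega> (\<lambda>y. eta r (x - y))"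
proof -
  have "bump_class x (r\<^sup>2) (\<lambda>y. flat 0 (r\<^sup>2 - (norm (y - x))\<^sup>2) * inverse (flat_mass TYPE('a) r))"
    by (intro bump_class.intros)
  then have sm: "smooth_fun (\<lambda>y. eta r (x - y))"
    using bump_class_smooth by (simp add: eta_def norm_minus_commute divide_inverse)
  have "{y. eta r (x - y) \<noteq> 0} \<subseteq> cball x r"
    using eta_zero[OF assms(1), of "x - y" for y] by (force simp: dist_norm)
  then have cl: "closure {y. eta r (x - y) \<noteq> 0} \<subseteq> cball x r"
    by (simp add: closure_minimal)
  moreover have "compact (closure {y. eta r (x - y) \<noteq> 0})"
    using cl by (meson bounded_cball bounded_subset closed_closure compact_eq_bounded_closed)
  ultimately show ?thesis
    unfolding test_fun_def using assms(2) sm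
    by blast
qed

lemma eta_dir_deriv: "dir_deriv v (\<lambda>y. eta r (x - y)) y = - (eta_grad r (x - y) \<bullet> v)"
proof -
  have "((\<lambda>y. x - y) has_derivative (\<lambda>h. - h)) (at y)" by (auto intro!: derivative_eq_intros)
  from has_derivative_compose[OF this eta_has_derivative]
  have "((\<lambda>y. eta r (x - y)) has_derivative (\<lambda>h. eta_grad r (x - y) \<bullet> (- h))) (at y)" .
  from frechet_derivative_at[OF this] show ?thesis by (metis dir_deriv_def inner_minus_right)
qed

section \<open>Convolution with the kernel: regularity, contraction in L1 and L2,
  convergence\<close>

definition moll :: "real \<Rightarrow> ('a::euclidean_space \<Rightarrow> 'b::euclidean_space) \<Rightarrow> 'a \<Rightarrow> 'b" where
  "moll r f x = (LINT y|lborel. eta r (x - y) *\<^sub>R f y)"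

lemma eta_bounded: "r > 0 \<Longrightarrow> \<exists>B>0. \<forall>z. eta r (z::'a::euclidean_space) \<le> B"
  using compact_support_uniform(2)[OF eta_continuous, of r r, OF eta_zero]
  by (force dest: abs_le_D1)

lemma integrable_bounded_scaleR:
  fixes f :: "'a \<Rightarrow> 'b::euclidean_space"
  assumes "integrable M f" "h \<in> borel_measurable M" "\<And>x. \<bar>h x\<bar> \<le> B"
  shows "integrable M (\<lambda>x. h x *\<^sub>R f x)"
proof (rule Bochner_Integration.integrable_bound[of M "\<lambda>x. B *\<^sub>R f x"])
  show "integrable M (\<lambda>x. B *\<^sub>R f x)" using assms(1) by simp
  show "(\<lambda>x. h x *\<^sub>R f x) \<in> borel_measurable M" using assms by measurable
  show "AE x in M. norm (h x *\<^sub>R f x) \<le> norm (B *\<^sub>R f x)"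
    using assms(3) by (intro always_eventually allI) (auto intro!: mult_right_mono order_trans[OF _ abs_ge_self])
qed

lemma moll_integrand_integrable:
  fixes f :: "'a::euclidean_space \<Rightarrow> 'b::euclidean_space"
  assumes "r > 0" "integrable lborel f"
  shows "integrable lborel (\<lambda>y. eta r (x - y) *\<^sub>R f y)"
proof -
  obtain B where "\<And>z::'a. eta r z \<le> B" using eta_bounded[OF assms(1)] by blast
  then show ?thesis by (intro integrable_bounded_scaleR[OF assms(2), of _ B]) (auto simp: eta_nonneg)
qed

text \<open>Dominated convergence, the bounded kernel giving the majorant
  \<open>B * norm (f y)\<close>.\<close>

lemma moll_continuous:
  fixes f :: "'a::euclidean_space \<Rightarrow> 'b::euclidean_space"
  assumes r: "r > 0" and f: "integrable lborel f"
  shows "continuous_on UNIV (moll r f)"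
proof -
  obtain B where B: "\<And>z::'a. eta r z \<le> B" using eta_bounded[OF r] by blast
  have "(\<lambda>n. moll r f (X n)) \<longlonglongrightarrow> moll r f x" if X: "X \<longlonglongrightarrow> x" for X x
    unfolding moll_def
  proof (rule integral_dominated_convergence[where w="\<lambda>y. B * norm (f y)"])
    show "AE y in lborel. (\<lambda>n. eta r (X n - y) *\<^sub>R f y) \<longlonglongrightarrow> eta r (x - y) *\<^sub>R f y"
    proof (intro always_eventually allI tendsto_scaleR tendsto_const)
      fix y
      have "isCont (eta r) (x - y)"
        using eta_continuous[of r, where 'a='a] by (simp add: continuous_on_eq_continuous_at)
      then show "(\<lambda>n. eta r (X n - y)) \<longlonglongrightarrow> eta r (x - y)"
        by (rule isCont_tendsto_compose) (intro tendsto_intros X)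
    qed
    show "AE y in lborel. norm (eta r (X n - y) *\<^sub>R f y) \<le> B * norm (f y)" for n
      by (auto simp: eta_nonneg B mult_right_mono)
  qed (use f in auto)
  then show ?thesis
    unfolding continuous_on_sequentially by (auto simp: o_def)
qed

lemma moll_measurable [measurable]:
  "r > 0 \<Longrightarrow> integrable lborel f \<Longrightarrow> moll r f \<in> borel_measurable borel"
  by (rule borel_measurable_continuous_onI[OF moll_continuous])

text \<open>The gradient of the kernel is uniformly continuous, so the linearization error of the
  kernel is at most a small multiple of \<open>norm h\<close>, uniformly in the base point.
  Integrating this bound against \<open>\<bar>f\<bar>\<close> gives the derivative of the
  convolution.\<close>

lemma moll_has_derivative:
  fixes f :: "'a::euclidean_space \<Rightarrow> real"
  assumes r: "r > 0" and f: "integrable lborel f"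
  shows "(moll r f has_derivative (\<lambda>h. (LINT y|lborel. f y *\<^sub>R eta_grad r (x - y)) \<bullet> h)) (at x)"
proof -
  define G where "G = (LINT y|lborel. f y *\<^sub>R eta_grad r (x - y))"
  obtain B where B: "\<And>z::'a. norm (eta_grad r z) \<le> B"
    using compact_support_uniform(2)[OF eta_grad_continuous, of r r, OF eta_grad_zero[OF r]] by blast
  have intG: "integrable lborel (\<lambda>y. f y *\<^sub>R eta_grad r (x - y))"
  proof (rule Bochner_Integration.integrable_bound[of _ "\<lambda>y. B * f y"])
    show "AE y in lborel. norm (f y *\<^sub>R eta_grad r (x - y)) \<le> norm (B * f y)"
      using B by (intro always_eventually allI)
        (auto simp: abs_mult mult.commute[of "\<bar>B\<bar>"] intro!: mult_left_mono order_trans[OF B abs_ge_self])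
  qed (use f in auto)
  define A where "A = (LINT y|lborel. \<bar>f y\<bar>)"
  have A0: "A \<ge> 0" unfolding A_def by simp
  have uc: "uniformly_continuous_on UNIV (eta_grad r :: 'a \<Rightarrow> 'a)"
    by (rule compact_support_uniform(1)[OF eta_grad_continuous, of r]) (simp add: eta_grad_zero r)
  show ?thesis
    unfolding has_derivative_at_alt
  proof (intro conjI allI impI)
    show "bounded_linear (\<lambda>h. (LINT y|lborel. f y *\<^sub>R eta_grad r (x - y)) \<bullet> h)"
      by (rule bounded_linear_inner_right)
    fix e :: real assume "e > 0"
    \<comment> \<open>The error is integrated against \<open>\<bar>f\<bar>\<close>, of total mass
      \<open>A\<close>; dividing by \<open>A + 1\<close> instead of \<open>A\<close> also covers
      \<open>A = 0\<close>.\<close>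
    then have "e / (A + 1) > 0" using A0 by simp
    then obtain d where d: "d > 0" "\<And>z z'::'a. dist z' z < d \<Longrightarrow> dist (eta_grad r z') (eta_grad r z) < e / (A + 1)"
      using uc unfolding uniformly_continuous_on_def by (metis UNIV_I)
    have bd: "\<bar>eta r (z + h) - eta r z - eta_grad r z \<bullet> h\<bar> \<le> e / (A + 1) * norm h" if h: "norm h < d" for z h :: 'a
    proof -
      have "norm (eta r (z + h) - eta r z - (\<lambda>k. eta_grad r z \<bullet> k) (z + h - z)) \<le> norm (z + h - z) * (e / (A + 1))"
      proof (rule differentiable_bound_linearization[of z "z + h" "{w. dist w z < d}" "eta r" "\<lambda>w k. eta_grad r w \<bullet> k" z])
        fix t :: real assume t: "t \<in> {0..1}"
        then have "t * norm h \<le> norm h" by (simp add: mult_left_le_one_le)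
        then show "z + t *\<^sub>R (z + h - z) \<in> {w. dist w z < d}" using t h by (simp add: dist_norm)
      next
        fix w assume "w \<in> {w. dist w z < d}"
        then have "norm (eta_grad r w - eta_grad r z) \<le> e / (A + 1)"
          using d(2)[of w z] by (simp add: dist_norm norm_minus_commute)
        moreover have "onorm (\<lambda>k. (eta_grad r w - eta_grad r z) \<bullet> k) \<le> norm (eta_grad r w - eta_grad r z)"
          by (rule onorm_bound) (auto intro: Cauchy_Schwarz_ineq2)
        ultimately show "onorm ((\<lambda>k. eta_grad r w \<bullet> k) - (\<lambda>k. eta_grad r z \<bullet> k)) \<le> e / (A + 1)"
          by (simp add: inner_diff_left fun_diff_def)
      next
        show "(eta r has_derivative (\<lambda>k. eta_grad r w \<bullet> k)) (at w within {w. dist w z < d})" for w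
          by (rule has_derivative_at_withinI[OF eta_has_derivative])
        show "z \<in> {w. dist w z < d}" using d(1) by simp
      qed
      then show ?thesis by (simp add: mult.commute)
    qed
    show "\<exists>d>0. \<forall>y. norm (y - x) < d \<longrightarrow>
        norm (moll r f y - moll r f x - (LINT y|lborel. f y *\<^sub>R eta_grad r (x - y)) \<bullet> (y - x)) \<le> e * norm (y - x)"
    proof (intro exI[of _ d] conjI allI impI d(1))
      fix x' assume h: "norm (x' - x) < d"
      let ?h = "x' - x"
      have i: "integrable lborel (\<lambda>y. eta r (z - y) *\<^sub>R f y)" for z
        by (rule moll_integrand_integrable[OF r f])
      have i3: "integrable lborel (\<lambda>y. (f y *\<^sub>R eta_grad r (x - y)) \<bullet> ?h)"
        using intG by (rule integrable_inner_left) 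
      define D where "D y = eta r (x' - y) *\<^sub>R f y - eta r (x - y) *\<^sub>R f y - (f y *\<^sub>R eta_grad r (x - y)) \<bullet> ?h" for y
      have iD: "integrable lborel D" unfolding D_def using i[of x'] i[of x] i3 by simp
      have Db: "\<bar>D y\<bar> \<le> e / (A + 1) * norm ?h * \<bar>f y\<bar>" for y
      proof -
        have "D y = (eta r ((x - y) + ?h) - eta r (x - y) - eta_grad r (x - y) \<bullet> ?h) * f y"
          by (simp add: D_def algebra_simps)
        then show ?thesis
          using mult_right_mono[OF bd[OF h, of "x - y"], of "\<bar>f y\<bar>"] by (simp add: abs_mult)
      qed
      have "moll r f x' - moll r f x - G \<bullet> ?h = (LINT y|lborel. D y)"
        unfolding G_def moll_def D_def
        using i[of x'] i[of x] i3 by (subst integral_inner_left[symmetric]) (simp_all add: intG)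
      also have "norm \<dots> \<le> (LINT y|lborel. norm (D y))"
        by (rule integral_norm_bound)
      also have "\<dots> \<le> (LINT y|lborel. e / (A + 1) * norm ?h * \<bar>f y\<bar>)"
        using iD f Db by (intro integral_mono) auto
      also have "\<dots> = e * norm ?h * (A / (A + 1))" by (simp add: A_def)
      also have "\<dots> \<le> e * norm ?h * 1"
        using A0 \<open>e > 0\<close> by (intro mult_left_mono) auto
      finally show "norm (moll r f x' - moll r f x - (LINT y|lborel. f y *\<^sub>R eta_grad r (x - y)) \<bullet> (x' - x)) \<le> e * norm (x' - x)"
        by (simp add: G_def)
    qed
  qed
qed

text \<open>Jensen's inequality for the probability density \<open>eta r (x - y)\<close>, read off
  from the nonnegative variance of \<open>f\<close> about its mean
  \<open>moll r f x\<close>.\<close>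

lemma moll_norm_square_le:
  fixes f :: "'a::euclidean_space \<Rightarrow> 'b::euclidean_space"
  assumes r: "r > 0" and f: "integrable lborel f" and f2: "integrable lborel (\<lambda>x. (norm (f x))\<^sup>2)"
  shows "(norm (moll r f x))\<^sup>2 \<le> (LINT y|lborel. eta r (x - y) * (norm (f y))\<^sup>2)"
proof -
  let ?m = "moll r f x"
  have i1: "integrable lborel (\<lambda>y. eta r (x - y) *\<^sub>R f y)"
    by (rule moll_integrand_integrable[OF r f])
  have i2: "integrable lborel (\<lambda>y. eta r (x - y) * (norm (f y))\<^sup>2)"
    using moll_integrand_integrable[OF r f2] by simp
  have i3: "integrable lborel (\<lambda>y. (eta r (x - y) *\<^sub>R f y) \<bullet> ?m)"
    using i1 by (rule integrable_inner_left)
  have i4: "integrable lborel (\<lambda>y. eta r (x - y))" by (rule eta_shift_integrable[OF r])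
  have "0 \<le> (LINT y|lborel. eta r (x - y) * (norm (f y - ?m))\<^sup>2)"
    by (intro Bochner_Integration.integral_nonneg) (auto simp: eta_nonneg)
  also have "\<dots> = (LINT y|lborel. eta r (x - y) * (norm (f y))\<^sup>2 - 2 * ((eta r (x - y) *\<^sub>R f y) \<bullet> ?m) + eta r (x - y) * (norm ?m)\<^sup>2)"
    by (intro Bochner_Integration.integral_cong refl)
       (simp add: power2_norm_eq_inner algebra_simps inner_commute)
  also have "\<dots> = (LINT y|lborel. eta r (x - y) * (norm (f y))\<^sup>2) - 2 * (?m \<bullet> ?m) + (norm ?m)\<^sup>2"
    using i2 i3 i4 integral_inner_left[OF i1, of "moll r f x"]
    by (simp add: eta_shift_integral[OF r] moll_def)
  finally show ?thesis by (simp add: power2_norm_eq_inner)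
qed

text \<open>After the pointwise Jensen bound, Tonelli integrates the kernel in \<open>x\<close>
  first, which gives the factor 1.\<close>

lemma moll_L2_le:
  fixes f :: "'a::euclidean_space \<Rightarrow> 'b::euclidean_space"
  assumes r: "r > 0" and f: "integrable lborel f" and f2: "integrable lborel (\<lambda>x. (norm (f x))\<^sup>2)"
  shows "(\<integral>\<^sup>+x. ennreal ((norm (moll r f x))\<^sup>2) \<partial>lborel) \<le> (\<integral>\<^sup>+x. ennreal ((norm (f x))\<^sup>2) \<partial>lborel)"
proof -
  have [measurable]: "f \<in> borel_measurable borel" using f by auto
  have "(\<integral>\<^sup>+x. ennreal ((norm (moll r f x))\<^sup>2) \<partial>lborel) \<le>
      (\<integral>\<^sup>+x. \<integral>\<^sup>+y. ennreal (eta r (x - y)) * ennreal ((norm (f y))\<^sup>2) \<partial>lborel \<partial>lborel)"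
  proof (rule nn_integral_mono)
    fix x
    have "ennreal ((norm (moll r f x))\<^sup>2) \<le> ennreal (LINT y|lborel. eta r (x - y) * (norm (f y))\<^sup>2)"
      using moll_norm_square_le[OF assms] by (rule ennreal_leI)
    also have "\<dots> = (\<integral>\<^sup>+y. ennreal (eta r (x - y) * (norm (f y))\<^sup>2) \<partial>lborel)"
      using moll_integrand_integrable[OF r f2]
      by (intro nn_integral_eq_integral[symmetric]) (auto simp: eta_nonneg)
    finally show "ennreal ((norm (moll r f x))\<^sup>2) \<le> (\<integral>\<^sup>+y. ennreal (eta r (x - y)) * ennreal ((norm (f y))\<^sup>2) \<partial>lborel)"
      by (simp add: ennreal_mult eta_nonneg)
  qed
  also have "\<dots> = (\<integral>\<^sup>+y. \<integral>\<^sup>+x. ennreal (eta r (x - y)) * ennreal ((norm (f y))\<^sup>2) \<partial>lborel \<partial>lborel)"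
    by (rule lborel_pair.Fubini') measurable
  also have "\<dots> = (\<integral>\<^sup>+y. ennreal ((norm (f y))\<^sup>2) \<partial>lborel)"
    by (subst nn_integral_multc) (auto simp: eta_nn_integral[OF r])
  finally show ?thesis .
qed

lemma moll_L1_le:
  fixes f :: "'a::euclidean_space \<Rightarrow> 'b::euclidean_space"
  assumes r: "r > 0" and f: "integrable lborel f"
  shows "(\<integral>\<^sup>+x. ennreal (norm (moll r f x)) \<partial>lborel) \<le> (\<integral>\<^sup>+x. ennreal (norm (f x)) \<partial>lborel)"
proof -
  have [measurable]: "f \<in> borel_measurable borel" using f by auto
  have "(\<integral>\<^sup>+x. ennreal (norm (moll r f x)) \<partial>lborel) \<le>
      (\<integral>\<^sup>+x. \<integral>\<^sup>+y. ennreal (eta r (x - y)) * ennreal (norm (f y)) \<partial>lborel \<partial>lborel)"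
  proof (rule nn_integral_mono)
    fix x
    have "ennreal (norm (moll r f x)) \<le> (\<integral>\<^sup>+y. ennreal (norm (eta r (x - y) *\<^sub>R f y)) \<partial>lborel)"
      unfolding moll_def by (rule integral_norm_bound_ennreal[OF moll_integrand_integrable[OF r f]])
    then show "ennreal (norm (moll r f x)) \<le> (\<integral>\<^sup>+y. ennreal (eta r (x - y)) * ennreal (norm (f y)) \<partial>lborel)"
      by (simp add: ennreal_mult eta_nonneg)
  qed
  also have "\<dots> = (\<integral>\<^sup>+y. \<integral>\<^sup>+x. ennreal (eta r (x - y)) * ennreal (norm (f y)) \<partial>lborel \<partial>lborel)"
    by (rule lborel_pair.Fubini') measurable
  also have "\<dots> = (\<integral>\<^sup>+y. ennreal (norm (f y)) \<partial>lborel)"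
    by (subst nn_integral_multc) (auto simp: eta_nn_integral[OF r])
  finally show ?thesis .
qed

text \<open>Cutting off and truncating makes \<open>f\<close> bounded with bounded support at a
  small \<open>L\<^sup>1\<close> cost. A measurable function is almost everywhere a limit of
  continuous ones, and the same cut-off and truncation applied to these supply the majorant for
  dominated convergence.\<close>

lemma L1_dense_compact_support:
  fixes f :: "'a::euclidean_space \<Rightarrow> real"
  assumes f: "integrable lborel f" and e: "e > 0"
  obtains h R where "continuous_on UNIV h" "\<And>x. R \<le> norm x \<Longrightarrow> h x = 0" "R \<ge> 0"
    "(LINT x|lborel. \<bar>f x - h x\<bar>) < e"
proof -
  have [measurable]: "f \<in> borel_measurable borel" using f by auto
  define cut where "cut k x = max 0 (min 1 (real k + 1 - norm x))" for k and x :: 'a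
  define tr where "tr k t = max (- real k) (min (real k) t)" for k t
  have cut01: "0 \<le> cut k x" "cut k x \<le> 1" for k x by (auto simp: cut_def)
  have trb: "\<bar>tr k t\<bar> \<le> \<bar>t\<bar>" "\<bar>tr k t\<bar> \<le> real k" for k t by (auto simp: tr_def)
  have cutc: "continuous_on UNIV (cut k)" for k unfolding cut_def by (intro continuous_intros)
  have trc: "continuous_on UNIV (tr k)" for k unfolding tr_def by (intro continuous_intros)
  have [measurable]: "cut k \<in> borel_measurable borel" "tr k \<in> borel_measurable borel" for k
    by (auto intro!: borel_measurable_continuous_onI cutc trc)
  define F where "F k x = cut k x * tr k (f x)" for k x
  have Fb: "\<bar>F k x\<bar> \<le> \<bar>f x\<bar>" for k x
    using mult_mono[OF cut01(2)[of k x] trb(1)[of k "f x"]] cut01 by (simp add: F_def abs_mult)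
  have "(\<lambda>k. LINT x|lborel. \<bar>f x - F k x\<bar>) \<longlonglongrightarrow> (LINT x|lborel. (0::real) * f x)"
  proof (rule integral_dominated_convergence[where w="\<lambda>x. 2 * \<bar>f x\<bar>"])
    show "AE x in lborel. (\<lambda>k. \<bar>f x - F k x\<bar>) \<longlonglongrightarrow> 0 * f x"
    proof (intro always_eventually allI)
      fix x
      have "eventually (\<lambda>k. F k x = f x) sequentially"
        using eventually_ge_at_top[of "nat \<lceil>norm x\<rceil>"] eventually_ge_at_top[of "nat \<lceil>\<bar>f x\<bar>\<rceil>"]
      proof eventually_elim
        case (elim k)
        then have "cut k x = 1" "tr k (f x) = f x" by (auto simp: cut_def tr_def)
        then show ?case by (simp add: F_def)
      qed
      then have "eventually (\<lambda>k. \<bar>f x - F k x\<bar> = 0 * f x) sequentially" by eventually_elim simp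
      then show "(\<lambda>k. \<bar>f x - F k x\<bar>) \<longlonglongrightarrow> 0 * f x" by (rule tendsto_eventually)
    qed
    show "AE x in lborel. norm \<bar>f x - F k x\<bar> \<le> 2 * \<bar>f x\<bar>" for k
    proof (intro always_eventually allI)
      fix x show "norm \<bar>f x - F k x\<bar> \<le> 2 * \<bar>f x\<bar>" using Fb[of k x] by (simp add: abs_if split: if_splits)
    qed
  qed (use f in \<open>auto simp: F_def\<close>)
  then have "eventually (\<lambda>k. (LINT x|lborel. \<bar>f x - F k x\<bar>) < e / 2) sequentially"
    using e by (intro order_tendstoD(2)) auto
  then obtain k where k: "(LINT x|lborel. \<bar>f x - F k x\<bar>) < e / 2"
    using eventually_happens by force
  have "f measurable_on UNIV"
    by (rule lebesgue_measurable_imp_measurable_on) (auto intro: measurable_completion)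
  then obtain N g where N: "negligible N" and g: "\<And>n. continuous_on UNIV (g n)"
    "\<And>x. x \<notin> N \<Longrightarrow> (\<lambda>n. g n x) \<longlonglongrightarrow> f x"
    unfolding measurable_on_def by auto
  have [measurable]: "g n \<in> borel_measurable borel" for n
    by (rule borel_measurable_continuous_onI[OF g(1)])
  have ae: "AE x in lborel. (\<lambda>n. g n x) \<longlonglongrightarrow> f x"
  proof -
    have "AE x in lebesgue. x \<notin> N" using N by (simp add: AE_not_in negligible_iff_null_sets)
    then have "AE x in lebesgue. (\<lambda>n. g n x) \<longlonglongrightarrow> f x" by eventually_elim (rule g(2))
    then show ?thesis by (simp add: AE_completion_iff)
  qed
  define H where "H n x = cut k x * tr k (g n x)" for n x
  have icut: "integrable lborel (cut k)"
    by (rule integrable_compact_support[OF cutc, of "real k + 1"]) (auto simp: cut_def)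
  have "(\<lambda>n. LINT x|lborel. \<bar>F k x - H n x\<bar>) \<longlonglongrightarrow> (LINT x|lborel. (0::real) * f x)"
  proof (rule integral_dominated_convergence[where w="\<lambda>x. 2 * real k * cut k x"])
    show "AE x in lborel. (\<lambda>n. \<bar>F k x - H n x\<bar>) \<longlonglongrightarrow> 0 * f x"
      using ae
    proof eventually_elim
      case (elim x)
      have "isCont (tr k) (f x)" using trc[of k] by (simp add: continuous_on_eq_continuous_at)
      from isCont_tendsto_compose[OF this elim] have "(\<lambda>n. tr k (g n x)) \<longlonglongrightarrow> tr k (f x)" .
      then have "(\<lambda>n. \<bar>F k x - H n x\<bar>) \<longlonglongrightarrow> \<bar>F k x - cut k x * tr k (f x)\<bar>"
        unfolding H_def by (intro tendsto_intros)
      then show ?case by (simp add: F_def)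
    qed
    show "AE x in lborel. norm \<bar>F k x - H n x\<bar> \<le> 2 * real k * cut k x" for n
    proof (intro always_eventually allI)
      fix x
      have "\<bar>F k x - H n x\<bar> = cut k x * \<bar>tr k (f x) - tr k (g n x)\<bar>"
        using cut01[of k x] by (simp add: F_def H_def abs_mult flip: right_diff_distrib)
      also have "\<dots> \<le> cut k x * (2 * real k)"
        using trb(2)[of k "f x"] trb(2)[of k "g n x"] cut01 by (intro mult_left_mono) auto
      finally show "norm \<bar>F k x - H n x\<bar> \<le> 2 * real k * cut k x" by (simp add: mult_ac)
    qed
  qed (use icut in \<open>auto simp: F_def H_def\<close>)
  then have "eventually (\<lambda>n. (LINT x|lborel. \<bar>F k x - H n x\<bar>) < e / 2) sequentially"
    using e by (intro order_tendstoD(2)) auto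
  then obtain n where n: "(LINT x|lborel. \<bar>F k x - H n x\<bar>) < e / 2"
    using eventually_happens by force
  have iF: "integrable lborel (F k)"
  proof (rule Bochner_Integration.integrable_bound[OF f])
    show "F k \<in> borel_measurable lborel" unfolding F_def by measurable
  qed (auto simp: Fb)
  have Hc: "continuous_on UNIV (H n)"
    unfolding H_def
    by (intro continuous_intros cutc continuous_on_compose2[OF trc g(1)]) auto
  have Hz: "H n x = 0" if "real k + 1 \<le> norm x" for x using that by (simp add: H_def cut_def)
  have iH: "integrable lborel (H n)" by (rule integrable_compact_support[OF Hc Hz])
  have "(LINT x|lborel. \<bar>f x - H n x\<bar>) \<le> (LINT x|lborel. \<bar>f x - F k x\<bar> + \<bar>F k x - H n x\<bar>)"
    using f iF iH by (intro integral_mono) auto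
  also have "\<dots> < e" using k n f iF iH by simp
  finally show ?thesis using that[OF Hc Hz] by auto
qed

text \<open>The kernel has mass 1 and lives on the ball of radius \<open>r\<close>, so
  \<open>moll r h x - h x\<close> is an average of \<open>h y - h x\<close> over that ball.\<close>

lemma moll_minus_bound:
  fixes h :: "'a::euclidean_space \<Rightarrow> real"
  assumes r: "r > 0" and h: "integrable lborel h" and d: "\<And>y. dist x y < r \<Longrightarrow> \<bar>h y - h x\<bar> \<le> e"
  shows "\<bar>moll r h x - h x\<bar> \<le> e"
proof -
  have i: "integrable lborel (\<lambda>y. eta r (x - y))" by (rule eta_shift_integrable[OF r])
  have i2: "integrable lborel (\<lambda>y. eta r (x - y) *\<^sub>R h y)" by (rule moll_integrand_integrable[OF r h])
  have "moll r h x - h x = (LINT y|lborel. eta r (x - y) *\<^sub>R h y - eta r (x - y) * h x)"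
    using i i2 by (simp add: moll_def eta_shift_integral[OF r])
  also have "\<bar>\<dots>\<bar> \<le> (LINT y|lborel. \<bar>eta r (x - y) *\<^sub>R h y - eta r (x - y) * h x\<bar>)"
    by (rule integral_abs_bound)
  also have "\<dots> \<le> (LINT y|lborel. eta r (x - y) * e)"
  proof (rule integral_mono)
    fix y
    have "\<bar>eta r (x - y) *\<^sub>R h y - eta r (x - y) * h x\<bar> = eta r (x - y) * \<bar>h y - h x\<bar>"
      by (simp add: abs_mult eta_nonneg flip: right_diff_distrib)
    also have "\<dots> \<le> eta r (x - y) * e"
    proof (cases "dist x y < r")
      case True then show ?thesis using d by (intro mult_left_mono) (auto simp: eta_nonneg)
    next
      case False then show ?thesis by (simp add: eta_zero[OF r] dist_norm)
    qed
    finally show "\<bar>eta r (x - y) *\<^sub>R h y - eta r (x - y) * h x\<bar> \<le> eta r (x - y) * e" .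
  qed (use i i2 in auto)
  also have "\<dots> = e" by (simp add: eta_shift_integral[OF r])
  finally show ?thesis .
qed

text \<open>Uniform continuity bounds the error by \<open>e / (V + 1)\<close> everywhere; for
  \<open>r < 1\<close> the error vanishes outside the ball of radius \<open>R + 1\<close>, whose
  volume is \<open>V\<close>.\<close>

lemma moll_tendsto_L1_compact_support:
  fixes h :: "'a::euclidean_space \<Rightarrow> real"
  assumes hc: "continuous_on UNIV h" and hz: "\<And>x. R \<le> norm x \<Longrightarrow> h x = 0" and e: "e > 0"
  obtains d where "d > 0" "\<And>r. 0 < r \<Longrightarrow> r < d \<Longrightarrow> (\<integral>\<^sup>+x. ennreal \<bar>moll r h x - h x\<bar> \<partial>lborel) \<le> ennreal e"
proof -
  let ?B = "ball (0::'a) (R + 1)"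
  define V where "V = measure lborel ?B"
  have V: "emeasure lborel ?B = ennreal V" "V \<ge> 0"
    unfolding V_def using emeasure_lborel_ball_finite[of "0::'a" "R+1"] by (auto simp: emeasure_eq_ennreal_measure)
  have ih: "integrable lborel h" by (rule integrable_compact_support[OF hc hz])
  have "e / (V + 1) > 0" using e V by simp
  then obtain d where d: "d > 0" "\<And>x y. dist x y < d \<Longrightarrow> dist (h x) (h y) < e / (V + 1)"
    using compact_support_uniform(1)[OF hc hz] unfolding uniformly_continuous_on_def by (metis UNIV_I dist_commute)
  show ?thesis
  proof (rule that[of "min d 1"])
    fix r :: real assume r: "0 < r" "r < min d 1"
    have *: "\<bar>moll r h x - h x\<bar> \<le> e / (V + 1) * indicator ?B x" for x
    proof (cases "x \<in> ?B")
      case True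
      have "\<bar>moll r h x - h x\<bar> \<le> e / (V + 1)"
      proof (rule moll_minus_bound[OF r(1) ih])
        fix y assume "dist x y < r"
        then show "\<bar>h y - h x\<bar> \<le> e / (V + 1)"
          using d(2)[of x y] r by (simp add: dist_real_def abs_minus_commute)
      qed
      then show ?thesis using True by simp
    next
      case False
      have "\<bar>moll r h x - h x\<bar> \<le> 0"
      proof (rule moll_minus_bound[OF r(1) ih])
        fix y assume "dist x y < r"
        then have "R \<le> norm y" using False r norm_triangle_ineq2[of x y] by (simp add: dist_norm)
        then show "\<bar>h y - h x\<bar> \<le> 0" using False by (simp add: hz)
      qed
      then show ?thesis using False by simp
    qed
    have "(\<integral>\<^sup>+x. ennreal \<bar>moll r h x - h x\<bar> \<partial>lborel) \<le> (\<integral>\<^sup>+x. ennreal (e / (V + 1)) * indicator ?B x \<partial>lborel)"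
      by (intro nn_integral_mono order_trans[OF ennreal_leI[OF *]]) (simp add: indicator_def)
    also have "\<dots> = ennreal (e / (V + 1)) * ennreal V" by (subst nn_integral_cmult_indicator) (auto simp: V)
    also have "\<dots> = ennreal (e / (V + 1) * V)" using V e by (subst ennreal_mult) auto
    also have "\<dots> \<le> ennreal e" using V e by (intro ennreal_leI) (simp add: field_simps)
    finally show "(\<integral>\<^sup>+x. ennreal \<bar>moll r h x - h x\<bar> \<partial>lborel) \<le> ennreal e" .
  qed (use d in auto)
qed

lemma moll_integrable:
  fixes f :: "'a::euclidean_space \<Rightarrow> 'b::euclidean_space"
  assumes "r > 0" "integrable lborel f"
  shows "integrable lborel (moll r f)"
proof (rule integrableI_bounded)
  show "moll r f \<in> borel_measurable lborel" using moll_measurable[OF assms] by simp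
  show "(\<integral>\<^sup>+x. ennreal (norm (moll r f x)) \<partial>lborel) < \<infinity>"
    using moll_L1_le[OF assms] assms(2) by (auto simp: integrable_iff_bounded intro: le_less_trans)
qed

text \<open>A density argument: the contraction property carries the error of replacing
  \<open>f\<close> by \<open>h\<close> through the mollification, uniformly in the radius.\<close>

lemma moll_tendsto_L1:
  fixes f :: "'a::euclidean_space \<Rightarrow> real"
  assumes f: "integrable lborel f" and r: "\<And>n. r n > 0" "r \<longlonglongrightarrow> 0"
  shows "(\<lambda>n. LINT x|lborel. norm (moll (r n) f x - f x)) \<longlonglongrightarrow> 0"
proof (rule LIMSEQ_I)
  fix e :: real assume e: "e > 0"
  then have "e / 4 > 0" by simp
  then obtain h R where h: "continuous_on UNIV h" "\<And>x. R \<le> norm x \<Longrightarrow> h x = 0" "R \<ge> 0"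
    "(LINT x|lborel. \<bar>f x - h x\<bar>) < e / 4"
    using L1_dense_compact_support[OF f, of "e / 4"] by blast
  obtain d where d: "d > 0" "\<And>r. 0 < r \<Longrightarrow> r < d \<Longrightarrow> (\<integral>\<^sup>+x. ennreal \<bar>moll r h x - h x\<bar> \<partial>lborel) \<le> ennreal (e / 4)"
    using moll_tendsto_L1_compact_support[OF h(1,2) \<open>e / 4 > 0\<close>] by blast
  have ih: "integrable lborel h" by (rule integrable_compact_support[OF h(1,2)])
  have "eventually (\<lambda>n. r n < d) sequentially" using r(2) d(1) by (rule order_tendstoD(2))
  then obtain N where N: "\<And>n. n \<ge> N \<Longrightarrow> r n < d" unfolding eventually_sequentially by blast
  show "\<exists>no. \<forall>n\<ge>no. norm ((LINT x|lborel. norm (moll (r n) f x - f x)) - 0) < e"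
  proof (intro exI[of _ N] allI impI)
    fix n assume n: "n \<ge> N"
    have im: "integrable lborel (moll (r n) h)" "integrable lborel (moll (r n) f)"
      using r f ih by (auto intro: moll_integrable)
    have lin: "moll (r n) f x - moll (r n) h x = moll (r n) (\<lambda>x. f x - h x) x" for x
      using moll_integrand_integrable[OF r(1) f, of n x] moll_integrand_integrable[OF r(1) ih, of n x]
      by (simp add: moll_def right_diff_distrib)
    have fh: "integrable lborel (\<lambda>x. f x - h x)" using f ih by simp
    have "(\<integral>\<^sup>+x. ennreal (norm (moll (r n) (\<lambda>x. f x - h x) x)) \<partial>lborel) \<le> (\<integral>\<^sup>+x. ennreal (norm (f x - h x)) \<partial>lborel)"
      by (rule moll_L1_le[OF r(1) fh])
    also have "\<dots> = ennreal (LINT x|lborel. \<bar>f x - h x\<bar>)"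
      using fh by (subst nn_integral_eq_integral) auto
    also have "(\<integral>\<^sup>+x. ennreal (norm (moll (r n) (\<lambda>x. f x - h x) x)) \<partial>lborel) =
        ennreal (LINT x|lborel. \<bar>moll (r n) (\<lambda>x. f x - h x) x\<bar>)"
      using moll_integrable[OF r(1) fh] by (subst nn_integral_eq_integral) auto
    finally have 1: "(LINT x|lborel. \<bar>moll (r n) (\<lambda>x. f x - h x) x\<bar>) < e / 4"
      using h(4) by (subst (asm) ennreal_le_iff) auto
    have "ennreal (LINT x|lborel. \<bar>moll (r n) h x - h x\<bar>) \<le> ennreal (e / 4)"
      using d(2)[OF r(1) N[OF n]] im ih by (subst (asm) nn_integral_eq_integral) auto
    then have 2: "(LINT x|lborel. \<bar>moll (r n) h x - h x\<bar>) \<le> e / 4"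
      using e by (subst (asm) ennreal_le_iff) auto
    have "(LINT x|lborel. \<bar>moll (r n) f x - f x\<bar>) \<le>
      (LINT x|lborel. \<bar>moll (r n) (\<lambda>x. f x - h x) x\<bar> + \<bar>moll (r n) h x - h x\<bar> + \<bar>f x - h x\<bar>)"
      using f ih im moll_integrable[OF r(1) fh] by (intro integral_mono) (auto simp flip: lin)
    also have "\<dots> = (LINT x|lborel. \<bar>moll (r n) (\<lambda>x. f x - h x) x\<bar>) + (LINT x|lborel. \<bar>moll (r n) h x - h x\<bar>)
       + (LINT x|lborel. \<bar>f x - h x\<bar>)"
      using f ih im moll_integrable[OF r(1) fh] by simp
    also have "\<dots> < e" using 1 2 h(4) e by linarith
    finally show "norm ((LINT x|lborel. norm (moll (r n) f x - f x)) - 0) < e" by simp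
  qed
qed

text \<open>\<open>L\<^sup>1\<close> convergence gives almost everywhere convergence along a
  subsequence, which is the form that Fatou's lemma takes as input.\<close>

lemma moll_AE_subseq:
  fixes f :: "'a::euclidean_space \<Rightarrow> real"
  assumes f: "integrable lborel f" and r: "\<And>n. r n > 0" "r \<longlonglongrightarrow> 0"
  obtains s :: "nat \<Rightarrow> nat" where "strict_mono s" "AE x in lborel. (\<lambda>n. moll (r (s n)) f x) \<longlonglongrightarrow> f x"
proof -
  have "\<exists>s::nat\<Rightarrow>nat. strict_mono s \<and> (AE x in lborel. (\<lambda>n. moll (r (s n)) f x - f x) \<longlonglongrightarrow> 0)"
    using moll_tendsto_L1[OF assms] f moll_integrable[OF r(1) f]
    by (intro tendsto_L1_AE_subseq[where u="\<lambda>n x. moll (r n) f x - f x"]) auto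
  then show ?thesis using that by (auto simp: LIM_zero_iff)
qed

section \<open>Weak gradients\<close>

text \<open>Borel representatives extended by zero, so that all integrals are over the whole space.\<close>
definition sob :: "'a::euclidean_space set \<Rightarrow> ('a \<Rightarrow> real) \<Rightarrow> ('a \<Rightarrow> 'a) \<Rightarrow> bool" where
  "sob \<Omega> u g \<longleftrightarrow> u \<in> borel_measurable borel \<and> g \<in> borel_measurable borel \<and>
     (\<forall>x. x \<notin> \<Omega> \<longrightarrow> u x = 0 \<and> g x = 0) \<and>
     integrable lborel (\<lambda>x. (u x)\<^sup>2) \<and> integrable lborel (\<lambda>x. (norm (g x))\<^sup>2) \<and>
     (\<forall>\<phi>. test_fun \<Omega> \<phi> \<longrightarrow> (\<forall>i\<in>Basis.
        (LINT x|lborel. u x * dir_deriv i \<phi> x) = - (LINT x|lborel. (g x \<bullet> i) * \<phi> x)))"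

lemma sobD:
  assumes "sob \<Omega> u g"
  shows "u \<in> borel_measurable borel" "g \<in> borel_measurable borel"
    "x \<notin> \<Omega> \<Longrightarrow> u x = 0" "x \<notin> \<Omega> \<Longrightarrow> g x = 0"
    "integrable lborel (\<lambda>x. (u x)\<^sup>2)" "integrable lborel (\<lambda>x. (norm (g x))\<^sup>2)"
    "test_fun \<Omega> \<phi> \<Longrightarrow> i \<in> Basis \<Longrightarrow>
        (LINT x|lborel. u x * dir_deriv i \<phi> x) = - (LINT x|lborel. (g x \<bullet> i) * \<phi> x)"
proof -
  note d = assms[unfolded sob_def]
  show "u \<in> borel_measurable borel" using d by (elim conjE)
  show "g \<in> borel_measurable borel" using d by (elim conjE)
  note z = d[THEN conjunct2, THEN conjunct2, THEN conjunct1]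
  show "x \<notin> \<Omega> \<Longrightarrow> u x = 0" using z by blast
  show "x \<notin> \<Omega> \<Longrightarrow> g x = 0" using z by blast
  show "integrable lborel (\<lambda>x. (u x)\<^sup>2)" using d by (elim conjE)
  show "integrable lborel (\<lambda>x. (norm (g x))\<^sup>2)" using d by (elim conjE)
  show "test_fun \<Omega> \<phi> \<Longrightarrow> i \<in> Basis \<Longrightarrow>
        (LINT x|lborel. u x * dir_deriv i \<phi> x) = - (LINT x|lborel. (g x \<bullet> i) * \<phi> x)"
    using d[THEN conjunct2, THEN conjunct2, THEN conjunct2, THEN conjunct2, THEN conjunct2, rule_format] .
qed

text \<open>The complement of the closed support is open and \<open>\<phi>\<close> is zero on it, so
  the derivative vanishes there too.\<close>

lemma test_fun_outside:
  assumes "test_fun \<Omega> \<phi>" "x \<notin> \<Omega>"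
  shows "\<phi> x = 0" "dir_deriv i \<phi> x = 0"
proof -
  let ?U = "- closure {x. \<phi> x \<noteq> 0}"
  have x: "x \<in> ?U" using assms unfolding test_fun_def by blast
  have z: "\<And>y. y \<in> ?U \<Longrightarrow> 0 = \<phi> y" using closure_subset[of "{x. \<phi> x \<noteq> 0}"] by auto
  show "\<phi> x = 0" using z[OF x] by simp
  have "(\<phi> has_derivative (\<lambda>_. 0)) (at x)"
    by (rule has_derivative_transform_within_open[OF has_derivative_const _ x z]) auto
  from frechet_derivative_at[OF this] show "dir_deriv i \<phi> x = 0"
    unfolding dir_deriv_def by metis
qed

lemma test_fun_mono: "test_fun D \<phi> \<Longrightarrow> D \<subseteq> \<Omega> \<Longrightarrow> test_fun \<Omega> \<phi>"
  unfolding test_fun_def by blast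

text \<open>A test function of \<open>D\<close> is one of the larger set and vanishes off
  \<open>D\<close> together with its derivatives, so the indicators drop out of the defining
  identity.\<close>

lemma sob_restrict:
  fixes \<Omega> D :: "'a::euclidean_space set"
  assumes s: "sob \<Omega> u g" and D: "D \<in> sets borel" "D \<subseteq> \<Omega>"
  shows "sob D (\<lambda>x. indicator D x * u x) (\<lambda>x. indicator D x *\<^sub>R g x)"
proof -
  note [measurable] = sobD(1,2)[OF s] D(1)
  show ?thesis
    unfolding sob_def
  proof (intro conjI allI impI ballI)
    show "(\<lambda>x. indicator D x * u x) \<in> borel_measurable borel" "(\<lambda>x. indicator D x *\<^sub>R g x) \<in> borel_measurable borel"
      by measurable
    show "integrable lborel (\<lambda>x. (indicator D x * u x)\<^sup>2)"
      by (rule Bochner_Integration.integrable_bound[OF sobD(5)[OF s]]) (auto simp: indicator_def)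
    show "integrable lborel (\<lambda>x. (norm (indicator D x *\<^sub>R g x))\<^sup>2)"
      by (rule Bochner_Integration.integrable_bound[OF sobD(6)[OF s]]) (auto simp: indicator_def)
    fix \<phi> :: "'a \<Rightarrow> real" and i :: 'a assume t: "test_fun D \<phi>" and i: "i \<in> Basis"
    have "(LINT x|lborel. indicator D x * u x * dir_deriv i \<phi> x) = (LINT x|lborel. u x * dir_deriv i \<phi> x)"
      by (intro Bochner_Integration.integral_cong refl) (auto simp: indicator_def test_fun_outside[OF t])
    also have "\<dots> = - (LINT x|lborel. (g x \<bullet> i) * \<phi> x)"
      by (rule sobD(7)[OF s test_fun_mono[OF t D(2)] i])
    also have "(LINT x|lborel. (g x \<bullet> i) * \<phi> x) = (LINT x|lborel. ((indicator D x *\<^sub>R g x) \<bullet> i) * \<phi> x)"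
      by (intro Bochner_Integration.integral_cong refl) (auto simp: indicator_def test_fun_outside[OF t])
    finally show "(LINT x|lborel. indicator D x * u x * dir_deriv i \<phi> x) =
      - (LINT x|lborel. ((indicator D x *\<^sub>R g x) \<bullet> i) * \<phi> x)" .
  qed auto
qed

text \<open>On a bounded set the inequality \<open>t \<le> 1 + t\<^sup>2\<close> provides an
  integrable majorant.\<close>

lemma integrable_of_square:
  fixes f :: "'a::euclidean_space \<Rightarrow> 'b::euclidean_space"
  assumes "bounded \<Omega>" "f \<in> borel_measurable borel" "\<And>x. x \<notin> \<Omega> \<Longrightarrow> f x = 0"
    and f2: "integrable lborel (\<lambda>x. (norm (f x))\<^sup>2)"
  shows "integrable lborel f"
proof -
  obtain R where R: "\<Omega> \<subseteq> ball 0 R" using assms(1) bounded_subset_ballD by blast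
  have "integrable lborel (\<lambda>x. indicator (ball 0 R) x + (norm (f x))\<^sup>2)"
    using f2 emeasure_lborel_ball_finite by (intro Bochner_Integration.integrable_add integrable_real_indicator) auto
  then show ?thesis
  proof (rule Bochner_Integration.integrable_bound)
    show "AE x in lborel. norm (f x) \<le> norm (indicator (ball 0 R) x + (norm (f x))\<^sup>2)"
    proof (intro always_eventually allI)
      fix x
      show "norm (f x) \<le> norm (indicator (ball 0 R) x + (norm (f x))\<^sup>2)"
      proof (cases "x \<in> \<Omega>")
        case True
        have "0 \<le> (norm (f x) - 1)\<^sup>2" by simp
        then have "2 * norm (f x) \<le> 1 + (norm (f x))\<^sup>2" by (simp add: power2_eq_square algebra_simps)
        moreover have "norm (f x) \<ge> 0" by simp
        ultimately have "norm (f x) \<le> 1 + (norm (f x))\<^sup>2" by linarith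
        then show ?thesis using True R by auto
      qed (simp add: assms)
    qed
  qed (use assms in auto)
qed

lemma sob_integrable:
  assumes "sob \<Omega> u g" "bounded \<Omega>"
  shows "integrable lborel u" "integrable lborel g"
  using integrable_of_square[OF assms(2), of u] integrable_of_square[OF assms(2), of g] sobD[OF assms(1)]
  by auto

text \<open>Gradient and mollification commute where the kernel ball stays in the domain: testing
  with the kernel moves the derivative from the kernel to \<open>u\<close>, and the sign of
  integration by parts cancels the sign from differentiating \<open>x - y\<close> in
  \<open>y\<close>.\<close>

lemma sob_moll_has_derivative:
  assumes s: "sob \<Omega> u g" and b: "bounded \<Omega>" and r: "r > 0" and x: "cball x r \<subseteq> \<Omega>"
  shows "(moll r u has_derivative (\<lambda>h. moll r g x \<bullet> h)) (at x)"
proof -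
  let ?G = "LINT y|lborel. u y *\<^sub>R eta_grad r (x - y)"
  note iu = sob_integrable(1)[OF s b] and ig = sob_integrable(2)[OF s b]
  obtain B where B: "\<And>z::'a. norm (eta_grad r z) \<le> B"
    using compact_support_uniform(2)[OF eta_grad_continuous, of r r, OF eta_grad_zero[OF r]] by blast
  have [measurable]: "u \<in> borel_measurable borel" using s by (rule sobD)
  have intG: "integrable lborel (\<lambda>y. u y *\<^sub>R eta_grad r (x - y))"
  proof (rule Bochner_Integration.integrable_bound[of _ "\<lambda>y. B * u y"])
    show "AE y in lborel. norm (u y *\<^sub>R eta_grad r (x - y)) \<le> norm (B * u y)"
      using B by (intro always_eventually allI)
        (auto simp: abs_mult mult.commute[of "\<bar>B\<bar>"] intro!: mult_left_mono order_trans[OF B abs_ge_self])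
  qed (use iu in auto)
  have "?G = moll r g x"
  proof (rule euclidean_eqI)
    fix i :: 'a assume i: "i \<in> Basis"
    have "?G \<bullet> i = (LINT y|lborel. (u y *\<^sub>R eta_grad r (x - y)) \<bullet> i)"
      by (rule integral_inner_left[OF intG, symmetric])
    also have "\<dots> = - (LINT y|lborel. u y * dir_deriv i (\<lambda>y. eta r (x - y)) y)"
      by (simp add: eta_dir_deriv)
    also have "\<dots> = (LINT y|lborel. (g y \<bullet> i) * eta r (x - y))"
      by (subst sobD(7)[OF s eta_test_fun[OF r x] i]) simp
    also have "\<dots> = (LINT y|lborel. (eta r (x - y) *\<^sub>R g y) \<bullet> i)"
      by (intro Bochner_Integration.integral_cong refl) simp
    also have "\<dots> = moll r g x \<bullet> i"
      unfolding moll_def by (rule integral_inner_left[OF moll_integrand_integrable[OF r ig]])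
    finally show "?G \<bullet> i = moll r g x \<bullet> i" .
  qed
  then show ?thesis using moll_has_derivative[OF r iu, of x] by simp
qed

lemma sob_moll_L2:
  assumes s: "sob \<Omega> u g" and b: "bounded \<Omega>" and r: "r > 0"
  shows "(\<integral>\<^sup>+x. ennreal ((norm (moll r g x))\<^sup>2) \<partial>lborel) \<le> ennreal (LINT x|lborel. (norm (g x))\<^sup>2)"
    "(\<integral>\<^sup>+x. ennreal ((moll r u x)\<^sup>2) \<partial>lborel) \<le> ennreal (LINT x|lborel. (u x)\<^sup>2)"
proof -
  show "(\<integral>\<^sup>+x. ennreal ((norm (moll r g x))\<^sup>2) \<partial>lborel) \<le> ennreal (LINT x|lborel. (norm (g x))\<^sup>2)"
    using moll_L2_le[OF r sob_integrable(2)[OF s b] sobD(6)[OF s]]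
    by (simp add: nn_integral_eq_integral[OF sobD(6)[OF s]])
  show "(\<integral>\<^sup>+x. ennreal ((moll r u x)\<^sup>2) \<partial>lborel) \<le> ennreal (LINT x|lborel. (u x)\<^sup>2)"
    using moll_L2_le[OF r sob_integrable(1)[OF s b]] sobD(5)[OF s]
    by (simp add: nn_integral_eq_integral[OF sobD(5)[OF s]])
qed

lemma moll_AE_sequence:
  fixes f :: "'a::euclidean_space \<Rightarrow> real"
  assumes f: "integrable lborel f"
  obtains r :: "nat \<Rightarrow> real" where "\<And>n. r n > 0" "r \<longlonglongrightarrow> 0" "AE x in lborel. (\<lambda>n. moll (r n) f x) \<longlonglongrightarrow> f x"
proof -
  have 0: "\<And>n. inverse (real (Suc n)) > 0" "(\<lambda>n. inverse (real (Suc n))) \<longlonglongrightarrow> 0"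
    using LIMSEQ_inverse_real_of_nat by auto
  obtain t :: "nat \<Rightarrow> nat" where t: "strict_mono t" "AE x in lborel. (\<lambda>n. moll (inverse (real (Suc (t n)))) f x) \<longlonglongrightarrow> f x"
    using moll_AE_subseq[OF f 0] by blast
  show ?thesis
    by (rule that[of "\<lambda>n. inverse (real (Suc (t n)))"])
       (use t LIMSEQ_subseq_LIMSEQ[OF 0(2) t(1)] in \<open>auto simp: o_def\<close>)
qed

text \<open>A compact subset has positive distance from the complement of an open set, so small
  radii fit uniformly.\<close>

lemma eventually_cball_subset:
  fixes K :: "'a::euclidean_space set" and r :: "nat \<Rightarrow> real"
  assumes "compact K" "open \<Omega>" "K \<subseteq> \<Omega>" "r \<longlonglongrightarrow> 0"
  shows "eventually (\<lambda>n. \<forall>x\<in>K. cball x (r n) \<subseteq> \<Omega>) sequentially"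
proof -
  obtain e where e: "0 < e" "(\<Union>x\<in>K. ball x e) \<subseteq> \<Omega>"
    using compact_subset_open_imp_ball_epsilon_subset[OF assms(1-3)] by blast
  have "eventually (\<lambda>n. r n < e) sequentially" using assms(4) e(1) by (rule order_tendstoD(2))
  then show ?thesis
  proof eventually_elim
    case (elim n)
    show ?case
    proof
      fix x assume "x \<in> K"
      then have "cball x (r n) \<subseteq> ball x e" "ball x e \<subseteq> \<Omega>" using elim e(2) by auto
      then show "cball x (r n) \<subseteq> \<Omega>" by blast
    qed
  qed
qed

section \<open>Translation estimates in L2\<close>

lemma AE_lborel_shift:
  fixes z :: "'a::euclidean_space"
  assumes "AE x in lborel. P x"
  shows "AE x in lborel. P (z + x)"
proof -
  obtain N where N: "{x. \<not> P x} \<subseteq> N" "N \<in> sets borel" "emeasure lborel N = 0"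
    using assms by (auto elim!: AE_E)
  have "emeasure lborel N = emeasure (distr lborel borel ((+) z)) N" by (simp add: lborel_distr_plus)
  also have "\<dots> = emeasure lborel ((+) z -` N)" using N(2) by (subst emeasure_distr) auto
  finally have "(+) z -` N \<in> null_sets lborel" using N(2,3) 
    using measurable_sets[of "(+) z" borel borel N] by (intro null_setsI) auto
  then show ?thesis by (rule AE_I') (use N(1) in auto)
qed

text \<open>Cauchy-Schwarz on the unit interval: \<open>f 1 - f 0\<close> is the mean of
  \<open>f'\<close>, and the variance of \<open>f'\<close> is nonnegative.\<close>

lemma square_increment_le:
  fixes f f' :: "real \<Rightarrow> real"
  assumes d: "\<And>t. 0 \<le> t \<Longrightarrow> t \<le> 1 \<Longrightarrow> (f has_real_derivative f' t) (at t)"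
    and c: "continuous_on UNIV f'"
  shows "ennreal ((f 1 - f 0)\<^sup>2) \<le> (\<integral>\<^sup>+t. ennreal ((f' t)\<^sup>2) * indicator {0..1} t \<partial>lborel)"
proof -
  define a where "a = f 1 - f 0"
  have hb: "has_bochner_integral lborel (\<lambda>x. f' x * indicator {0..1} x) a"
    unfolding a_def by (rule has_bochner_integral_FTC_Icc_real)
     (use d c in \<open>auto simp: continuous_on_eq_continuous_at\<close>)
  have i1: "integrable lborel (\<lambda>t. (f' t)\<^sup>2 * indicator {0..1} t)"
    using borel_integrable_compact[of "{0..1::real}" "\<lambda>t. (f' t)\<^sup>2"]
    by (auto simp: mult.commute intro!: continuous_intros continuous_on_subset[OF c])
  have i2: "integrable lborel (\<lambda>t. f' t * indicator {0..1} t)" "(LINT t|lborel. f' t * indicator {0..1} t) = a"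
    using hb by (auto simp: has_bochner_integral_iff)
  have i3: "integrable lborel (indicator {0..1::real} :: real \<Rightarrow> real)" by (auto intro: integrable_real_indicator)
  have "0 \<le> (LINT t|lborel. (f' t - a)\<^sup>2 * indicator {0..1} t)"
    by (intro Bochner_Integration.integral_nonneg) auto
  also have "\<dots> = (LINT t|lborel. (f' t)\<^sup>2 * indicator {0..1} t - 2 * a * (f' t * indicator {0..1} t) + a\<^sup>2 * indicator {0..1} t)"
    by (intro Bochner_Integration.integral_cong refl) (simp add: power2_eq_square algebra_simps)
  also have "\<dots> = (LINT t|lborel. (f' t)\<^sup>2 * indicator {0..1} t) - a\<^sup>2"
    using i1 i2 i3 by (simp add: power2_eq_square)
  finally have "ennreal (a\<^sup>2) \<le> ennreal (LINT t|lborel. (f' t)\<^sup>2 * indicator {0..1} t)"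
    by (intro ennreal_leI) simp
  also have "\<dots> = (\<integral>\<^sup>+t. ennreal ((f' t)\<^sup>2 * indicator {0..1} t) \<partial>lborel)"
    using i1 by (intro nn_integral_eq_integral[symmetric]) auto
  also have "\<dots> = (\<integral>\<^sup>+t. ennreal ((f' t)\<^sup>2) * indicator {0..1} t \<partial>lborel)"
    by (intro nn_integral_cong) (auto simp: indicator_def)
  finally show ?thesis by (simp add: a_def)
qed

text \<open>For a smooth function the increment is the integral of the derivative along the segment;
  Tonelli and translation invariance turn this into \<open>norm z\<close> times the gradient norm.
  Applied to mollifications and passed to the limit, this gives the bound for
  \<open>u\<close>.\<close>

lemma sob_translate_compact:
  assumes s: "sob \<Omega> u g" and b: "bounded \<Omega>" and o: "open \<Omega>" and K: "compact K"
    and seg: "\<And>x t. x \<in> K \<Longrightarrow> 0 \<le> t \<Longrightarrow> t \<le> 1 \<Longrightarrow> x + t *\<^sub>R z \<in> \<Omega>"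
  shows "(\<integral>\<^sup>+x. ennreal ((u (z + x) - u x)\<^sup>2) * indicator K x \<partial>lborel) \<le>
    ennreal ((norm z)\<^sup>2 * (LINT x|lborel. (norm (g x))\<^sup>2))"
proof -
  obtain r :: "nat \<Rightarrow> real" where r: "\<And>n. r n > 0" "r \<longlonglongrightarrow> 0"
    and ae: "AE x in lborel. (\<lambda>n. moll (r n) u x) \<longlonglongrightarrow> u x"
    using moll_AE_sequence[OF sob_integrable(1)[OF s b]] by blast
  note iu = sob_integrable(1)[OF s b] and ig = sob_integrable(2)[OF s b]
  note [measurable] = sobD(1,2)[OF s] moll_measurable[OF r(1) iu] moll_measurable[OF r(1) ig]
  have [measurable]: "K \<in> sets borel" using K by (simp add: compact_imp_closed)
  let ?K = "(\<lambda>p. fst p + snd p *\<^sub>R z) ` (K \<times> {0..1})"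
  \<comment> \<open>The union of the segments is the continuous image of
    \<open>K \<times> {0..1}\<close>, hence compact, so a small mollification radius fits along all
    of them at once.\<close>
  have "compact ?K"
    by (intro compact_continuous_image continuous_intros compact_Times K) auto
  moreover have "?K \<subseteq> \<Omega>" using seg by auto
  ultimately have ev: "eventually (\<lambda>n. \<forall>x\<in>?K. cball x (r n) \<subseteq> \<Omega>) sequentially"
    using o r(2) by (intro eventually_cball_subset)
  let ?E = "ennreal ((norm z)\<^sup>2 * (LINT x|lborel. (norm (g x))\<^sup>2))"
  have bound: "(\<integral>\<^sup>+x. ennreal ((moll (r n) u (z + x) - moll (r n) u x)\<^sup>2) * indicator K x \<partial>lborel) \<le> ?E"
    if n: "\<forall>x\<in>?K. cball x (r n) \<subseteq> \<Omega>" for n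
  proof -
    let ?G = "moll (r n) g"
    have "(\<integral>\<^sup>+x. ennreal ((moll (r n) u (z + x) - moll (r n) u x)\<^sup>2) * indicator K x \<partial>lborel) \<le>
      (\<integral>\<^sup>+x. \<integral>\<^sup>+t. ennreal ((norm z)\<^sup>2 * (norm (?G (t *\<^sub>R z + x)))\<^sup>2) * indicator {0..1} t \<partial>lborel \<partial>lborel)"
    proof (rule nn_integral_mono)
      fix x
      show "ennreal ((moll (r n) u (z + x) - moll (r n) u x)\<^sup>2) * indicator K x \<le>
        (\<integral>\<^sup>+t. ennreal ((norm z)\<^sup>2 * (norm (?G (t *\<^sub>R z + x)))\<^sup>2) * indicator {0..1} t \<partial>lborel)"
      proof (cases "x \<in> K")
        case True
        have "ennreal ((moll (r n) u (x + 1 *\<^sub>R z) - moll (r n) u (x + 0 *\<^sub>R z))\<^sup>2) \<le>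
          (\<integral>\<^sup>+t. ennreal ((?G (x + t *\<^sub>R z) \<bullet> z)\<^sup>2) * indicator {0..1} t \<partial>lborel)"
        proof (rule square_increment_le)
          fix t :: real assume t: "0 \<le> t" "t \<le> 1"
          then have "x + t *\<^sub>R z \<in> ?K" using True by (force intro: image_eqI[where x="(x, t)"])
          then have c: "cball (x + t *\<^sub>R z) (r n) \<subseteq> \<Omega>" using n by blast
          have "((\<lambda>t. x + t *\<^sub>R z) has_derivative (\<lambda>h. h *\<^sub>R z)) (at t)"
            by (auto intro!: derivative_eq_intros)
          from has_derivative_compose[OF this sob_moll_has_derivative[OF s b r(1) c]]
          show "((\<lambda>t. moll (r n) u (x + t *\<^sub>R z)) has_real_derivative ?G (x + t *\<^sub>R z) \<bullet> z) (at t)"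
            by (simp add: has_field_derivative_def mult.commute[of _ "_ \<bullet> _"])
        next
          show "continuous_on UNIV (\<lambda>t. ?G (x + t *\<^sub>R z) \<bullet> z)"
            by (intro continuous_intros continuous_on_compose2[OF moll_continuous[OF r(1) ig]]) auto
        qed
        also have "\<dots> \<le> (\<integral>\<^sup>+t. ennreal ((norm z)\<^sup>2 * (norm (?G (t *\<^sub>R z + x)))\<^sup>2) * indicator {0..1} t \<partial>lborel)"
        proof (intro nn_integral_mono mult_right_mono ennreal_leI)
          fix t
          have "(?G (x + t *\<^sub>R z) \<bullet> z)\<^sup>2 \<le> (norm (?G (x + t *\<^sub>R z)) * norm z)\<^sup>2"
            using Cauchy_Schwarz_ineq2 by (metis abs_le_square_iff abs_norm_cancel abs_mult)
          then show "(?G (x + t *\<^sub>R z) \<bullet> z)\<^sup>2 \<le> (norm z)\<^sup>2 * (norm (?G (t *\<^sub>R z + x)))\<^sup>2"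
            by (simp add: power_mult_distrib mult.commute add.commute)
        qed auto
        finally show ?thesis using True by (simp add: add.commute)
      qed simp
    qed
    also have "\<dots> = (\<integral>\<^sup>+t. \<integral>\<^sup>+x. ennreal ((norm z)\<^sup>2 * (norm (?G (t *\<^sub>R z + x)))\<^sup>2) * indicator {0..1} t \<partial>lborel \<partial>lborel)"
      by (rule lborel_pair.Fubini') measurable
    also have "\<dots> = (\<integral>\<^sup>+t. ennreal ((norm z)\<^sup>2) * (\<integral>\<^sup>+x. ennreal ((norm (?G x))\<^sup>2) \<partial>lborel) * indicator {0..1::real} t \<partial>lborel)"
    proof (intro nn_integral_cong)
      fix t :: real
      have "(\<integral>\<^sup>+x. ennreal ((norm z)\<^sup>2 * (norm (?G (t *\<^sub>R z + x)))\<^sup>2) * indicator {0..1} t \<partial>lborel) =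
        (\<integral>\<^sup>+x. ennreal ((norm z)\<^sup>2 * (norm (?G x))\<^sup>2) * indicator {0..1} t \<partial>lborel)"
        by (rule nn_integral_lborel_shift[of "\<lambda>x. ennreal ((norm z)\<^sup>2 * (norm (?G x))\<^sup>2) * indicator {0..1} t"]) measurable
      also have "\<dots> = ennreal ((norm z)\<^sup>2) * (\<integral>\<^sup>+x. ennreal ((norm (?G x))\<^sup>2) \<partial>lborel) * indicator {0..1::real} t"
        by (simp add: nn_integral_multc nn_integral_cmult ennreal_mult)
      finally show "(\<integral>\<^sup>+x. ennreal ((norm z)\<^sup>2 * (norm (?G (t *\<^sub>R z + x)))\<^sup>2) * indicator {0..1} t \<partial>lborel) =
        ennreal ((norm z)\<^sup>2) * (\<integral>\<^sup>+x. ennreal ((norm (?G x))\<^sup>2) \<partial>lborel) * indicator {0..1::real} t" .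
    qed
    also have "\<dots> = ennreal ((norm z)\<^sup>2) * (\<integral>\<^sup>+x. ennreal ((norm (?G x))\<^sup>2) \<partial>lborel)"
      by (subst nn_integral_cmult_indicator) auto
    also have "\<dots> \<le> ennreal ((norm z)\<^sup>2) * ennreal (LINT x|lborel. (norm (g x))\<^sup>2)"
      by (intro mult_left_mono sob_moll_L2(1)[OF s b r(1)]) auto
    also have "\<dots> = ?E" by (simp add: ennreal_mult)
    finally show ?thesis .
  qed
  \<comment> \<open>Fatou's lemma along the almost everywhere convergent mollifications, used both
    at \<open>x\<close> and at the shifted point \<open>z + x\<close>.\<close>
  have "(\<integral>\<^sup>+x. ennreal ((u (z + x) - u x)\<^sup>2) * indicator K x \<partial>lborel) \<le>
    (\<integral>\<^sup>+x. liminf (\<lambda>n. ennreal ((moll (r n) u (z + x) - moll (r n) u x)\<^sup>2) * indicator K x) \<partial>lborel)"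
  proof (rule nn_integral_mono_AE)
    show "AE x in lborel. ennreal ((u (z + x) - u x)\<^sup>2) * indicator K x \<le>
      liminf (\<lambda>n. ennreal ((moll (r n) u (z + x) - moll (r n) u x)\<^sup>2) * indicator K x)"
      using ae AE_lborel_shift[OF ae, of z]
    proof eventually_elim
      case (elim x)
      have "(\<lambda>n. ennreal ((moll (r n) u (z + x) - moll (r n) u x)\<^sup>2) * indicator K x) \<longlonglongrightarrow>
        ennreal ((u (z + x) - u x)\<^sup>2) * indicator K x"
        by (cases "x \<in> K") (auto intro!: tendsto_intros elim)
      from lim_imp_Liminf[OF _ this] show ?case by simp
    qed
  qed
  also have "\<dots> \<le> liminf (\<lambda>n. \<integral>\<^sup>+x. ennreal ((moll (r n) u (z + x) - moll (r n) u x)\<^sup>2) * indicator K x \<partial>lborel)"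
    by (rule nn_integral_liminf) measurable
  also have "\<dots> \<le> liminf (\<lambda>n. ?E)"
    by (rule Liminf_mono) (use ev bound in \<open>auto elim: eventually_mono\<close>)
  also have "\<dots> = ?E" by (simp add: Liminf_const)
  finally show ?thesis .
qed

text \<open>The bound does not depend on the compact set, so an exhaustion and monotone convergence
  carry it to the open one.\<close>

lemma sob_translate_open:
  assumes s: "sob \<Omega> u g" and b: "bounded \<Omega>" and o: "open \<Omega>" and A: "open A"
    and seg: "\<And>x t. x \<in> A \<Longrightarrow> 0 \<le> t \<Longrightarrow> t \<le> 1 \<Longrightarrow> x + t *\<^sub>R z \<in> \<Omega>"
  shows "(\<integral>\<^sup>+x. ennreal ((u (z + x) - u x)\<^sup>2) * indicator A x \<partial>lborel) \<le>
    ennreal ((norm z)\<^sup>2 * (LINT x|lborel. (norm (g x))\<^sup>2))"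
proof -
  note [measurable] = sobD(1)[OF s]
  obtain C :: "nat \<Rightarrow> 'a set" where C: "\<And>n. compact (C n)" "\<And>n. C n \<subseteq> A" "\<And>n. C n \<subseteq> interior (C (Suc n))" "\<Union>(range C) = A"
    using open_Union_compact_subsets[OF A] by metis
  have "mono C" using C(3) interior_subset by (intro mono_iff_le_Suc[THEN iffD2]) blast
  have [measurable]: "C n \<in> sets borel" for n using C(1) by (simp add: compact_imp_closed)
  let ?f = "\<lambda>x. ennreal ((u (z + x) - u x)\<^sup>2)"
  have "?f x * indicator A x = (SUP n. ?f x * indicator (C n) x)" for x
  proof -
    have "(SUP n. ?f x * indicator (C n) x) = ?f x * (SUP n. indicator (C n) x)"
      by (simp add: SUP_mult_left_ennreal)
    also have "(SUP n. indicator (C n) x :: ennreal) = indicator A x"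
    proof (cases "x \<in> A")
      case True
      then obtain m where "x \<in> C m" using C(4) by auto
      then have "1 \<le> (SUP n. indicator (C n) x :: ennreal)" by (intro SUP_upper2[of m]) auto
      moreover have "(SUP n. indicator (C n) x :: ennreal) \<le> 1" by (intro SUP_least) (auto simp: indicator_def)
      ultimately show ?thesis using True by (auto intro: order.antisym)
    next
      case False
      then have "\<And>n. x \<notin> C n" using C(2) by blast
      then show ?thesis using False by simp
    qed
    finally show ?thesis by simp
  qed
  then have "(\<integral>\<^sup>+x. ?f x * indicator A x \<partial>lborel) = (\<integral>\<^sup>+x. (SUP n. ?f x * indicator (C n) x) \<partial>lborel)" by simp
  also have "\<dots> = (SUP n. \<integral>\<^sup>+x. ?f x * indicator (C n) x \<partial>lborel)"
    by (rule nn_integral_monotone_convergence_SUP)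
       (use \<open>mono C\<close> in \<open>auto simp: incseq_def le_fun_def mono_def indicator_def\<close>)
  also have "\<dots> \<le> ennreal ((norm z)\<^sup>2 * (LINT x|lborel. (norm (g x))\<^sup>2))"
    by (intro SUP_least sob_translate_compact[OF s b o C(1)] seg) (use C(2) in blast)+
  finally show ?thesis .
qed

section \<open>Compactness in \<open>L\<^sup>2\<close>\<close>

text \<open>Rellich compactness in quantitative form: subsequences then only have to be chosen for
  countably many bounded real sequences.\<close>
definition functional_bound :: "'a::euclidean_space set \<Rightarrow> 'a set \<Rightarrow> real \<Rightarrow> ('a \<Rightarrow> real) set \<Rightarrow> real \<Rightarrow> bool" where
  "functional_bound \<Omega> A \<epsilon> \<Phi> C \<longleftrightarrow> finite \<Phi> \<and> C \<ge> 0 \<and>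
     (\<forall>\<phi>\<in>\<Phi>. \<phi> \<in> borel_measurable borel \<and> bounded (range \<phi>)) \<and>
     (\<forall>u g. sob \<Omega> u g \<longrightarrow> (\<integral>\<^sup>+x. ennreal ((u x)\<^sup>2) * indicator A x \<partial>lborel) \<le>
        ennreal (\<epsilon> * ((LINT x|lborel. (u x)\<^sup>2) + (LINT x|lborel. (norm (g x))\<^sup>2)) +
          C * (\<Sum>\<phi>\<in>\<Phi>. (LINT x|lborel. u x * \<phi> x)\<^sup>2)))"

lemma functional_boundD:
  assumes "functional_bound \<Omega> A \<epsilon> \<Phi> C"
  shows "finite \<Phi>" "C \<ge> 0" "\<forall>\<phi>\<in>\<Phi>. \<phi> \<in> borel_measurable borel \<and> bounded (range \<phi>)"
    "sob \<Omega> u g \<Longrightarrow> (\<integral>\<^sup>+x. ennreal ((u x)\<^sup>2) * indicator A x \<partial>lborel) \<le>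
        ennreal (\<epsilon> * ((LINT x|lborel. (u x)\<^sup>2) + (LINT x|lborel. (norm (g x))\<^sup>2)) +
          C * (\<Sum>\<phi>\<in>\<Phi>. (LINT x|lborel. u x * \<phi> x)\<^sup>2))"
proof -
  note d = assms[unfolded functional_bound_def]
  show "finite \<Phi>" "C \<ge> 0" using d by blast+
  show "\<forall>\<phi>\<in>\<Phi>. \<phi> \<in> borel_measurable borel \<and> bounded (range \<phi>)" using d by (elim conjE)
  show "(\<integral>\<^sup>+x. ennreal ((u x)\<^sup>2) * indicator A x \<partial>lborel) \<le>
        ennreal (\<epsilon> * ((LINT x|lborel. (u x)\<^sup>2) + (LINT x|lborel. (norm (g x))\<^sup>2)) +
          C * (\<Sum>\<phi>\<in>\<Phi>. (LINT x|lborel. u x * \<phi> x)\<^sup>2))" if "sob \<Omega> u g"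
    using d[THEN conjunct2, THEN conjunct2, THEN conjunct2, rule_format, OF that] .
qed

text \<open>Quantitative compactness of the restriction from the Sobolev space on
  \<open>\<Omega>\<close> to \<open>L\<^sup>2\<close> on \<open>A\<close>: up to an \<epsilon> of
  the squared Sobolev norm, finitely many integrals against bounded functions control the
  function.\<close>

definition precompact_on :: "'a::euclidean_space set \<Rightarrow> 'a set \<Rightarrow> bool" where
  "precompact_on \<Omega> A \<longleftrightarrow> (\<forall>\<epsilon>>0. \<exists>\<Phi> C. functional_bound \<Omega> A \<epsilon> \<Phi> C)"

lemma sob_integral_nonneg: "0 \<le> (LINT x|lborel. (u x)\<^sup>2)" "0 \<le> (LINT x|lborel. (norm (g x))\<^sup>2)"
  for u :: "'a::euclidean_space \<Rightarrow> real" and g :: "'a \<Rightarrow> 'a"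
  by (auto intro!: Bochner_Integration.integral_nonneg)

lemma precompact_on_mono:
  assumes "precompact_on \<Omega> A" "A' \<subseteq> A"
  shows "precompact_on \<Omega> A'"
  unfolding precompact_on_def
proof (intro allI impI)
  fix \<epsilon> :: real assume "\<epsilon> > 0"
  then obtain \<Phi> C where p: "functional_bound \<Omega> A \<epsilon> \<Phi> C"
    using assms(1) unfolding precompact_on_def by blast
  have *: "(\<integral>\<^sup>+x. ennreal ((u x)\<^sup>2) * indicator A' x \<partial>lborel) \<le> (\<integral>\<^sup>+x. ennreal ((u x)\<^sup>2) * indicator A x \<partial>lborel)" for u
    by (intro nn_integral_mono mult_left_mono) (use assms(2) in \<open>auto simp: indicator_def\<close>)
  note p = functional_boundD[OF p]
  show "\<exists>\<Phi> C. functional_bound \<Omega> A' \<epsilon> \<Phi> C"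
    unfolding functional_bound_def
    by (intro exI[of _ \<Phi>] exI[of _ C] conjI allI impI p(1-3) order_trans[OF * p(4)])
qed

text \<open>Each set receives half of \<epsilon>; functionals and constants accumulate, since
  additional nonnegative terms only enlarge the right-hand side.\<close>

lemma precompact_on_Un:
  assumes "precompact_on \<Omega> A" "precompact_on \<Omega> B" "A \<in> sets borel" "B \<in> sets borel"
  shows "precompact_on \<Omega> (A \<union> B)"
  unfolding precompact_on_def
proof (intro allI impI)
  fix \<epsilon> :: real assume "\<epsilon> > 0"
  then have "\<epsilon> / 2 > 0" by simp
  obtain \<Phi> C where p: "functional_bound \<Omega> A (\<epsilon> / 2) \<Phi> C"
    using assms(1) \<open>\<epsilon> / 2 > 0\<close> unfolding precompact_on_def by blast
  obtain \<Psi> D where q: "functional_bound \<Omega> B (\<epsilon> / 2) \<Psi> D"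
    using assms(2) \<open>\<epsilon> / 2 > 0\<close> unfolding precompact_on_def by blast
  note p = functional_boundD[OF p] and q = functional_boundD[OF q]
  show "\<exists>\<Phi> C. functional_bound \<Omega> (A \<union> B) \<epsilon> \<Phi> C"
    unfolding functional_bound_def
  proof (intro exI[of _ "\<Phi> \<union> \<Psi>"] exI[of _ "C + D"] conjI allI impI)
    fix u g assume s: "sob \<Omega> u g"
    note [measurable] = sobD(1)[OF s] assms(3,4)
    let ?N = "(LINT x|lborel. (u x)\<^sup>2) + (LINT x|lborel. (norm (g x))\<^sup>2)"
    let ?S = "\<lambda>\<Phi>. \<Sum>\<phi>\<in>\<Phi>. (LINT x|lborel. u x * \<phi> x)\<^sup>2"
    have N: "?N \<ge> 0" using sob_integral_nonneg(1)[of u] sob_integral_nonneg(2)[of g] by simp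
    have S0: "0 \<le> ?S X" for X by (intro sum_nonneg) auto
    have S: "?S \<Phi> \<le> ?S (\<Phi> \<union> \<Psi>)" "?S \<Psi> \<le> ?S (\<Phi> \<union> \<Psi>)"
      using p(1) q(1) by (auto intro!: sum_mono2)
    have "(\<integral>\<^sup>+x. ennreal ((u x)\<^sup>2) * indicator (A \<union> B) x \<partial>lborel) \<le>
      (\<integral>\<^sup>+x. ennreal ((u x)\<^sup>2) * indicator A x + ennreal ((u x)\<^sup>2) * indicator B x \<partial>lborel)"
      by (intro nn_integral_mono) (auto simp: indicator_def)
    also have "\<dots> = (\<integral>\<^sup>+x. ennreal ((u x)\<^sup>2) * indicator A x \<partial>lborel) + (\<integral>\<^sup>+x. ennreal ((u x)\<^sup>2) * indicator B x \<partial>lborel)"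
      by (intro nn_integral_add) measurable
    also have "\<dots> \<le> ennreal (\<epsilon> / 2 * ?N + C * ?S \<Phi>) + ennreal (\<epsilon> / 2 * ?N + D * ?S \<Psi>)"
      by (intro add_mono p(4)[OF s] q(4)[OF s])
    also have "\<dots> = ennreal (\<epsilon> * ?N + (C * ?S \<Phi> + D * ?S \<Psi>))"
    proof (subst ennreal_plus[symmetric])
      show "0 \<le> \<epsilon> / 2 * ?N + C * ?S \<Phi>" "0 \<le> \<epsilon> / 2 * ?N + D * ?S \<Psi>"
        using N S0 \<open>\<epsilon> > 0\<close> p(2) q(2) by (auto intro!: add_nonneg_nonneg mult_nonneg_nonneg)
    qed (simp add: algebra_simps)
    also have "\<dots> \<le> ennreal (\<epsilon> * ?N + (C + D) * ?S (\<Phi> \<union> \<Psi>))"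
      using mult_left_mono[OF S(1) p(2)] mult_left_mono[OF S(2) q(2)]
      by (intro ennreal_leI) (simp add: distrib_right)
    finally show "(\<integral>\<^sup>+x. ennreal ((u x)\<^sup>2) * indicator (A \<union> B) x \<partial>lborel) \<le> ennreal (\<epsilon> * ?N + (C + D) * ?S (\<Phi> \<union> \<Psi>))" .
  qed (use p q in auto)
qed

lemma precompact_on_UN:
  assumes "finite I" "\<And>i. i \<in> I \<Longrightarrow> precompact_on \<Omega> (A i)" "\<And>i. i \<in> I \<Longrightarrow> A i \<in> sets borel"
  shows "precompact_on \<Omega> (\<Union>i\<in>I. A i)"
  using assms
proof (induction I rule: finite_induct)
  case empty
  show ?case unfolding precompact_on_def functional_bound_def
  proof (intro allI impI exI[of _ "{}"] exI[of _ 0] conjI)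
    fix \<epsilon> :: real and u g
    show "(\<integral>\<^sup>+x. ennreal ((u x)\<^sup>2) * indicator (\<Union>i\<in>{}. A i) x \<partial>lborel) \<le>
        ennreal (\<epsilon> * ((LINT x|lborel. (u x)\<^sup>2) + (LINT x|lborel. (norm (g x))\<^sup>2)) +
          0 * (\<Sum>\<phi>\<in>{}. (LINT x|lborel. u x * \<phi> x)\<^sup>2))" by simp
  qed auto
next
  case (insert i I)
  have "(\<Union>i\<in>I. A i) \<in> sets borel" using insert by (intro sets.finite_UN) auto
  then have "precompact_on \<Omega> (A i \<union> (\<Union>i\<in>I. A i))" using insert by (intro precompact_on_Un) auto
  then show ?case by simp
qed

section \<open>Compactness on compact subsets, by mollification\<close>

lemma moll_minus_square_le:
  fixes f :: "'a::euclidean_space \<Rightarrow> real"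
  assumes r: "r > 0" and f: "integrable lborel f" and f2: "integrable lborel (\<lambda>x. (f x)\<^sup>2)"
  shows "ennreal ((moll r f x - c)\<^sup>2) \<le> (\<integral>\<^sup>+w. ennreal (eta r w) * ennreal ((f (x - w) - c)\<^sup>2) \<partial>lborel)"
proof -
  have [measurable]: "f \<in> borel_measurable borel" using f by auto
  let ?m = "moll r f x"
  have i1: "integrable lborel (\<lambda>y. eta r (x - y) * f y)"
    using moll_integrand_integrable[OF r f, of x] by simp
  have i2: "integrable lborel (\<lambda>y. eta r (x - y) * (f y)\<^sup>2)"
    using moll_integrand_integrable[OF r f2] by simp
  have i4: "integrable lborel (\<lambda>y. eta r (x - y))" by (rule eta_shift_integrable[OF r])
  \<comment> \<open>Expanding about an arbitrary centre \<open>c\<close> reduces the claim to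
    Jensen's inequality, as the linear term integrates to the mean.\<close>
  have eq: "eta r (x - y) * (f y - c)\<^sup>2 = eta r (x - y) * (f y)\<^sup>2 - 2 * c * (eta r (x - y) * f y) + c\<^sup>2 * eta r (x - y)" for y
    by (simp add: power2_eq_square algebra_simps)
  have i5: "integrable lborel (\<lambda>y. eta r (x - y) * (f y - c)\<^sup>2)"
    unfolding eq using i1 i2 i4 by simp
  have "(?m - c)\<^sup>2 = ?m\<^sup>2 - 2 * c * ?m + c\<^sup>2" by (simp add: power2_eq_square algebra_simps)
  also have "\<dots> \<le> (LINT y|lborel. eta r (x - y) * (f y)\<^sup>2) - 2 * c * ?m + c\<^sup>2"
    using moll_norm_square_le[OF r f, of x] f2 by simp
  also have "\<dots> = (LINT y|lborel. eta r (x - y) * (f y - c)\<^sup>2)"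
    unfolding eq using i1 i2 i4 by (simp add: eta_shift_integral[OF r]) (simp add: moll_def)
  finally have "ennreal ((?m - c)\<^sup>2) \<le> ennreal (LINT y|lborel. eta r (x - y) * (f y - c)\<^sup>2)"
    by (rule ennreal_leI)
  also have "\<dots> = (\<integral>\<^sup>+y. ennreal (eta r (x - y) * (f y - c)\<^sup>2) \<partial>lborel)"
    using i5 by (intro nn_integral_eq_integral[symmetric]) (auto simp: eta_nonneg)
  \<comment> \<open>The reflection \<open>y = x - w\<close> exhibits a mean over shifts
    \<open>w\<close>, to each of which the translation estimate applies.\<close>
  also have "\<dots> = (\<integral>\<^sup>+w. ennreal (eta r w * (f (x - w) - c)\<^sup>2) \<partial>lborel)"
    using nn_integral_lborel_reflect[of "\<lambda>w. ennreal (eta r w * (f (x - w) - c)\<^sup>2)" x] by simp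
  finally show ?thesis by (simp add: ennreal_mult eta_nonneg)
qed

text \<open>The mollification is a mean of translates by \<open>w\<close> with
  \<open>norm w \<le> r\<close>, and each translate is within \<open>norm w\<close> times the
  gradient norm of \<open>u\<close>.\<close>

lemma sob_moll_close:
  assumes s: "sob \<Omega> u g" and b: "bounded \<Omega>" and o: "open \<Omega>" and K: "compact K" and r: "r > 0"
    and sub: "\<And>x. x \<in> K \<Longrightarrow> cball x r \<subseteq> \<Omega>"
  shows "(\<integral>\<^sup>+x. ennreal ((moll r u x - u x)\<^sup>2) * indicator K x \<partial>lborel) \<le>
    ennreal (r\<^sup>2 * (LINT x|lborel. (norm (g x))\<^sup>2))"
proof -
  note [measurable] = sobD(1)[OF s]
  have [measurable]: "K \<in> sets borel" using K by (simp add: compact_imp_closed)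
  let ?E = "ennreal (r\<^sup>2 * (LINT x|lborel. (norm (g x))\<^sup>2))"
  have "(\<integral>\<^sup>+x. ennreal ((moll r u x - u x)\<^sup>2) * indicator K x \<partial>lborel) \<le>
    (\<integral>\<^sup>+x. (\<integral>\<^sup>+w. ennreal (eta r w) * ennreal ((u (x - w) - u x)\<^sup>2) \<partial>lborel) * indicator K x \<partial>lborel)"
    by (intro nn_integral_mono mult_right_mono moll_minus_square_le[OF r sob_integrable(1)[OF s b] sobD(5)[OF s]]) auto
  also have "\<dots> = (\<integral>\<^sup>+x. (\<integral>\<^sup>+w. ennreal (eta r w) * ennreal ((u (x - w) - u x)\<^sup>2) * indicator K x \<partial>lborel) \<partial>lborel)"
    by (intro nn_integral_cong nn_integral_multc[symmetric]) measurable
  also have "\<dots> = (\<integral>\<^sup>+w. (\<integral>\<^sup>+x. ennreal (eta r w) * ennreal ((u (x - w) - u x)\<^sup>2) * indicator K x \<partial>lborel) \<partial>lborel)"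
    by (rule lborel_pair.Fubini') measurable
  also have "\<dots> \<le> (\<integral>\<^sup>+w. ennreal (eta r (w::'a)) * ?E \<partial>lborel)"
  proof (rule nn_integral_mono)
    fix w
    show "(\<integral>\<^sup>+x. ennreal (eta r w) * ennreal ((u (x - w) - u x)\<^sup>2) * indicator K x \<partial>lborel) \<le> ennreal (eta r w) * ?E"
    proof (cases "norm w \<le> r")
      case True
      have "(\<integral>\<^sup>+x. ennreal (eta r w) * ennreal ((u (x - w) - u x)\<^sup>2) * indicator K x \<partial>lborel) =
        ennreal (eta r w) * (\<integral>\<^sup>+x. ennreal ((u (- w + x) - u x)\<^sup>2) * indicator K x \<partial>lborel)"
        by (simp add: nn_integral_cmult mult.assoc)
      also have "\<dots> \<le> ennreal (eta r w) * ennreal ((norm (- w))\<^sup>2 * (LINT x|lborel. (norm (g x))\<^sup>2))"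
      proof (intro mult_left_mono sob_translate_compact[OF s b o K])
        fix x and t :: real assume x: "x \<in> K" and t: "0 \<le> t" "t \<le> 1"
        have "t * norm w \<le> 1 * r" using True t by (intro mult_mono) auto
        then have "x + t *\<^sub>R - w \<in> cball x r" using t by (simp add: dist_norm)
        then show "x + t *\<^sub>R - w \<in> \<Omega>" using sub[OF x] by blast
      qed auto
      also have "\<dots> \<le> ennreal (eta r w) * ?E"
        using True by (intro mult_left_mono ennreal_leI mult_right_mono) (auto intro: power_mono sob_integral_nonneg)
      finally show ?thesis .
    next
      case False
      then show ?thesis using eta_zero[OF r, of w] by simp
    qed
  qed
  also have "\<dots> = ?E" using eta_nn_integral(1)[OF r, of "0::'a"] by (simp add: nn_integral_multc)
  finally show ?thesis .
qed

text \<open>Cauchy-Schwarz against the indicator of the ball, obtained by completing the square with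
  \<open>c = m / V\<close>; volume zero is separate because of this division.\<close>

lemma L1_square_le:
  fixes u :: "'a::euclidean_space \<Rightarrow> real"
  assumes "\<Omega> \<subseteq> ball 0 R" "\<And>x. x \<notin> \<Omega> \<Longrightarrow> u x = 0" "integrable lborel u" "integrable lborel (\<lambda>x. (u x)\<^sup>2)"
    and V: "V = measure lborel (ball (0::'a) R)"
  shows "(LINT x|lborel. \<bar>u x\<bar>)\<^sup>2 \<le> V * (LINT x|lborel. (u x)\<^sup>2)"
proof (cases "V = 0")
  case True
  have "emeasure lborel (ball (0::'a) R) = 0"
    using True V emeasure_lborel_ball_finite[of "0::'a" R] by (simp add: emeasure_eq_ennreal_measure)
  then have "AE x in lborel. x \<notin> ball (0::'a) R"
    by (intro AE_not_in) (auto simp: null_sets_def)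
  then have "AE x in lborel. \<bar>u x\<bar> = 0"
  proof eventually_elim
    case (elim x)
    then have "x \<notin> \<Omega>" using assms(1) by blast
    then show ?case by (simp add: assms(2))
  qed
  then have "(LINT x|lborel. \<bar>u x\<bar>) = 0" by (subst integral_cong_AE[of _ _ "\<lambda>_. 0"]) (use assms(3) in auto)
  then show ?thesis using True by simp
next
  case False
  then have Vp: "V > 0" using V by (simp add: measure_nonneg order_less_le)
  define m where "m = (LINT x|lborel. \<bar>u x\<bar>)"
  define c where "c = m / V"
  have iB: "integrable lborel (indicator (ball (0::'a) R) :: 'a \<Rightarrow> real)"
    using emeasure_lborel_ball_finite by (intro integrable_real_indicator) auto
  have "0 \<le> (LINT x|lborel. (\<bar>u x\<bar> - c * indicator (ball 0 R) x)\<^sup>2)"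
    by (intro Bochner_Integration.integral_nonneg) auto
  also have "\<dots> = (LINT x|lborel. (u x)\<^sup>2 - 2 * c * \<bar>u x\<bar> + c\<^sup>2 * indicator (ball 0 R) x)"
  proof (intro Bochner_Integration.integral_cong refl)
    fix x
    have "x \<notin> ball 0 R \<Longrightarrow> u x = 0" using assms(1,2) by blast
    then show "(\<bar>u x\<bar> - c * indicator (ball 0 R) x)\<^sup>2 = (u x)\<^sup>2 - 2 * c * \<bar>u x\<bar> + c\<^sup>2 * indicator (ball 0 R) x"
      by (cases "x \<in> ball 0 R") (simp_all add: power2_eq_square algebra_simps)
  qed
  also have "\<dots> = (LINT x|lborel. (u x)\<^sup>2) - 2 * c * m + c\<^sup>2 * V"
    using assms(3,4) iB by (simp add: m_def V)
  finally have "m\<^sup>2 / V \<le> (LINT x|lborel. (u x)\<^sup>2)"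
    using Vp by (simp add: c_def power2_eq_square field_simps)
  then show ?thesis using Vp by (simp add: m_def field_simps)
qed

text \<open>On \<open>K\<close>, \<open>u\<close> is within \<open>r\<close> times the gradient norm
  of its mollification, whose values vary equicontinuously with a modulus fixed by the kernel alone.
  Hence the values at a finite net of points control it on all of \<open>K\<close>, and these values
  are the required functionals.\<close>

lemma precompact_on_compact:
  fixes \<Omega> K :: "'a::euclidean_space set"
  assumes b: "bounded \<Omega>" and o: "open \<Omega>" and K: "compact K" "K \<subseteq> \<Omega>"
  shows "precompact_on \<Omega> K"
  unfolding precompact_on_def
proof (intro allI impI)
  fix \<epsilon> :: real assume e: "\<epsilon> > 0"
  have [measurable]: "K \<in> sets borel" using K by (simp add: compact_imp_closed)
  obtain R where R: "\<Omega> \<subseteq> ball 0 R" using b bounded_subset_ballD by blast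
  define V where "V = measure lborel (ball (0::'a) R)"
  have V0: "V \<ge> 0" by (simp add: V_def)
  define k where "k = measure lborel K"
  have k: "emeasure lborel K = ennreal k" "k \<ge> 0"
    unfolding k_def using emeasure_compact_finite[OF K(1)] by (auto simp: emeasure_eq_ennreal_measure)
  obtain d where d: "0 < d" "(\<Union>x\<in>K. ball x d) \<subseteq> \<Omega>"
    using compact_subset_open_imp_ball_epsilon_subset[OF K(1) o K(2)] by blast
  \<comment> \<open>\<open>r\<close> lies below \<open>d\<close> so that balls about points of
    \<open>K\<close> stay inside, and is small enough for the factor \<open>2 * r\<^sup>2\<close> of
    the energy to be absorbed by \<epsilon>.\<close>
  define r where "r = min (d / 2) (min 1 (\<epsilon> / 2))"
  have r: "r > 0" "r < d" "2 * r\<^sup>2 \<le> \<epsilon>"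
  proof -
    show "r > 0" "r < d" using d e by (auto simp: r_def)
    have "r * r \<le> (\<epsilon> / 2) * 1" using e d by (intro mult_mono) (auto simp: r_def)
    then show "2 * r\<^sup>2 \<le> \<epsilon>" by (simp add: power2_eq_square)
  qed
  have sub: "cball x r \<subseteq> \<Omega>" if "x \<in> K" for x
  proof -
    have "cball x r \<subseteq> ball x d" using r by auto
    then show ?thesis using that d(2) by blast
  qed
  \<comment> \<open>Between a point and its net point the mollification varies by at most \<omega>
    times the \<open>L\<^sup>1\<close> norm of \<open>u\<close>. Squaring, two doublings and
    integration over \<open>K\<close> turn this into \<open>4 * k * \<omega>\<^sup>2 * V\<close>
    times the square integral. The added ones avoid division by zero.\<close>
  define \<omega> where "\<omega> = sqrt (\<epsilon> / (4 * (k + 1) * (V + 1)))"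
  have om: "\<omega> > 0" "4 * k * \<omega>\<^sup>2 * V \<le> \<epsilon>"
  proof -
    show "\<omega> > 0" using e k V0 by (simp add: \<omega>_def)
    have "\<omega>\<^sup>2 = \<epsilon> / (4 * (k + 1) * (V + 1))" unfolding \<omega>_def using e k V0 by (intro real_sqrt_pow2) auto
    then have "4 * k * \<omega>\<^sup>2 * V = \<epsilon> * ((4 * k / (4 * (k + 1))) * (V / (V + 1)))"
      by (simp only: times_divide_eq_left times_divide_eq_right times_divide_times_eq divide_divide_eq_left mult_ac)
    also have "4 * k / (4 * (k + 1)) = k / (k + 1)" by (rule mult_divide_mult_cancel_left) simp
    also have "\<epsilon> * (k / (k + 1) * (V / (V + 1))) \<le> \<epsilon> * (1 * 1)" using e k V0 by (intro mult_left_mono mult_mono) auto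
    finally show "4 * k * \<omega>\<^sup>2 * V \<le> \<epsilon>" by simp
  qed
  have "uniformly_continuous_on UNIV (eta r :: 'a \<Rightarrow> real)"
    by (rule compact_support_uniform(1)[OF eta_continuous, of r]) (simp add: eta_zero r)
  then obtain \<delta> where de: "\<delta> > 0" "\<And>z z'::'a. dist z' z < \<delta> \<Longrightarrow> dist (eta r z') (eta r z) < \<omega>"
    using om(1) unfolding uniformly_continuous_on_def by (metis UNIV_I)
  obtain X where X: "finite X" "X \<subseteq> K" "K \<subseteq> (\<Union>x\<in>X. ball x \<delta>)"
    using compactE_image[OF K(1), of K "\<lambda>x. ball x \<delta>"] de(1) by (metis UN_I centre_in_ball open_ball subsetI)
  define \<Phi> where "\<Phi> = (\<lambda>x y. eta r (x - y)) ` X"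
  show "\<exists>\<Phi> C. functional_bound \<Omega> K \<epsilon> \<Phi> C"
    unfolding functional_bound_def
  proof (intro exI[of _ \<Phi>] exI[of _ "4 * k"] conjI allI impI)
    show "finite \<Phi>" using X(1) by (simp add: \<Phi>_def)
    show "0 \<le> 4 * k" using k by simp
    obtain B where B: "\<And>z::'a. eta r z \<le> B" using eta_bounded[OF r(1)] by blast
    show "\<forall>\<phi>\<in>\<Phi>. \<phi> \<in> borel_measurable borel \<and> bounded (range \<phi>)"
      unfolding \<Phi>_def by (auto simp: bounded_iff eta_nonneg intro!: exI[of _ B] B)
    fix u g assume s: "sob \<Omega> u g"
    note [measurable] = sobD(1)[OF s]
    note iu = sob_integrable(1)[OF s b]
    let ?U = "LINT x|lborel. (u x)\<^sup>2" and ?G = "LINT x|lborel. (norm (g x))\<^sup>2"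
    let ?S = "\<Sum>\<phi>\<in>\<Phi>. (LINT x|lborel. u x * \<phi> x)\<^sup>2"
    have S0: "?S \<ge> 0" by (intro sum_nonneg) auto
    have pt: "(moll r u x)\<^sup>2 \<le> 2 * ?S + 2 * \<omega>\<^sup>2 * V * ?U" if x: "x \<in> K" for x
    proof -
      obtain x' where x': "x' \<in> X" "dist x' x < \<delta>" using X(3) x by auto
      have i: "integrable lborel (\<lambda>y. eta r (z - y) * u y)" for z
        using moll_integrand_integrable[OF r(1) iu] by simp
      have "\<bar>moll r u x - moll r u x'\<bar> = \<bar>LINT y|lborel. (eta r (x - y) - eta r (x' - y)) * u y\<bar>"
        using i[of x] i[of x'] by (simp add: moll_def left_diff_distrib)
      also have "\<dots> \<le> (LINT y|lborel. \<bar>(eta r (x - y) - eta r (x' - y)) * u y\<bar>)"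
        by (rule integral_abs_bound)
      also have "\<dots> \<le> (LINT y|lborel. \<omega> * \<bar>u y\<bar>)"
      proof (rule integral_mono)
        show "integrable lborel (\<lambda>y. \<bar>(eta r (x - y) - eta r (x' - y)) * u y\<bar>)"
          using i[of x] i[of x'] by (simp add: left_diff_distrib)
        show "integrable lborel (\<lambda>y. \<omega> * \<bar>u y\<bar>)" using iu by simp
        fix y
        have "dist (x' - y) (x - y) < \<delta>" using x'(2) by (simp add: dist_norm)
        from de(2)[OF this] have "\<bar>eta r (x - y) - eta r (x' - y)\<bar> \<le> \<omega>"
          by (simp add: dist_real_def)
        then show "\<bar>(eta r (x - y) - eta r (x' - y)) * u y\<bar> \<le> \<omega> * \<bar>u y\<bar>"
          by (simp add: abs_mult mult_right_mono)
      qed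
      also have "\<dots> = \<omega> * (LINT y|lborel. \<bar>u y\<bar>)" by simp
      finally have "\<bar>moll r u x - moll r u x'\<bar> \<le> \<omega> * (LINT y|lborel. \<bar>u y\<bar>)" .
      then have "(moll r u x - moll r u x')\<^sup>2 \<le> (\<omega> * (LINT y|lborel. \<bar>u y\<bar>))\<^sup>2"
        by (metis abs_ge_zero power2_abs power_mono)
      also have "\<dots> \<le> \<omega>\<^sup>2 * (V * ?U)"
        unfolding power_mult_distrib
        by (intro mult_left_mono L1_square_le[OF R sobD(3)[OF s] iu sobD(5)[OF s] V_def]) auto
      finally have 1: "(moll r u x - moll r u x')\<^sup>2 \<le> \<omega>\<^sup>2 * (V * ?U)" .
      have "(moll r u x')\<^sup>2 = (LINT y|lborel. u y * eta r (x' - y))\<^sup>2"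
        by (simp add: moll_def mult.commute)
      also have "\<dots> \<le> ?S"
        by (rule member_le_sum[of "\<lambda>y. eta r (x' - y)" \<Phi> "\<lambda>\<phi>. (LINT x|lborel. u x * \<phi> x)\<^sup>2"])
           (use x' X(1) in \<open>auto simp: \<Phi>_def\<close>)
      finally have 2: "(moll r u x')\<^sup>2 \<le> ?S" .
      \<comment> \<open>In the form \<open>(2 * b - a)\<^sup>2 \<ge> 0\<close> this is the
        inequality \<open>a\<^sup>2 \<le> 2 * b\<^sup>2 + 2 * (a - b)\<^sup>2\<close>.\<close>
      have "0 \<le> (moll r u x' - (moll r u x - moll r u x'))\<^sup>2" by simp
      then have "(moll r u x)\<^sup>2 \<le> 2 * (moll r u x')\<^sup>2 + 2 * (moll r u x - moll r u x')\<^sup>2"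
        by (simp add: power2_eq_square algebra_simps)
      then show ?thesis using 1 2 by simp
    qed
    define M where "M = 2 * ?S + 2 * \<omega>\<^sup>2 * V * ?U"
    have M0: "M \<ge> 0" using S0 V0 sob_integral_nonneg(1)[of u] by (simp add: M_def)
    have "(\<integral>\<^sup>+x. ennreal ((u x)\<^sup>2) * indicator K x \<partial>lborel) \<le>
      (\<integral>\<^sup>+x. 2 * (ennreal ((moll r u x - u x)\<^sup>2) * indicator K x) + ennreal (2 * M) * indicator K x \<partial>lborel)"
    proof (rule nn_integral_mono)
      fix x
      show "ennreal ((u x)\<^sup>2) * indicator K x \<le> 2 * (ennreal ((moll r u x - u x)\<^sup>2) * indicator K x) + ennreal (2 * M) * indicator K x"
      proof (cases "x \<in> K")
        case True
        have "0 \<le> (moll r u x - u x + moll r u x)\<^sup>2" by simp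
        then have "(u x)\<^sup>2 \<le> 2 * (moll r u x - u x)\<^sup>2 + 2 * (moll r u x)\<^sup>2"
          by (simp add: power2_eq_square algebra_simps)
        also have "\<dots> \<le> 2 * (moll r u x - u x)\<^sup>2 + 2 * M" using pt[OF True] by (simp add: M_def)
        finally have "ennreal ((u x)\<^sup>2) \<le> ennreal (2 * (moll r u x - u x)\<^sup>2 + 2 * M)" by (rule ennreal_leI)
        also have "\<dots> = 2 * ennreal ((moll r u x - u x)\<^sup>2) + ennreal (2 * M)"
          using M0 by (simp add: ennreal_plus ennreal_mult)
        finally show ?thesis using True by simp
      qed simp
    qed
    also have "\<dots> = 2 * (\<integral>\<^sup>+x. ennreal ((moll r u x - u x)\<^sup>2) * indicator K x \<partial>lborel) + ennreal (2 * M) * ennreal k"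
      using r(1) iu by (simp add: nn_integral_add nn_integral_cmult nn_integral_cmult_indicator k(1))
    also have "\<dots> \<le> 2 * ennreal (r\<^sup>2 * ?G) + ennreal (2 * M) * ennreal k"
      by (intro add_mono mult_left_mono sob_moll_close[OF s b o K(1) r(1)] sub) auto
    also have "\<dots> = ennreal (2 * r\<^sup>2 * ?G + 2 * M * k)"
      using M0 k(2) sob_integral_nonneg(2)[of g] by (simp add: ennreal_plus ennreal_mult mult.assoc)
    also have "\<dots> \<le> ennreal (\<epsilon> * (?U + ?G) + 4 * k * ?S)"
    proof (rule ennreal_leI)
      have "2 * r\<^sup>2 * ?G \<le> \<epsilon> * ?G" using r(3) sob_integral_nonneg(2)[of g] by (intro mult_right_mono) auto
      moreover have "4 * k * \<omega>\<^sup>2 * V * ?U \<le> \<epsilon> * ?U" using om(2) sob_integral_nonneg(1)[of u] by (intro mult_right_mono) auto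
      ultimately show "2 * r\<^sup>2 * ?G + 2 * M * k \<le> \<epsilon> * (?U + ?G) + 4 * k * ?S"
        by (simp add: M_def algebra_simps)
    qed
    finally show "(\<integral>\<^sup>+x. ennreal ((u x)\<^sup>2) * indicator K x \<partial>lborel) \<le> ennreal (\<epsilon> * (?U + ?G) + 4 * k * ?S)" .
  qed
qed

text \<open>Shifting a boundary piece inward by \<open>t\<close> moves it into a compact subset of the domain, at the
  price of \<open>t\<close> times the gradient norm.\<close>
lemma precompact_on_shift:
  fixes \<Omega> A :: "'a::euclidean_space set"
  assumes b: "bounded \<Omega>" and o: "open \<Omega>" and A: "open A"
    and seg: "\<And>x t. x \<in> closure A \<Longrightarrow> 0 < t \<Longrightarrow> t < \<rho> \<Longrightarrow> t *\<^sub>R e + x \<in> \<Omega>"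
    and AO: "A \<subseteq> \<Omega>" and e: "norm e = 1" and \<rho>: "\<rho> > 0"
  shows "precompact_on \<Omega> A"
  unfolding precompact_on_def
proof (intro allI impI)
  fix \<epsilon> :: real assume ep: "\<epsilon> > 0"
  \<comment> \<open>The shift is shorter than \<rho>, and
    \<open>2 * t\<^sup>2 \<le> \<epsilon> / 2\<close> leaves the other half of \<epsilon> to the
    shifted set, whose bound with \<open>\<epsilon> / 4\<close> enters twice.\<close>
  define t where "t = min (\<rho> / 2) (min 1 (\<epsilon> / 4))"
  have t: "t > 0" "t < \<rho>" "2 * t\<^sup>2 \<le> \<epsilon> / 2"
  proof -
    show "t > 0" "t < \<rho>" using \<rho> ep by (auto simp: t_def)
    have "t * t \<le> (\<epsilon> / 4) * 1" using ep \<rho> by (intro mult_mono) (auto simp: t_def)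
    then show "2 * t\<^sup>2 \<le> \<epsilon> / 2" by (simp add: power2_eq_square)
  qed
  let ?K = "(+) (t *\<^sub>R e) ` closure A"
  have [measurable]: "A \<in> sets borel" using A by simp
  have "bounded A" using b AO by (rule bounded_subset)
  then have cK: "compact ?K" by (intro compact_translation) (simp add: compact_closure)
  have [measurable]: "?K \<in> sets borel" using cK by (simp add: compact_imp_closed)
  have KO: "?K \<subseteq> \<Omega>" using seg t by auto
  have "precompact_on \<Omega> ?K" by (rule precompact_on_compact[OF b o cK KO])
  moreover have "\<epsilon> / 4 > 0" using ep by simp
  ultimately obtain \<Phi> C where p: "functional_bound \<Omega> ?K (\<epsilon> / 4) \<Phi> C"
    unfolding precompact_on_def by blast
  note p = functional_boundD[OF p]
  show "\<exists>\<Phi> C. functional_bound \<Omega> A \<epsilon> \<Phi> C"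
    unfolding functional_bound_def
  proof (intro exI[of _ \<Phi>] exI[of _ "2 * C"] conjI allI impI p(1,3))
    fix u g assume s: "sob \<Omega> u g"
    note [measurable] = sobD(1)[OF s]
    let ?U = "LINT x|lborel. (u x)\<^sup>2" and ?G = "LINT x|lborel. (norm (g x))\<^sup>2"
    let ?S = "\<Sum>\<phi>\<in>\<Phi>. (LINT x|lborel. u x * \<phi> x)\<^sup>2"
    have S0: "?S \<ge> 0" by (intro sum_nonneg) auto
    note UG = sob_integral_nonneg(1)[of u] sob_integral_nonneg(2)[of g]
    let ?z = "t *\<^sub>R e"
    have "(\<integral>\<^sup>+x. ennreal ((u x)\<^sup>2) * indicator A x \<partial>lborel) \<le>
      (\<integral>\<^sup>+x. 2 * (ennreal ((u (?z + x) - u x)\<^sup>2) * indicator A x) + 2 * (ennreal ((u (?z + x))\<^sup>2) * indicator ?K (?z + x)) \<partial>lborel)"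
    proof (rule nn_integral_mono)
      fix x
      show "ennreal ((u x)\<^sup>2) * indicator A x \<le>
        2 * (ennreal ((u (?z + x) - u x)\<^sup>2) * indicator A x) + 2 * (ennreal ((u (?z + x))\<^sup>2) * indicator ?K (?z + x))"
      proof (cases "x \<in> A")
        case True
        then have K: "?z + x \<in> ?K" using closure_subset by auto
        have "0 \<le> (u (?z + x) - u x + u (?z + x))\<^sup>2" by simp
        then have "(u x)\<^sup>2 \<le> 2 * (u (?z + x) - u x)\<^sup>2 + 2 * (u (?z + x))\<^sup>2"
          by (simp add: power2_eq_square algebra_simps)
        then have "ennreal ((u x)\<^sup>2) \<le> ennreal (2 * (u (?z + x) - u x)\<^sup>2 + 2 * (u (?z + x))\<^sup>2)" by (rule ennreal_leI)
        also have "\<dots> = 2 * ennreal ((u (?z + x) - u x)\<^sup>2) + 2 * ennreal ((u (?z + x))\<^sup>2)"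
          by (simp add: ennreal_plus ennreal_mult)
        finally show ?thesis using True K by simp
      qed simp
    qed
    also have "\<dots> = 2 * (\<integral>\<^sup>+x. ennreal ((u (?z + x) - u x)\<^sup>2) * indicator A x \<partial>lborel) +
        2 * (\<integral>\<^sup>+x. ennreal ((u (?z + x))\<^sup>2) * indicator ?K (?z + x) \<partial>lborel)"
      by (subst nn_integral_add, measurable) (simp add: nn_integral_cmult)
    also have "(\<integral>\<^sup>+x. ennreal ((u (?z + x))\<^sup>2) * indicator ?K (?z + x) \<partial>lborel) = (\<integral>\<^sup>+x. ennreal ((u x)\<^sup>2) * indicator ?K x \<partial>lborel)"
      by (rule nn_integral_lborel_shift[of "\<lambda>x. ennreal ((u x)\<^sup>2) * indicator ?K x"]) measurable
    also have "2 * (\<integral>\<^sup>+x. ennreal ((u (?z + x) - u x)\<^sup>2) * indicator A x \<partial>lborel) + 2 * \<dots> \<le>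
      2 * ennreal ((norm ?z)\<^sup>2 * ?G) + 2 * ennreal (\<epsilon> / 4 * (?U + ?G) + C * ?S)"
    proof (intro add_mono mult_left_mono p(4)[OF s] sob_translate_open[OF s b o A])
      fix x and \<tau> :: real assume x: "x \<in> A" and \<tau>: "0 \<le> \<tau>" "\<tau> \<le> 1"
      show "x + \<tau> *\<^sub>R t *\<^sub>R e \<in> \<Omega>"
      \<comment> \<open>For \<open>\<tau> = 0\<close> the hypothesis \<open>seg\<close> says
        nothing, as it concerns positive shifts only; the point then lies in \<open>A\<close>
        itself.\<close>
      proof (cases "\<tau> = 0")
        case True then show ?thesis using x AO by auto
      next
        case False
        have "\<tau> * t \<le> 1 * t" using \<tau> t by (intro mult_right_mono) auto
        then have "\<tau> * t < \<rho>" using t by linarith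
        then have "(\<tau> * t) *\<^sub>R e + x \<in> \<Omega>" using False \<tau> t x closure_subset by (intro seg) auto
        then show ?thesis by (simp add: add.commute)
      qed
    qed auto
    also have "\<dots> = ennreal (2 * (t\<^sup>2 * ?G) + 2 * (\<epsilon> / 4 * (?U + ?G) + C * ?S))"
    proof -
      have "0 \<le> \<epsilon> / 4 * (?U + ?G) + C * ?S" using UG S0 p(2) ep by (intro add_nonneg_nonneg mult_nonneg_nonneg) auto
      moreover have "0 \<le> t\<^sup>2 * ?G" using UG by simp
      moreover have "2 * ennreal x + 2 * ennreal y = ennreal (2 * x + 2 * y)" if "0 \<le> x" "0 \<le> y" for x y
        using that by (simp add: ennreal_plus ennreal_mult)
      moreover have "(norm ?z)\<^sup>2 = t\<^sup>2" using e t by simp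
      ultimately show ?thesis by presburger
    qed
    also have "\<dots> \<le> ennreal (\<epsilon> * (?U + ?G) + 2 * C * ?S)"
    proof (rule ennreal_leI)
      have "2 * t\<^sup>2 * ?G \<le> \<epsilon> / 2 * ?G" using t(3) UG by (intro mult_right_mono) auto
      moreover have "\<epsilon> / 2 * ?U \<ge> 0" using UG ep by simp
      ultimately show "2 * (t\<^sup>2 * ?G) + 2 * (\<epsilon> / 4 * (?U + ?G) + C * ?S) \<le> \<epsilon> * (?U + ?G) + 2 * C * ?S"
        by (simp add: algebra_simps)
    qed
    finally show "(\<integral>\<^sup>+x. ennreal ((u x)\<^sup>2) * indicator A x \<partial>lborel) \<le> ennreal (\<epsilon> * (?U + ?G) + 2 * C * ?S)" .
  qed (use p in auto)
qed

section \<open>Compactness up to the boundary\<close>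

lemma smooth_fun_continuous: "smooth_fun \<gamma> \<Longrightarrow> continuous_on UNIV \<gamma>"
  unfolding smooth_fun_def
  by (metis foldr_Nil id_apply differentiable_imp_continuous_within continuous_at_imp_continuous_on)

lemma orthogonal_continuous:
  "orthogonal_transformation T \<Longrightarrow> continuous_on S (T :: 'a::euclidean_space \<Rightarrow> 'a)"
  by (rule linear_continuous_on[OF linear_conv_bounded_linear[THEN iffD1, OF orthogonal_transformation_linear]])

text \<open>Interior points have a compact ball around them. Near a boundary point the half-radius
  piece is pushed along the graph direction: its closure lies on or above the graph, any positive
  shift puts it strictly above, and a shift below \<open>r / 2\<close> stays in the chart ball.
  Finitely many pieces cover the compact closure.\<close>

lemma precompact_on_domain:
  fixes \<Omega> :: "(real^2) set"
  assumes "smooth_bounded_domain \<Omega>"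
  shows "precompact_on \<Omega> \<Omega>"
proof -
  have o: "open \<Omega>" and b: "bounded \<Omega>" and sb: "smooth_boundary \<Omega>"
    using assms by (auto simp: smooth_bounded_domain_def)
  have loc: "\<exists>s>0. precompact_on \<Omega> (\<Omega> \<inter> ball p s)" if p: "p \<in> closure \<Omega>" for p
  proof (cases "p \<in> \<Omega>")
    case True
    then obtain s where s: "s > 0" "cball p s \<subseteq> \<Omega>" using o open_contains_cball by blast
    have "precompact_on \<Omega> (cball p s)" by (rule precompact_on_compact[OF b o _ s(2)]) simp
    then have "precompact_on \<Omega> (\<Omega> \<inter> ball p s)" by (rule precompact_on_mono) auto
    then show ?thesis using s(1) by blast
  next
    case False
    then have "p \<in> frontier \<Omega>" using p o by (simp add: frontier_def interior_open)
    then obtain r and T :: "real^2 \<Rightarrow> real^2" and \<gamma> where r: "r > 0" and T: "orthogonal_transformation T"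
      and \<gamma>: "smooth_fun \<gamma>" and eq: "\<Omega> \<inter> ball p r = {x \<in> ball p r. T x $ 2 > \<gamma> (T x $ 1)}"
      using sb unfolding smooth_boundary_def by blast
    note Tl = orthogonal_transformation_linear[OF T]
    \<comment> \<open>The direction that the chart maps to the vertical axis, along which points
      move away from the graph.\<close>
    define e where "e = inv T (axis 2 1)"
    have Te: "T e = axis 2 1" unfolding e_def
      by (simp add: orthogonal_transformation_surj[OF T] surj_f_inv_f)
    have ne: "norm e = 1" using orthogonal_transformation_norm[OF T, of e] Te by simp
    let ?A = "\<Omega> \<inter> ball p (r / 2)"
    \<comment> \<open>A closed set containing the piece; taking closures weakens the strict
      inequality, which the positive shift restores.\<close>
    let ?C = "cball p (r / 2) \<inter> {x. \<gamma> (T x $ 1) \<le> T x $ 2}"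
    note Tc = orthogonal_continuous[OF T]
    have "closed ?C"
      by (intro closed_Int closed_cball closed_Collect_le continuous_intros Tc
          continuous_on_compose2[OF smooth_fun_continuous[OF \<gamma>], of _ "\<lambda>x. T x $ 1"]) auto
    moreover have "?A \<subseteq> ?C"
    proof
      fix x assume x: "x \<in> ?A"
      then have "x \<in> \<Omega> \<inter> ball p r" using r by auto
      then show "x \<in> ?C" using x unfolding eq by auto
    qed
    ultimately have cl: "closure ?A \<subseteq> ?C" by (rule closure_minimal[rotated])
    have "precompact_on \<Omega> ?A"
    proof (rule precompact_on_shift[OF b o _ _ _ ne])
      show "r / 2 > 0" using r by simp
      fix x t assume x: "x \<in> closure ?A" and t: "0 < t" "t < r / 2"
      have C: "x \<in> ?C" using cl x by blast
      have "dist p (t *\<^sub>R e + x) \<le> dist p x + norm (t *\<^sub>R e)"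
        using norm_triangle_ineq4[of "p - x" "t *\<^sub>R e"] by (simp add: dist_norm algebra_simps)
      also have "\<dots> < r" using C t ne by auto
      finally have "t *\<^sub>R e + x \<in> ball p r" by simp
      moreover have "T (t *\<^sub>R e + x) = t *\<^sub>R axis 2 1 + T x"
        by (simp add: linear_add[OF Tl] linear_scale[OF Tl] Te)
      then have "T (t *\<^sub>R e + x) $ 1 = T x $ 1" "T (t *\<^sub>R e + x) $ 2 = t + T x $ 2"
        by (simp_all add: axis_def)
      ultimately have "t *\<^sub>R e + x \<in> \<Omega> \<inter> ball p r" unfolding eq using C t by auto
      then show "t *\<^sub>R e + x \<in> \<Omega>" by blast
    qed (use o in auto)
    then show ?thesis using r by (intro exI[of _ "r / 2"]) auto
  qed
  then obtain s where s: "\<And>p. p \<in> closure \<Omega> \<Longrightarrow> s p > 0 \<and> precompact_on \<Omega> (\<Omega> \<inter> ball p (s p))" by metis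
  have "compact (closure \<Omega>)" using b by (simp add: compact_closure)
  then obtain P where P: "P \<subseteq> closure \<Omega>" "finite P" "closure \<Omega> \<subseteq> (\<Union>p\<in>P. ball p (s p))"
    using compactE_image[of "closure \<Omega>" "closure \<Omega>" "\<lambda>p. ball p (s p)"] s
    by (metis (no_types, lifting) UN_I centre_in_ball open_ball subsetI)
  have "precompact_on \<Omega> (\<Union>p\<in>P. \<Omega> \<inter> ball p (s p))"
    using P s o by (intro precompact_on_UN) auto
  then show ?thesis
    by (rule precompact_on_mono) (use P(3) closure_subset in blast)
qed

section \<open>The Hardy inequality near the origin\<close>

text \<open>With \<open>s = ln (b / q)\<close> the derivative of \<open>s\<close> is
  \<open>- 1 / q\<close>. The square of \<open>f' + f / (2 * q * s)\<close>, weighted with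
  \<open>q\<close>, is nonnegative, and its cross term is the derivative of
  \<open>f\<^sup>2 / (2 * s)\<close> minus half of the integrand on the left. The coefficient 1/2 in
  the square is the origin of the constant 4.\<close>

lemma hardy_1d:
  fixes f f' :: "real \<Rightarrow> real"
  assumes d: "\<And>q. q0 \<le> q \<Longrightarrow> q \<le> q1 \<Longrightarrow> (f has_real_derivative f' q) (at q)"
    and c: "continuous_on UNIV f" "continuous_on UNIV f'"
    and q: "0 < q0" "q0 \<le> q1" "q1 < b"
  shows "(\<integral>\<^sup>+q. ennreal ((f q)\<^sup>2 / (q * (ln (b / q))\<^sup>2)) * indicator {q0..q1} q \<partial>lborel) \<le>
    4 * (\<integral>\<^sup>+q. ennreal ((f' q)\<^sup>2 * q) * indicator {q0..q1} q \<partial>lborel) + ennreal (2 * (f q1)\<^sup>2 / ln (b / q1))"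
proof -
  let ?I = "{q0..q1}"
  define s where "s q = ln (b / q)" for q
  have s0: "s q > 0" if "q \<in> ?I" for q using that q by (simp add: s_def)
  have sne: "s q \<noteq> 0" if "q0 \<le> q" "q \<le> q1" for q using s0[of q] that by simp
  have sc: "continuous_on ?I s" unfolding s_def using q by (intro continuous_intros) auto
  note cf = continuous_on_subset[OF c(1) subset_UNIV, of ?I] and cf' = continuous_on_subset[OF c(2) subset_UNIV, of ?I]
  define h where "h q = (f q)\<^sup>2 / (2 * s q)" for q
  define h' where "h' q = f q * f' q / s q + (f q)\<^sup>2 / (2 * q * (s q)\<^sup>2)" for q
  have hd: "(h has_real_derivative h' q) (at q)" if qi: "q \<in> ?I" for q
  proof -
    have "b > 0" "q > 0" using qi q by auto
    then have sd: "(s has_real_derivative (- 1 / q)) (at q)"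
      unfolding s_def by (auto intro!: derivative_eq_intros simp: field_simps power2_eq_square)
    have "((\<lambda>q. (f q)\<^sup>2 / (2 * s q)) has_real_derivative
        ((2 * f q * f' q) * (2 * s q) - (f q)\<^sup>2 * (2 * (- 1 / q))) / ((2 * s q) * (2 * s q))) (at q)"
      using s0[OF qi] d[of q] qi by (auto intro!: derivative_eq_intros sd)
    moreover have "((2 * f q * f' q) * (2 * s q) - (f q)\<^sup>2 * (2 * (- 1 / q))) / ((2 * s q) * (2 * s q)) = h' q"
      using s0[OF qi] \<open>q > 0\<close> by (simp add: h'_def field_simps power2_eq_square)
    ultimately show ?thesis unfolding h_def[abs_def] by simp
  qed
  have h'c: "continuous_on ?I h'"
    unfolding h'_def using sne q by (intro continuous_intros cf cf' sc) auto
  have FTC: "has_bochner_integral lborel (\<lambda>q. indicator ?I q *\<^sub>R h' q) (h q1 - h q0)"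
    by (rule has_bochner_integral_FTC_Icc[OF q(2) _ h'c])
       (use hd in \<open>auto simp: has_real_derivative_iff_has_vector_derivative intro: has_vector_derivative_at_within\<close>)
  have i1: "integrable lborel (\<lambda>q. indicator ?I q *\<^sub>R ((f' q)\<^sup>2 * q))"
    by (rule borel_integrable_compact) (auto intro!: continuous_intros cf')
  have i2: "integrable lborel (\<lambda>q. indicator ?I q *\<^sub>R ((f q)\<^sup>2 / (q * (s q)\<^sup>2)))"
    by (rule borel_integrable_compact) (use sne q in \<open>auto intro!: continuous_intros cf sc\<close>)
  have pt: "(f q)\<^sup>2 / (q * (s q)\<^sup>2) \<le> 4 * ((f' q)\<^sup>2 * q) + 4 * h' q" if qi: "q \<in> ?I" for q
  proof -
    have qp: "q > 0" using qi q by simp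
    have "0 \<le> (f' q + f q / (2 * q * s q))\<^sup>2 * q" using qp by simp
    also have "\<dots> = (f' q)\<^sup>2 * q + f q * f' q / s q + (f q)\<^sup>2 / (4 * q * (s q)\<^sup>2)"
      using qp s0[OF qi] by (simp add: field_simps power2_eq_square)
    finally have 0: "0 \<le> (f' q)\<^sup>2 * q + f q * f' q / s q + (f q)\<^sup>2 / (4 * q * (s q)\<^sup>2)" .
    define X where "X = (f q)\<^sup>2 / (q * (s q)\<^sup>2)"
    have X: "(f q)\<^sup>2 / (4 * q * (s q)\<^sup>2) = X / 4" "(f q)\<^sup>2 / (2 * q * (s q)\<^sup>2) = X / 2"
      by (simp_all add: X_def field_simps)
    show ?thesis using 0 unfolding h'_def X X_def[symmetric] by argo
  qed
  have "(LINT q|lborel. indicator ?I q *\<^sub>R ((f q)\<^sup>2 / (q * (s q)\<^sup>2))) \<le>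
    (LINT q|lborel. 4 * (indicator ?I q *\<^sub>R ((f' q)\<^sup>2 * q)) + 4 * (indicator ?I q *\<^sub>R h' q))"
    using i1 i2 FTC pt by (intro integral_mono) (auto simp: has_bochner_integral_iff indicator_def)
  also have "\<dots> = 4 * (LINT q|lborel. indicator ?I q *\<^sub>R ((f' q)\<^sup>2 * q)) + 4 * (h q1 - h q0)"
    using i1 FTC by (simp add: has_bochner_integral_iff)
  \<comment> \<open>The primitive \<open>h\<close> is nonnegative at \<open>q0\<close>, so its lower
    boundary term is dropped and only the outer one remains. This is what admits functions that do
    not vanish towards the origin.\<close>
  also have "\<dots> \<le> 4 * (LINT q|lborel. indicator ?I q *\<^sub>R ((f' q)\<^sup>2 * q)) + 2 * (f q1)\<^sup>2 / s q1"
    using s0[of q0] q by (simp add: h_def)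
  finally have "ennreal (LINT q|lborel. indicator ?I q *\<^sub>R ((f q)\<^sup>2 / (q * (s q)\<^sup>2))) \<le>
    ennreal (4 * (LINT q|lborel. indicator ?I q *\<^sub>R ((f' q)\<^sup>2 * q)) + 2 * (f q1)\<^sup>2 / s q1)"
    by (rule ennreal_leI)
  also have "\<dots> = 4 * ennreal (LINT q|lborel. indicator ?I q *\<^sub>R ((f' q)\<^sup>2 * q)) + ennreal (2 * (f q1)\<^sup>2 / s q1)"
  proof (subst ennreal_plus)
    show "0 \<le> 2 * (f q1)\<^sup>2 / s q1" using s0[of q1] q by simp
    show "0 \<le> 4 * (LINT q|lborel. indicator ?I q *\<^sub>R ((f' q)\<^sup>2 * q))"
      using q by (intro mult_nonneg_nonneg Bochner_Integration.integral_nonneg) (auto simp: indicator_def)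
  qed (simp add: ennreal_mult')
  also have "ennreal (LINT q|lborel. indicator ?I q *\<^sub>R ((f' q)\<^sup>2 * q)) =
      (\<integral>\<^sup>+q. ennreal ((f' q)\<^sup>2 * q) * indicator {q0..q1} q \<partial>lborel)"
    using q by (subst nn_integral_eq_integral[OF i1, symmetric])
      (auto simp: indicator_def intro!: nn_integral_cong)
  also have "ennreal (LINT q|lborel. indicator ?I q *\<^sub>R ((f q)\<^sup>2 / (q * (s q)\<^sup>2))) =
      (\<integral>\<^sup>+q. ennreal ((f q)\<^sup>2 / (q * (s q)\<^sup>2)) * indicator {q0..q1} q \<partial>lborel)"
    using q by (subst nn_integral_eq_integral[OF i2, symmetric])
      (auto simp: indicator_def intro!: nn_integral_cong)
  finally show ?thesis by (simp add: s_def)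
qed

text \<open>Averaging over the right endpoint replaces the boundary term by an \<open>L\<^sup>2\<close> norm.\<close>
lemma hardy_1d_average:
  fixes f f' :: "real \<Rightarrow> real"
  assumes d: "\<And>q. q0 \<le> q \<Longrightarrow> q \<le> 2 * Q \<Longrightarrow> (f has_real_derivative f' q) (at q)"
    and c: "continuous_on UNIV f" "continuous_on UNIV f'"
    and q: "0 < q0" "q0 \<le> Q" and b: "2 * Q * exp 1 \<le> b"
  shows "(\<integral>\<^sup>+q. ennreal ((f q)\<^sup>2 / (q * (ln (b / q))\<^sup>2)) * indicator {q0..Q} q \<partial>lborel) \<le>
    4 * (\<integral>\<^sup>+q. ennreal ((f' q)\<^sup>2 * q) * indicator {q0..2 * Q} q \<partial>lborel) +
    ennreal (2 / Q\<^sup>2) * (\<integral>\<^sup>+q. ennreal ((f q)\<^sup>2 * q) * indicator {q0..2 * Q} q \<partial>lborel)"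
    (is "?X \<le> 4 * ?Y + _ * ?Z")
proof -
  have Q: "Q > 0" using q by simp
  have [measurable]: "f \<in> borel_measurable borel" "f' \<in> borel_measurable borel"
    using c by (auto intro: borel_measurable_continuous_onI)
  have *: "?X \<le> 4 * ?Y + ennreal (2 * (f q1)\<^sup>2)" if q1: "q1 \<in> {Q..2 * Q}" for q1
  proof -
    have "q1 * 1 < q1 * exp 1" using Q q1 by (intro mult_strict_left_mono) auto
    moreover have qb: "q1 * exp 1 \<le> b"
    proof -
      have "q1 * exp 1 \<le> 2 * Q * exp 1" using q1 by (intro mult_right_mono) auto
      then show ?thesis using b by (rule order_trans)
    qed
    ultimately have q1b: "q1 < b" by simp
    \<comment> \<open>Since \<open>b\<close> is at least \<open>q1 * exp 1\<close>, the logarithm is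
      at least 1 and disappears from the boundary term.\<close>
    have "exp 1 \<le> b / q1" using qb Q q1 by (simp add: field_simps)
    then have "ln (b / q1) \<ge> 1" using Q q1 q1b by (subst ln_ge_iff) auto
    then have "2 * (f q1)\<^sup>2 / ln (b / q1) \<le> 2 * (f q1)\<^sup>2 / 1" by (intro divide_left_mono) auto
    then have le: "ennreal (2 * (f q1)\<^sup>2 / ln (b / q1)) \<le> ennreal (2 * (f q1)\<^sup>2)" by (intro ennreal_leI) simp
    have "?X \<le> (\<integral>\<^sup>+q. ennreal ((f q)\<^sup>2 / (q * (ln (b / q))\<^sup>2)) * indicator {q0..q1} q \<partial>lborel)"
      by (intro nn_integral_mono mult_left_mono) (use q1 in \<open>auto simp: indicator_def\<close>)
    also have "\<dots> \<le> 4 * (\<integral>\<^sup>+q. ennreal ((f' q)\<^sup>2 * q) * indicator {q0..q1} q \<partial>lborel) + ennreal (2 * (f q1)\<^sup>2 / ln (b / q1))"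
      using q1 q q1b by (intro hardy_1d d c) auto
    also have "\<dots> \<le> 4 * ?Y + ennreal (2 * (f q1)\<^sup>2)"
      by (intro add_mono mult_left_mono le nn_integral_mono) (use q1 in \<open>auto simp: indicator_def\<close>)
    finally show ?thesis .
  qed
  \<comment> \<open>Integration over \<open>q1\<close> in an interval of length \<open>Q\<close>, on
    which \<open>2 * (f q1)\<^sup>2 \<le> (2 / Q) * ((f q1)\<^sup>2 * q1)\<close>; the final
    division by \<open>Q\<close> produces \<open>2 / Q\<^sup>2\<close>. The factor \<open>q1\<close>
    is the Jacobian of the planar \<open>L\<^sup>2\<close> norm to come.\<close>
  have "?X * ennreal Q = (\<integral>\<^sup>+q1. ?X * indicator {Q..2 * Q} q1 \<partial>lborel)"
    using Q by (subst nn_integral_cmult_indicator) auto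
  also have "\<dots> \<le> (\<integral>\<^sup>+q1. (4 * ?Y) * indicator {Q..2 * Q} q1 + ennreal (2 / Q) * (ennreal ((f q1)\<^sup>2 * q1) * indicator {q0..2 * Q} q1) \<partial>lborel)"
  proof (rule nn_integral_mono)
    fix q1
    show "?X * indicator {Q..2 * Q} q1 \<le> (4 * ?Y) * indicator {Q..2 * Q} q1 + ennreal (2 / Q) * (ennreal ((f q1)\<^sup>2 * q1) * indicator {q0..2 * Q} q1)"
    proof (cases "q1 \<in> {Q..2 * Q}")
      case True
      have "2 * (f q1)\<^sup>2 * 1 \<le> 2 * (f q1)\<^sup>2 * (q1 / Q)" using True Q by (intro mult_left_mono) (auto simp: field_simps)
      then have "ennreal (2 * (f q1)\<^sup>2) \<le> ennreal (2 / Q * ((f q1)\<^sup>2 * q1))" by (intro ennreal_leI) (simp add: field_simps)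
      also have "\<dots> = ennreal (2 / Q) * ennreal ((f q1)\<^sup>2 * q1)" using Q True by (intro ennreal_mult) auto
      finally have "?X \<le> 4 * ?Y + ennreal (2 / Q) * ennreal ((f q1)\<^sup>2 * q1)"
        using *[OF True] by (meson add_left_mono order_trans)
      then show ?thesis using True q by simp
    qed simp
  qed
  also have "\<dots> = (4 * ?Y) * ennreal Q + ennreal (2 / Q) * ?Z"
    using Q by (subst nn_integral_add) (auto simp: nn_integral_cmult nn_integral_cmult_indicator)
  finally have "?X * ennreal Q * ennreal (1 / Q) \<le> ((4 * ?Y) * ennreal Q + ennreal (2 / Q) * ?Z) * ennreal (1 / Q)"
    by (rule mult_right_mono) simp
  also have "\<dots> = (4 * ?Y) * (ennreal Q * ennreal (1 / Q)) + (ennreal (2 / Q) * ennreal (1 / Q)) * ?Z"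
    by (simp add: distrib_right distrib_left mult_ac)
  finally have "?X * (ennreal Q * ennreal (1 / Q)) \<le> (4 * ?Y) * (ennreal Q * ennreal (1 / Q)) + (ennreal (2 / Q) * ennreal (1 / Q)) * ?Z"
    by (simp only: mult.assoc)
  moreover have "ennreal Q * ennreal (1 / Q) = 1" using Q by (simp flip: ennreal_mult)
  moreover have "ennreal (2 / Q) * ennreal (1 / Q) = ennreal (2 / Q\<^sup>2)"
    using Q by (simp add: power2_eq_square flip: ennreal_mult)
  ultimately show ?thesis by (simp only: mult_1_right)
qed

section \<open>Change of variables to curved polar coordinates\<close>

lemma lborel_distr_orthogonal:
  fixes T :: "real^2 \<Rightarrow> real^2"
  assumes T: "orthogonal_transformation T"
  shows "distr lborel borel T = lborel"
proof (rule lborel_eqI[symmetric])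
  have [measurable]: "T \<in> borel_measurable borel"
    by (rule borel_measurable_continuous_onI[OF orthogonal_continuous[OF T]])
  note Ti = orthogonal_transformation_inv[OF T]
  fix l u :: "real^2"
  assume lu: "\<And>b. b \<in> Basis \<Longrightarrow> l \<bullet> b \<le> u \<bullet> b"
  \<comment> \<open>The preimage of a box is its image under the inverse, which is again orthogonal
    and hence preserves measure.\<close>
  have vi: "T -` box l u = inv T ` box l u"
    using orthogonal_transformation_bij[OF T] by (rule bij_vimage_eq_inv_image)
  have m: "inv T ` box l u \<in> lmeasurable" by (rule measurable_orthogonal_image[OF Ti]) simp
  have "emeasure (distr lborel borel T) (box l u) = emeasure lebesgue (T -` box l u)"
    by (subst emeasure_distr) (auto simp: measurable_sets[of T borel borel, simplified])
  also have "\<dots> = ennreal (measure lebesgue (box l u))"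
    using m unfolding vi by (simp add: emeasure_eq_measure2 measure_orthogonal_image[OF Ti])
  also have "\<dots> = ennreal (\<Prod>b\<in>Basis. (u - l) \<bullet> b)"
    using lu by (simp add: measure_lborel_box_eq)
  finally show "emeasure (distr lborel borel T) (box l u) = (\<Prod>b\<in>Basis. (u - l) \<bullet> b)" .
qed simp

definition vec2 :: "real \<Rightarrow> real \<Rightarrow> real^2" where
  "vec2 p q = p *\<^sub>R axis 1 1 + q *\<^sub>R axis 2 1"

lemma vec2_nth [simp]: "vec2 p q $ 1 = p" "vec2 p q $ 2 = q"
  by (auto simp: vec2_def axis_def)

lemma vec2_eta: "vec2 (x $ 1) (x $ 2) = x"
  by (simp add: vec_eq_iff forall_2)

lemma vec2_add: "vec2 p q + vec2 p' q' = vec2 (p + p') (q + q')"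
  by (simp add: vec_eq_iff forall_2)

lemma vec2_scaleR: "c *\<^sub>R vec2 p q = vec2 (c * p) (c * q)"
  by (simp add: vec_eq_iff forall_2)

lemma norm_vec2: "norm (vec2 p q) = sqrt (p\<^sup>2 + q\<^sup>2)"
  by (simp add: norm_vec_def L2_set_def sum_2)

lemma vec2_continuous [continuous_intros]:
  "continuous_on S f \<Longrightarrow> continuous_on S g \<Longrightarrow> continuous_on S (\<lambda>x. vec2 (f x) (g x))"
  unfolding vec2_def by (intro continuous_intros)

lemma vec2_measurable [measurable]: "(\<lambda>p. vec2 (fst p) (snd p)) \<in> borel_measurable borel"
  by (intro borel_measurable_continuous_onI continuous_intros)

text \<open>Both measures agree on boxes, whose preimages are products of intervals.\<close>

lemma lborel_vec2: "distr (lborel \<Otimes>\<^sub>M lborel) borel (\<lambda>p. vec2 (fst p) (snd p)) = lborel"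
proof (rule lborel_eqI[symmetric])
  have B: "(Basis :: (real^2) set) = {axis 1 1, axis 2 1}"
    by (auto simp: Basis_vec_def UNIV_2)
  have ne: "axis 1 1 \<noteq> (axis 2 1 :: real^2)" by (simp add: axis_eq_axis)
  fix l u :: "real^2"
  assume lu: "\<And>b. b \<in> Basis \<Longrightarrow> l \<bullet> b \<le> u \<bullet> b"
  have lu2: "l $ 1 \<le> u $ 1" "l $ 2 \<le> u $ 2"
    using lu[of "axis 1 1"] lu[of "axis 2 1"] by (auto simp: B inner_axis)
  have pre: "(\<lambda>p. vec2 (fst p) (snd p)) -` box l u = {l $ 1<..<u $ 1} \<times> {l $ 2<..<u $ 2}"
    by (auto simp: mem_box_cart forall_2)
  have "emeasure (distr (lborel \<Otimes>\<^sub>M lborel) borel (\<lambda>p. vec2 (fst p) (snd p))) (box l u) =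
      emeasure (lborel \<Otimes>\<^sub>M lborel) ({l $ 1<..<u $ 1} \<times> {l $ 2<..<u $ 2})"
    by (subst emeasure_distr) (auto simp: pre lborel_prod)
  also have "\<dots> = ennreal (u $ 1 - l $ 1) * ennreal (u $ 2 - l $ 2)"
    using lu2 by (subst lborel.emeasure_pair_measure_Times) auto
  also have "\<dots> = ennreal (\<Prod>b\<in>Basis. (u - l) \<bullet> b)"
    using lu2 ne by (simp add: B inner_axis ennreal_mult inner_diff_left)
  finally show "emeasure (distr (lborel \<Otimes>\<^sub>M lborel) borel (\<lambda>p. vec2 (fst p) (snd p))) (box l u) =
    (\<Prod>b\<in>Basis. (u - l) \<bullet> b)" .
qed simp

lemma nn_integral_vec2:
  assumes [measurable]: "F \<in> borel_measurable borel"
  shows "(\<integral>\<^sup>+x. F x \<partial>lborel) = (\<integral>\<^sup>+p. \<integral>\<^sup>+q. F (vec2 p q) \<partial>lborel \<partial>lborel)"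
proof -
  have "(\<integral>\<^sup>+x. F x \<partial>lborel) = (\<integral>\<^sup>+x. F x \<partial>distr (lborel \<Otimes>\<^sub>M lborel) borel (\<lambda>p. vec2 (fst p) (snd p)))"
    by (simp add: lborel_vec2)
  also have "\<dots> = (\<integral>\<^sup>+p. F (vec2 (fst p) (snd p)) \<partial>(lborel \<Otimes>\<^sub>M lborel))"
    by (subst nn_integral_distr) (auto simp: lborel_prod)
  also have "\<dots> = (\<integral>\<^sup>+p. \<integral>\<^sup>+q. F (vec2 p q) \<partial>lborel \<partial>lborel)"
    by (subst lborel.nn_integral_fst[symmetric]) (auto simp: lborel_prod)
  finally show ?thesis .
qed

text \<open>Coordinates \<open>(p, q)\<close> on \<open>{x. \<gamma> (T x $ 1) < T x $ 2}\<close>: the curves \<open>p = const\<close> are the images of the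
  rays from the origin after the boundary has been flattened by a shear; the Jacobian is \<open>q\<close>.\<close>
lemma nn_integral_flattened_polar:
  fixes T :: "real^2 \<Rightarrow> real^2" and \<gamma> :: "real \<Rightarrow> real"
  assumes T: "orthogonal_transformation T"
    and F [measurable]: "F \<in> borel_measurable borel" and \<gamma> [measurable]: "\<gamma> \<in> borel_measurable borel"
    and z: "\<And>x. T x $ 2 \<le> \<gamma> (T x $ 1) \<Longrightarrow> F x = 0"
  shows "(\<integral>\<^sup>+x. F x \<partial>lborel) =
    (\<integral>\<^sup>+p. \<integral>\<^sup>+q. F (inv T (vec2 (p * q) (q + \<gamma> (p * q)))) * ennreal q * indicator {0<..} q \<partial>lborel \<partial>lborel)"
proof -
  let ?S = "inv T"
  note S = orthogonal_transformation_inv[OF T]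
  have [measurable]: "?S \<in> borel_measurable borel"
    by (rule borel_measurable_continuous_onI[OF orthogonal_continuous[OF S]])
  have TS: "T (?S y) = y" for y by (simp add: orthogonal_transformation_surj[OF T] surj_f_inv_f)
  have [measurable]: "(\<lambda>(q, a). vec2 a (\<gamma> a + q)) \<in> borel_measurable (borel \<Otimes>\<^sub>M borel)"
    "(\<lambda>(p, q). vec2 (p * q) (q + \<gamma> (p * q))) \<in> borel_measurable (borel \<Otimes>\<^sub>M borel)"
    "(\<lambda>(a, q). vec2 a (\<gamma> a + q)) \<in> borel_measurable (borel \<Otimes>\<^sub>M borel)"
    "(\<lambda>(a, b). vec2 a b) \<in> borel_measurable (borel \<Otimes>\<^sub>M borel)"
    unfolding vec2_def by measurable
  have "(\<integral>\<^sup>+x. F x \<partial>lborel) = (\<integral>\<^sup>+x. F x \<partial>distr lborel borel ?S)"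
    by (simp add: lborel_distr_orthogonal[OF S])
  also have "\<dots> = (\<integral>\<^sup>+x. F (?S x) \<partial>lborel)" by (subst nn_integral_distr) auto
  also have "\<dots> = (\<integral>\<^sup>+a. \<integral>\<^sup>+b. F (?S (vec2 a b)) \<partial>lborel \<partial>lborel)"
    by (rule nn_integral_vec2) measurable
  also have "\<dots> = (\<integral>\<^sup>+a. \<integral>\<^sup>+q. F (?S (vec2 a (\<gamma> a + q))) * indicator {0<..} q \<partial>lborel \<partial>lborel)"
  proof (rule nn_integral_cong)
    fix a
    \<comment> \<open>For a fixed first coordinate the boundary is flattened by a translation in the
      second one; the vanishing hypothesis then supplies the indicator of positive heights.\<close>
    have "(\<integral>\<^sup>+b. F (?S (vec2 a b)) \<partial>lborel) = (\<integral>\<^sup>+q. F (?S (vec2 a (\<gamma> a + q))) \<partial>lborel)"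
      by (rule nn_integral_lborel_shift[symmetric]) measurable
    also have "\<dots> = (\<integral>\<^sup>+q. F (?S (vec2 a (\<gamma> a + q))) * indicator {0<..} q \<partial>lborel)"
    proof (rule nn_integral_cong)
      fix q
      show "F (?S (vec2 a (\<gamma> a + q))) = F (?S (vec2 a (\<gamma> a + q))) * indicator {0<..} q"
        using z[of "?S (vec2 a (\<gamma> a + q))"] by (auto simp: TS indicator_def)
    qed
    finally show "(\<integral>\<^sup>+b. F (?S (vec2 a b)) \<partial>lborel) = (\<integral>\<^sup>+q. F (?S (vec2 a (\<gamma> a + q))) * indicator {0<..} q \<partial>lborel)" .
  qed
  also have "\<dots> = (\<integral>\<^sup>+q. \<integral>\<^sup>+a. F (?S (vec2 a (\<gamma> a + q))) * indicator {0<..} q \<partial>lborel \<partial>lborel)"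
    by (rule lborel_pair.Fubini') measurable
  also have "\<dots> = (\<integral>\<^sup>+q. \<integral>\<^sup>+p. F (?S (vec2 (p * q) (q + \<gamma> (p * q)))) * ennreal q * indicator {0<..} q \<partial>lborel \<partial>lborel)"
  proof (rule nn_integral_cong)
    fix q :: real
    show "(\<integral>\<^sup>+a. F (?S (vec2 a (\<gamma> a + q))) * indicator {0<..} q \<partial>lborel) =
      (\<integral>\<^sup>+p. F (?S (vec2 (p * q) (q + \<gamma> (p * q)))) * ennreal q * indicator {0<..} q \<partial>lborel)"
    proof (cases "q > 0")
      case True
      \<comment> \<open>The substitution \<open>a = q * p\<close> at fixed height \<open>q\<close>
        produces the Jacobian \<open>q\<close>.\<close>
      have "(\<integral>\<^sup>+a. F (?S (vec2 a (\<gamma> a + q))) * indicator {0<..} q \<partial>lborel) =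
        ennreal \<bar>q\<bar> * (\<integral>\<^sup>+p. F (?S (vec2 (0 + q * p) (\<gamma> (0 + q * p) + q))) * indicator {0<..} q \<partial>lborel)"
        using True by (intro nn_integral_real_affine) auto
      also have "\<dots> = (\<integral>\<^sup>+p. ennreal q * (F (?S (vec2 (p * q) (q + \<gamma> (p * q)))) * indicator {0<..} q) \<partial>lborel)"
        using True by (subst nn_integral_cmult) (auto simp: mult.commute add.commute)
      finally show ?thesis by (simp add: mult_ac)
    qed simp
  qed
  also have "\<dots> = (\<integral>\<^sup>+p. \<integral>\<^sup>+q. F (?S (vec2 (p * q) (q + \<gamma> (p * q)))) * ennreal q * indicator {0<..} q \<partial>lborel \<partial>lborel)"
    by (rule lborel_pair.Fubini') measurable
  finally show ?thesis .
qed

section \<open>The Hardy inequality in a chart at the origin\<close>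

lemma hardy_weight_measurable [measurable]: "hardy_weight a \<in> borel_measurable borel"
  unfolding hardy_weight_def by measurable

lemma hardy_weight_nonneg: "0 \<le> hardy_weight a x"
  unfolding hardy_weight_def by simp

text \<open>\<eta> bounds the relative distortion, and up to \<open>2 * \<delta>\<close> the slope
  of the boundary varies by at most \<eta>. The factor 2 in \<open>near\<close> and
  \<open>small\<close> leaves room for averaging over the outer endpoint; \<open>small\<close> keeps
  the logarithm at least 1 on the larger region, with \<open>a / (1 + \<eta>)\<close> allowing for
  the distortion of the norm.\<close>

locale boundary_chart =
  fixes T :: "real^2 \<Rightarrow> real^2" and \<gamma> \<gamma>' :: "real \<Rightarrow> real" and a \<eta> \<delta> :: real
  assumes T: "orthogonal_transformation T"
    and \<gamma>: "\<And>t. (\<gamma> has_real_derivative \<gamma>' t) (at t)" and \<gamma>'c: "continuous_on UNIV \<gamma>'"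
    and \<gamma>0: "\<gamma> 0 = 0" and a: "a > 1" and \<eta>: "0 < \<eta>" "\<eta> \<le> 1/2" and \<delta>: "\<delta> > 0"
    and near: "\<And>t. \<bar>t\<bar> \<le> 2 * \<delta> \<Longrightarrow> \<bar>\<gamma>' t - \<gamma>' 0\<bar> \<le> \<eta>"
    and small: "2 * \<delta> * exp 1 \<le> a / (1 + \<eta>)"
begin

definition height :: "real^2 \<Rightarrow> real" where "height x = T x $ 2 - \<gamma> (T x $ 1)"

text \<open>The boundary is sheared onto its tangent at the origin instead of onto the horizontal
  axis. The map then differs from \<open>T\<close> only by
  \<open>\<gamma> t - \<gamma>' 0 * t\<close> in the second coordinate, so near the origin it almost
  preserves the norm.\<close>

definition straight :: "real^2 \<Rightarrow> real^2" where
  "straight x = vec2 (T x $ 1) (height x + \<gamma>' 0 * (T x $ 1))"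

text \<open>Pieces that increase with \<open>j\<close> and keep away from the boundary; in the
  curved coordinates they are given by \<open>1 / j \<le> q\<close> and
  \<open>\<bar>p\<bar> \<le> j\<close>. The outer cut uses the straightened norm, so that on each
  curve it becomes the bound \<open>q \<le> \<rho> / slope p\<close>.\<close>

definition sector :: "real \<Rightarrow> real \<Rightarrow> (real^2) set" where
  "sector j \<rho> = {x. 1 \<le> j * height x \<and> \<bar>T x $ 1\<bar> \<le> j * height x \<and> norm (straight x) \<le> \<rho>}"

text \<open>The length of the ray direction with parameter \<open>p\<close>:
  \<open>slope p * q\<close> is the straightened norm of \<open>curve p q\<close>, so up to
  distortion this is the factor between the parameter \<open>q\<close> and the distance from the
  origin.\<close>

definition slope :: "real \<Rightarrow> real" where "slope p = norm (vec2 p (1 + \<gamma>' 0 * p))"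

text \<open>For \<open>q > 0\<close> this is the point that \<open>straight\<close> maps to
  \<open>q\<close> times the vector \<open>(p, 1 + \<gamma>' 0 * p)\<close>, a point of a straight
  ray. The curve tends to the origin as \<open>q\<close> tends to 0 because
  \<open>\<gamma> 0 = 0\<close>.\<close>

definition curve :: "real \<Rightarrow> real \<Rightarrow> real^2" where
  "curve p q = inv T (vec2 (p * q) (q + \<gamma> (p * q)))"

definition velocity :: "real \<Rightarrow> real \<Rightarrow> real^2" where
  "velocity p q = inv T (vec2 p (1 + \<gamma>' (p * q) * p))"

lemma T_inv: "T (inv T y) = y"
  by (simp add: orthogonal_transformation_surj[OF T] surj_f_inv_f)

lemmas inv_T = orthogonal_transformation_inv[OF T]

lemma norm_inv_T: "norm (inv T y) = norm y"
  by (rule orthogonal_transformation_norm[OF inv_T])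

lemma \<gamma>_continuous: "continuous_on UNIV \<gamma>"
  using \<gamma> DERIV_isCont by (auto intro!: continuous_at_imp_continuous_on)

lemma \<gamma>_measurable [measurable]: "\<gamma> \<in> borel_measurable borel"
  by (rule borel_measurable_continuous_onI[OF \<gamma>_continuous])

lemma T_coord_continuous: "continuous_on UNIV (\<lambda>x. T x $ i)"
  by (intro continuous_intros orthogonal_continuous T)

lemma height_continuous: "continuous_on UNIV height"
  unfolding height_def
  by (intro continuous_intros T_coord_continuous continuous_on_compose2[OF \<gamma>_continuous T_coord_continuous]) auto

lemma straight_continuous: "continuous_on UNIV straight"
  unfolding straight_def by (intro continuous_intros T_coord_continuous height_continuous)

lemma slope_pos: "slope p > 0" and abs_le_slope: "\<bar>p\<bar> \<le> slope p"
proof -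
  show "\<bar>p\<bar> \<le> slope p"
    unfolding slope_def norm_vec2 by (rule real_le_rsqrt) simp
  have "p \<noteq> 0 \<or> 1 + \<gamma>' 0 * p \<noteq> 0" by auto
  then have "p\<^sup>2 + (1 + \<gamma>' 0 * p)\<^sup>2 > 0" by (metis sum_power2_gt_zero_iff)
  then show "slope p > 0" unfolding slope_def norm_vec2 by simp
qed

lemma \<gamma>_near: "\<bar>t\<bar> \<le> 2 * \<delta> \<Longrightarrow> \<bar>\<gamma> t - \<gamma>' 0 * t\<bar> \<le> \<eta> * \<bar>t\<bar>"
proof -
  assume t: "\<bar>t\<bar> \<le> 2 * \<delta>"
  have "norm ((\<gamma> t - \<gamma>' 0 * t) - (\<gamma> 0 - \<gamma>' 0 * 0)) \<le> \<eta> * norm (t - 0)"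
  proof (rule field_differentiable_bound[of "cball 0 (2 * \<delta>)" "\<lambda>t. \<gamma> t - \<gamma>' 0 * t" "\<lambda>t. \<gamma>' t - \<gamma>' 0"])
    show "((\<lambda>t. \<gamma> t - \<gamma>' 0 * t) has_field_derivative \<gamma>' z - \<gamma>' 0) (at z within cball 0 (2 * \<delta>))" for z
      using DERIV_diff[OF \<gamma>[of z] DERIV_cmult[OF DERIV_ident, of "\<gamma>' 0" z UNIV]]
      by (auto intro: has_field_derivative_at_within)
  qed (use near t \<delta> in auto)
  then show ?thesis using \<gamma>0 by simp
qed

text \<open>The curve is its tangent ray plus a vertical error, which the mean value bound keeps
  below \<open>\<eta> * (slope p * q)\<close>; for the velocity the variation of
  \<open>\<gamma>'\<close> plays the same part.\<close>

lemma curve_bounds: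
  assumes q: "q > 0" "slope p * q \<le> 2 * \<delta>"
  shows "(1 - \<eta>) * (slope p * q) \<le> norm (curve p q)" "norm (curve p q) \<le> (1 + \<eta>) * (slope p * q)"
    "norm (velocity p q) \<le> (1 + \<eta>) * slope p"
proof -
  have "\<bar>p * q\<bar> \<le> slope p * q" using q abs_le_slope[of p] by (simp add: abs_mult)
  then have pq: "\<bar>p * q\<bar> \<le> 2 * \<delta>" using q by simp
  have le: "norm (x + vec2 0 y) \<le> norm x + \<bar>y\<bar>" "norm x - \<bar>y\<bar> \<le> norm (x + vec2 0 y)" for x y
    using norm_triangle_ineq[of x "vec2 0 y"] norm_diff_ineq[of x "vec2 0 y"] by (auto simp: norm_vec2)
  have 1: "vec2 (p * q) (q + \<gamma> (p * q)) = q *\<^sub>R vec2 p (1 + \<gamma>' 0 * p) + vec2 0 (\<gamma> (p * q) - \<gamma>' 0 * (p * q))"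
    by (simp add: vec2_add vec2_scaleR algebra_simps)
  have "\<bar>\<gamma> (p * q) - \<gamma>' 0 * (p * q)\<bar> \<le> \<eta> * \<bar>p * q\<bar>" by (rule \<gamma>_near[OF pq])
  also have "\<dots> \<le> \<eta> * (slope p * q)"
    using \<eta> q abs_le_slope[of p] by (intro mult_left_mono) (auto simp: abs_mult)
  finally have 2: "\<bar>\<gamma> (p * q) - \<gamma>' 0 * (p * q)\<bar> \<le> \<eta> * (slope p * q)" .
  have n: "norm (q *\<^sub>R vec2 p (1 + \<gamma>' 0 * p)) = slope p * q" using q by (simp add: slope_def)
  show "(1 - \<eta>) * (slope p * q) \<le> norm (curve p q)" "norm (curve p q) \<le> (1 + \<eta>) * (slope p * q)"
    using le(1)[of "q *\<^sub>R vec2 p (1 + \<gamma>' 0 * p)" "\<gamma> (p * q) - \<gamma>' 0 * (p * q)"]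
      le(2)[of "q *\<^sub>R vec2 p (1 + \<gamma>' 0 * p)" "\<gamma> (p * q) - \<gamma>' 0 * (p * q)"] 2
    unfolding curve_def norm_inv_T 1 n by (auto simp: algebra_simps)
  have 3: "vec2 p (1 + \<gamma>' (p * q) * p) = vec2 p (1 + \<gamma>' 0 * p) + vec2 0 ((\<gamma>' (p * q) - \<gamma>' 0) * p)"
    by (simp add: vec2_add algebra_simps)
  have "\<bar>(\<gamma>' (p * q) - \<gamma>' 0) * p\<bar> \<le> \<eta> * slope p"
    unfolding abs_mult using near[OF pq] abs_le_slope[of p] \<eta> by (intro mult_mono) auto
  then show "norm (velocity p q) \<le> (1 + \<eta>) * slope p"
    using le(1)[of "vec2 p (1 + \<gamma>' 0 * p)" "(\<gamma>' (p * q) - \<gamma>' 0) * p"]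
    unfolding velocity_def norm_inv_T 3 slope_def[symmetric] by (simp add: algebra_simps)
qed

text \<open>\<open>curve p q\<close> has height \<open>q\<close>, first coordinate
  \<open>p * q\<close> and straightened norm \<open>slope p * q\<close>; the three conditions become
  an interval for \<open>q\<close> and a bound on \<open>p\<close>.\<close>

lemma sector_curve:
  assumes "q > 0" "j > 0"
  shows "curve p q \<in> sector j \<rho> \<longleftrightarrow> 1 / j \<le> q \<and> \<bar>p\<bar> \<le> j \<and> slope p * q \<le> \<rho>"
proof -
  have h: "height (curve p q) = q" by (simp add: height_def curve_def T_inv)
  have "straight (curve p q) = q *\<^sub>R vec2 p (1 + \<gamma>' 0 * p)"
    unfolding straight_def h by (simp add: curve_def T_inv vec2_scaleR algebra_simps)
  then have s: "norm (straight (curve p q)) = slope p * q" using assms by (simp add: slope_def)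
  have "\<bar>p * q\<bar> \<le> j * q \<longleftrightarrow> \<bar>p\<bar> \<le> j" using assms by (simp add: abs_mult)
  then show ?thesis
    using assms unfolding sector_def mem_Collect_eq h s by (simp add: curve_def T_inv field_simps)
qed

lemma curve_height: "height x > 0 \<Longrightarrow> x = curve (T x $ 1 / height x) (height x)"
  unfolding curve_def height_def
  by (simp add: vec2_eta orthogonal_transformation_inj[OF T])

lemma sector_height: "j > 0 \<Longrightarrow> x \<in> sector j \<rho> \<Longrightarrow> height x > 0"
  unfolding sector_def using mult_nonneg_nonpos[of j "height x"] by fastforce

lemma sector_norm:
  assumes "j > 0" "x \<in> sector j \<rho>" "\<rho> \<le> 2 * \<delta>"
  shows "norm x \<le> (1 + \<eta>) * \<rho>"
proof -
  have h: "height x > 0" by (rule sector_height[OF assms(1,2)])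
  define p where "p = T x $ 1 / height x"
  have x: "x = curve p (height x)" unfolding p_def by (rule curve_height[OF h])
  then have s: "slope p * height x \<le> \<rho>" using sector_curve[OF h assms(1), of p \<rho>] assms(2) by metis
  have "norm x \<le> (1 + \<eta>) * (slope p * height x)"
    using curve_bounds(2)[OF h, of p] s assms(3) x by auto
  also have "\<dots> \<le> (1 + \<eta>) * \<rho>" using s \<eta> by (intro mult_left_mono) auto
  finally show ?thesis .
qed

lemma sector_compact:
  assumes "j > 0" "\<rho> \<le> 2 * \<delta>"
  shows "compact (sector j \<rho>)"
  unfolding compact_eq_bounded_closed
proof
  show "bounded (sector j \<rho>)" using sector_norm[OF assms(1) _ assms(2)] unfolding bounded_iff by blast
  have "closed {x. 1 \<le> j * height x}" "closed {x. \<bar>T x $ 1\<bar> \<le> j * height x}" "closed {x. norm (straight x) \<le> \<rho>}"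
    by (intro closed_Collect_le continuous_intros T_coord_continuous height_continuous straight_continuous)+
  moreover have "sector j \<rho> = {x. 1 \<le> j * height x} \<inter> {x. \<bar>T x $ 1\<bar> \<le> j * height x} \<inter> {x. norm (straight x) \<le> \<rho>}"
    by (auto simp: sector_def)
  ultimately show "closed (sector j \<rho>)" by auto
qed

lemma nn_integral_sector:
  assumes [measurable]: "F \<in> borel_measurable borel" and j: "j > 0" and \<rho>: "\<rho> \<le> 2 * \<delta>"
  shows "(\<integral>\<^sup>+x. F x * indicator (sector j \<rho>) x \<partial>lborel) =
    (\<integral>\<^sup>+p. \<integral>\<^sup>+q. F (curve p q) * ennreal q * indicator {1 / j..\<rho> / slope p} q * indicator {-j..j} p \<partial>lborel \<partial>lborel)"
proof -
  have [measurable]: "sector j \<rho> \<in> sets borel"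
    using sector_compact[OF j \<rho>] by (simp add: compact_imp_closed)
  have "(\<integral>\<^sup>+x. F x * indicator (sector j \<rho>) x \<partial>lborel) =
    (\<integral>\<^sup>+p. \<integral>\<^sup>+q. (F (curve p q) * indicator (sector j \<rho>) (curve p q)) * ennreal q * indicator {0<..} q \<partial>lborel \<partial>lborel)"
    unfolding curve_def
  proof (rule nn_integral_flattened_polar[OF T])
    fix x assume "T x $ 2 \<le> \<gamma> (T x $ 1)"
    then have "x \<notin> sector j \<rho>" using sector_height[OF j, of x \<rho>] by (auto simp: height_def)
    then show "F x * indicator (sector j \<rho>) x = 0" by simp
  qed measurable
  also have "\<dots> = (\<integral>\<^sup>+p. \<integral>\<^sup>+q. F (curve p q) * ennreal q * indicator {1 / j..\<rho> / slope p} q * indicator {-j..j} p \<partial>lborel \<partial>lborel)"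
  proof (intro nn_integral_cong)
    fix p q
    show "(F (curve p q) * indicator (sector j \<rho>) (curve p q)) * ennreal q * indicator {0<..} q =
      F (curve p q) * ennreal q * indicator {1 / j..\<rho> / slope p} q * indicator {-j..j} p"
    proof (cases "q > 0")
      case True
      have "slope p * q \<le> \<rho> \<longleftrightarrow> q \<le> \<rho> / slope p" using slope_pos[of p] by (simp add: field_simps)
      moreover have "\<bar>p\<bar> \<le> j \<longleftrightarrow> p \<in> {-j..j}" by auto
      ultimately show ?thesis using sector_curve[OF True j, of p \<rho>] True
        by (auto simp: indicator_def)
    next
      case False
      have "0 < 1 / j" using j by simp
      then have "q \<notin> {1 / j..}" using False by (simp add: not_le del: zero_less_divide_1_iff)
      then show ?thesis using False by (auto simp: indicator_def)
    qed
  qed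
  finally show ?thesis .
qed

lemma curve_has_derivative:
  assumes "(v has_derivative (\<lambda>h. G \<bullet> h)) (at (curve p q))"
  shows "((\<lambda>q. v (curve p q)) has_real_derivative (G \<bullet> velocity p q)) (at q)"
proof -
  have 1: "((\<lambda>q. \<gamma> (p * q)) has_real_derivative \<gamma>' (p * q) * p) (at q)"
    by (rule DERIV_chain'[where g=\<gamma>]) (auto intro!: derivative_eq_intros \<gamma>)
  have "((\<lambda>q. vec2 (p * q) (q + \<gamma> (p * q))) has_derivative (\<lambda>h. h *\<^sub>R vec2 p (1 + \<gamma>' (p * q) * p))) (at q)"
    unfolding vec2_def using 1[unfolded has_field_derivative_def]
    by (auto intro!: derivative_eq_intros simp: algebra_simps)
  then have "((\<lambda>q. curve p q) has_derivative (\<lambda>h. inv T (h *\<^sub>R vec2 p (1 + \<gamma>' (p * q) * p)))) (at q)"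
    unfolding curve_def
    by (rule bounded_linear.has_derivative[OF linear_conv_bounded_linear[THEN iffD1, OF orthogonal_transformation_linear[OF inv_T]]])
  then have "((\<lambda>q. curve p q) has_derivative (\<lambda>h. h *\<^sub>R velocity p q)) (at q)"
    by (simp add: velocity_def linear_scale[OF orthogonal_transformation_linear[OF inv_T]])
  from has_derivative_compose[OF this assms] show ?thesis
    by (simp add: has_field_derivative_def mult.commute[of _ "_ \<bullet> _"])
qed

lemma curve_continuous: "continuous_on UNIV (\<lambda>q. curve p q)"
  unfolding curve_def
  by (intro continuous_on_compose2[OF orthogonal_continuous[OF inv_T, of UNIV]] continuous_intros
     continuous_on_compose2[OF \<gamma>_continuous]) auto

lemma velocity_continuous: "continuous_on UNIV (\<lambda>q. velocity p q)"
  unfolding velocity_def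
  by (intro continuous_on_compose2[OF orthogonal_continuous[OF inv_T, of UNIV]] continuous_intros
     continuous_on_compose2[OF \<gamma>'c]) auto

text \<open>The denominator is bounded below factor by factor: the lower bound for the norm enters
  the square and the upper bound the logarithm, which is at least 1 by \<open>small\<close>, so
  squaring preserves the comparison.\<close>

lemma curve_weight_le:
  assumes q: "q > 0" "slope p * q \<le> \<delta>"
  shows "hardy_weight a (curve p q) * q \<le>
    1 / ((1 - \<eta>)\<^sup>2 * (slope p)\<^sup>2) * (1 / (q * (ln (a / (1 + \<eta>) / slope p / q))\<^sup>2))"
proof -
  let ?k = "slope p" and ?c = "norm (curve p q)"
  define s where "s = ln (a / (1 + \<eta>) / ?k / q)"
  have kq: "?k * q > 0" using q slope_pos by simp
  have kq2: "?k * q \<le> 2 * \<delta>" using q \<delta> by linarith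
  note cb = curve_bounds[OF q(1) kq2]
  have "0 < (1 - \<eta>) * (?k * q)" by (rule mult_pos_pos[OF _ kq]) (use \<eta> in simp)
  then have c0: "?c > 0" using cb(1) by linarith
  have "?k * q * exp 1 \<le> 2 * \<delta> * exp 1" using kq2 by (intro mult_right_mono) auto
  also have "\<dots> \<le> a / (1 + \<eta>)" by (rule small)
  finally have "exp 1 \<le> a / (1 + \<eta>) / ?k / q"
    using q slope_pos[of p] by (simp only: pos_le_divide_eq mult_ac)
  then have s1: "s \<ge> 1" unfolding s_def by (subst ln_ge_iff) (auto intro: less_le_trans[OF exp_gt_zero])
  have "a / (1 + \<eta>) / ?k / q = a / ((1 + \<eta>) * (?k * q))" by (simp add: field_simps)
  also have "\<dots> \<le> a / ?c"
  proof (rule divide_left_mono[OF cb(2)])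
    have "0 < (1 + \<eta>) * (?k * q)" by (rule mult_pos_pos[OF _ kq]) (use \<eta> in simp)
    then show "0 < (1 + \<eta>) * (?k * q) * ?c" using c0 by (rule mult_pos_pos)
  qed (use a in simp)
  finally have le: "a / (1 + \<eta>) / ?k / q \<le> a / ?c" .
  have "0 < a / (1 + \<eta>) / ?k / q" using a \<eta> q slope_pos[of p] by simp
  then have s2: "s \<le> ln (a / ?c)" unfolding s_def using le by (subst ln_le_cancel_iff) (auto intro: less_le_trans)
  have "((1 - \<eta>) * (?k * q))\<^sup>2 * s\<^sup>2 \<le> ?c\<^sup>2 * (ln (a / ?c))\<^sup>2"
    using cb(1) s1 s2 kq \<eta> by (intro mult_mono power_mono) auto
  moreover have "0 < ((1 - \<eta>) * (?k * q))\<^sup>2 * s\<^sup>2"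
    using mult_pos_pos[OF zero_less_power[OF \<open>0 < (1 - \<eta>) * (?k * q)\<close>, of 2] zero_less_power[of s 2]] s1 by simp
  ultimately have "hardy_weight a (curve p q) \<le> 1 / (((1 - \<eta>) * (?k * q))\<^sup>2 * s\<^sup>2)"
    unfolding hardy_weight_def by (intro divide_left_mono) (auto intro!: mult_pos_pos)
  then have "hardy_weight a (curve p q) * q \<le> 1 / (((1 - \<eta>) * (?k * q))\<^sup>2 * s\<^sup>2) * q"
    using q by (intro mult_right_mono) auto
  also have "\<dots> = 1 / ((1 - \<eta>)\<^sup>2 * ?k\<^sup>2) * (1 / (q * s\<^sup>2))"
    using q by (simp add: power2_eq_square)
  finally show ?thesis by (simp add: s_def)
qed

text \<open>The averaged one-dimensional inequality for \<open>v\<close> along the curve, with outer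
  radius \<open>\<delta> / slope p\<close>. The weight contributes
  \<open>1 / (slope p)\<^sup>2\<close> and the chain rule \<open>(slope p)\<^sup>2\<close>; they
  cancel, so the constants do not depend on \<open>p\<close>.\<close>

lemma hardy_curve:
  fixes v :: "real^2 \<Rightarrow> real" and G :: "real^2 \<Rightarrow> real^2"
  assumes d: "\<And>x. x \<in> sector j (2 * \<delta>) \<Longrightarrow> (v has_derivative (\<lambda>h. G x \<bullet> h)) (at x)"
    and v: "continuous_on UNIV v" and G: "continuous_on UNIV G" and j: "j > 0" and p: "\<bar>p\<bar> \<le> j"
  shows "(\<integral>\<^sup>+q. ennreal ((v (curve p q))\<^sup>2 * hardy_weight a (curve p q)) * ennreal q * indicator {1 / j..\<delta> / slope p} q \<partial>lborel) \<le>
    ennreal (4 * ((1 + \<eta>) / (1 - \<eta>))\<^sup>2) * (\<integral>\<^sup>+q. ennreal ((norm (G (curve p q)))\<^sup>2) * ennreal q * indicator {1 / j..2 * \<delta> / slope p} q \<partial>lborel) +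
    ennreal (2 / ((1 - \<eta>)\<^sup>2 * \<delta>\<^sup>2)) * (\<integral>\<^sup>+q. ennreal ((v (curve p q))\<^sup>2) * ennreal q * indicator {1 / j..2 * \<delta> / slope p} q \<partial>lborel)"
    (is "?L \<le> _ * ?Y + _ * ?Z")
proof (cases "1 / j \<le> \<delta> / slope p")
  case False
  then have "{1 / j..\<delta> / slope p} = {}" by simp
  then show ?thesis by simp
next
  case True
  let ?k = "slope p"
  note k = slope_pos[of p]
  define f where "f q = v (curve p q)" for q
  define f' where "f' q = G (curve p q) \<bullet> velocity p q" for q
  let ?Q = "\<delta> / ?k"
  let ?b = "a / (1 + \<eta>) / ?k"
  let ?A = "1 / ((1 - \<eta>)\<^sup>2 * ?k\<^sup>2)"
  have A: "?A \<ge> 0" by simp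
  have fc: "continuous_on UNIV f" unfolding f_def by (rule continuous_on_compose2[OF v curve_continuous]) auto
  have f'c: "continuous_on UNIV f'" unfolding f'_def
    by (intro continuous_intros velocity_continuous continuous_on_compose2[OF G curve_continuous]) auto
  have [measurable]: "f \<in> borel_measurable borel" "f' \<in> borel_measurable borel"
    using fc f'c by (auto intro: borel_measurable_continuous_onI)
  have [measurable]: "(\<lambda>q. norm (G (curve p q))) \<in> borel_measurable borel"
    by (intro borel_measurable_continuous_onI continuous_intros continuous_on_compose2[OF G curve_continuous]) auto
  have kq: "q > 0 \<and> ?k * q \<le> \<rho>" if "q \<in> {1 / j..\<rho> / ?k}" for q \<rho>
  proof -
    have "0 < 1 / j" using j by simp
    moreover have "1 / j \<le> q" using that by simp
    ultimately have "0 < q" by linarith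
    then show ?thesis using that k by (simp add: pos_le_divide_eq mult.commute)
  qed
  have "?L \<le> (\<integral>\<^sup>+q. ennreal ?A * (ennreal ((f q)\<^sup>2 / (q * (ln (?b / q))\<^sup>2)) * indicator {1 / j..?Q} q) \<partial>lborel)"
  proof (rule nn_integral_mono)
    fix q
    show "ennreal ((v (curve p q))\<^sup>2 * hardy_weight a (curve p q)) * ennreal q * indicator {1 / j..\<delta> / slope p} q \<le>
      ennreal ?A * (ennreal ((f q)\<^sup>2 / (q * (ln (?b / q))\<^sup>2)) * indicator {1 / j..?Q} q)"
    proof (cases "q \<in> {1 / j..?Q}")
      case True
      then have q: "q > 0" "?k * q \<le> \<delta>" using kq by blast+
      have "(f q)\<^sup>2 * (hardy_weight a (curve p q) * q) \<le> (f q)\<^sup>2 * (?A * (1 / (q * (ln (?b / q))\<^sup>2)))"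
        by (intro mult_left_mono curve_weight_le q) auto
      then have "ennreal ((f q)\<^sup>2 * hardy_weight a (curve p q) * q) \<le> ennreal (?A * ((f q)\<^sup>2 / (q * (ln (?b / q))\<^sup>2)))"
        by (intro ennreal_leI) (simp add: mult_ac)
      also have "\<dots> = ennreal ?A * ennreal ((f q)\<^sup>2 / (q * (ln (?b / q))\<^sup>2))"
        using q by (intro ennreal_mult A) auto
      finally show ?thesis using True q hardy_weight_nonneg[of a "curve p q"]
        by (simp add: f_def ennreal_mult)
    qed simp
  qed
  also have "\<dots> = ennreal ?A * (\<integral>\<^sup>+q. ennreal ((f q)\<^sup>2 / (q * (ln (?b / q))\<^sup>2)) * indicator {1 / j..?Q} q \<partial>lborel)"
    by (rule nn_integral_cmult) measurable
  also have "\<dots> \<le> ennreal ?A * (4 * (\<integral>\<^sup>+q. ennreal ((f' q)\<^sup>2 * q) * indicator {1 / j..2 * ?Q} q \<partial>lborel) +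
    ennreal (2 / ?Q\<^sup>2) * (\<integral>\<^sup>+q. ennreal ((f q)\<^sup>2 * q) * indicator {1 / j..2 * ?Q} q \<partial>lborel))"
  proof (intro mult_left_mono hardy_1d_average fc f'c)
    fix q assume "1 / j \<le> q" "q \<le> 2 * ?Q"
    then have "q \<in> {1 / j..2 * \<delta> / ?k}" by simp
    from kq[OF this] have q: "q > 0" "?k * q \<le> 2 * \<delta>" by auto
    have "curve p q \<in> sector j (2 * \<delta>)"
      using sector_curve[OF q(1) j, of p "2 * \<delta>"] q \<open>1 / j \<le> q\<close> p by simp
    from curve_has_derivative[OF d[OF this]]
    show "(f has_real_derivative f' q) (at q)" unfolding f_def f'_def .
  next
    show "2 * (\<delta> / ?k) * exp 1 \<le> ?b" using divide_right_mono[OF small, of ?k] k by simp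
  qed (use j True in auto)
  also have "\<dots> \<le> ennreal ?A * (4 * (ennreal (((1 + \<eta>) * ?k)\<^sup>2) * ?Y) + ennreal (2 / ?Q\<^sup>2) * ?Z)"
  proof (intro mult_left_mono add_mono)
    have "(\<integral>\<^sup>+q. ennreal ((f' q)\<^sup>2 * q) * indicator {1 / j..2 * ?Q} q \<partial>lborel) \<le>
      (\<integral>\<^sup>+q. ennreal (((1 + \<eta>) * ?k)\<^sup>2) * (ennreal ((norm (G (curve p q)))\<^sup>2) * ennreal q * indicator {1 / j..2 * \<delta> / ?k} q) \<partial>lborel)"
    proof (rule nn_integral_mono)
      fix q
      show "ennreal ((f' q)\<^sup>2 * q) * indicator {1 / j..2 * ?Q} q \<le>
        ennreal (((1 + \<eta>) * ?k)\<^sup>2) * (ennreal ((norm (G (curve p q)))\<^sup>2) * ennreal q * indicator {1 / j..2 * \<delta> / ?k} q)"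
      proof (cases "q \<in> {1 / j..2 * \<delta> / ?k}")
        case True
        from kq[OF this] have q: "q > 0" "?k * q \<le> 2 * \<delta>" by auto
        have "\<bar>f' q\<bar> \<le> norm (G (curve p q)) * norm (velocity p q)"
          unfolding f'_def by (rule Cauchy_Schwarz_ineq2)
        also have "\<dots> \<le> norm (G (curve p q)) * ((1 + \<eta>) * ?k)"
          by (intro mult_left_mono curve_bounds(3)[OF q]) auto
        finally have "(f' q)\<^sup>2 \<le> (norm (G (curve p q)) * ((1 + \<eta>) * ?k))\<^sup>2"
          by (metis abs_ge_zero power2_abs power_mono)
        then have "(f' q)\<^sup>2 * q \<le> ((1 + \<eta>) * ?k)\<^sup>2 * ((norm (G (curve p q)))\<^sup>2 * q)"
          using mult_right_mono[of "(f' q)\<^sup>2" _ q] q by (simp add: power_mult_distrib mult_ac)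
        then have "ennreal ((f' q)\<^sup>2 * q) \<le> ennreal (((1 + \<eta>) * ?k)\<^sup>2 * ((norm (G (curve p q)))\<^sup>2 * q))" by (rule ennreal_leI)
        also have "\<dots> = ennreal (((1 + \<eta>) * ?k)\<^sup>2) * (ennreal ((norm (G (curve p q)))\<^sup>2) * ennreal q)"
          using q by (simp only: ennreal_mult[symmetric] zero_le_power2 mult_nonneg_nonneg less_imp_le)
        finally show ?thesis using True by simp
      qed simp
    qed
    also have "\<dots> = ennreal (((1 + \<eta>) * ?k)\<^sup>2) * ?Y" by (rule nn_integral_cmult) measurable
    finally show "(\<integral>\<^sup>+q. ennreal ((f' q)\<^sup>2 * q) * indicator {1 / j..2 * ?Q} q \<partial>lborel) \<le> ennreal (((1 + \<eta>) * ?k)\<^sup>2) * ?Y" .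
    show "(\<integral>\<^sup>+q. ennreal ((f q)\<^sup>2 * q) * indicator {1 / j..2 * ?Q} q \<partial>lborel) \<le> ?Z"
    proof (rule nn_integral_mono)
      fix q
      show "ennreal ((f q)\<^sup>2 * q) * indicator {1 / j..2 * ?Q} q \<le>
        ennreal ((v (curve p q))\<^sup>2) * ennreal q * indicator {1 / j..2 * \<delta> / ?k} q"
        using kq[of q "2 * \<delta>"] by (cases "q \<in> {1 / j..2 * \<delta> / ?k}") (auto simp: f_def ennreal_mult)
    qed
  qed auto
  also have "\<dots> = ennreal (4 * ((1 + \<eta>) / (1 - \<eta>))\<^sup>2) * ?Y + ennreal (2 / ((1 - \<eta>)\<^sup>2 * \<delta>\<^sup>2)) * ?Z"
  proof -
    have e1: "?A * (4 * ((1 + \<eta>) * ?k)\<^sup>2) = 4 * ((1 + \<eta>) / (1 - \<eta>))\<^sup>2"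
      using k by (simp add: power_mult_distrib power_divide)
    have e2: "?A * (2 / ?Q\<^sup>2) = 2 / ((1 - \<eta>)\<^sup>2 * \<delta>\<^sup>2)"
      using k by (simp add: power_divide)
    have gen: "ennreal A * (4 * (ennreal B * Y) + ennreal C * Z) = ennreal (A * (4 * B)) * Y + ennreal (A * C) * Z"
      if "0 \<le> A" "0 \<le> B" "0 \<le> C" for A B C Y Z
      using that by (simp add: ennreal_mult distrib_left mult_ac)
    have "0 \<le> 2 / ?Q\<^sup>2" by simp
    from gen[OF A zero_le_power2[of "(1 + \<eta>) * ?k"] this, of ?Y ?Z] show ?thesis
      unfolding e1 e2 .
  qed
  finally show ?thesis .
qed


lemma curve_measurable [measurable]: "(\<lambda>z. curve (fst z) (snd z)) \<in> borel_measurable borel"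
  unfolding curve_def
  by (intro borel_measurable_continuous_onI continuous_on_compose2[OF orthogonal_continuous[OF inv_T, of UNIV]]
      continuous_intros continuous_on_compose2[OF \<gamma>_continuous]) auto

lemma curve_measurable_pair [measurable]: "(\<lambda>(p, q). curve p q) \<in> borel_measurable (borel \<Otimes>\<^sub>M borel)"
  using curve_measurable by (simp add: borel_prod split_beta')

lemma sector_measurable [measurable]: "0 < j \<Longrightarrow> \<rho> \<le> 2 * \<delta> \<Longrightarrow> sector j \<rho> \<in> sets borel"
  using sector_compact by (simp add: compact_imp_closed)

text \<open>Integration over \<open>p\<close> of the inequality on single curves, whose constants
  are free of \<open>p\<close>.\<close>

lemma hardy_sector:
  fixes v :: "real^2 \<Rightarrow> real" and G :: "real^2 \<Rightarrow> real^2"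
  assumes d: "\<And>x. x \<in> sector j (2 * \<delta>) \<Longrightarrow> (v has_derivative (\<lambda>h. G x \<bullet> h)) (at x)"
    and v: "continuous_on UNIV v" and G: "continuous_on UNIV G" and j: "j > 0"
  shows "(\<integral>\<^sup>+x. ennreal ((v x)\<^sup>2 * hardy_weight a x) * indicator (sector j \<delta>) x \<partial>lborel) \<le>
    ennreal (4 * ((1 + \<eta>) / (1 - \<eta>))\<^sup>2) * (\<integral>\<^sup>+x. ennreal ((norm (G x))\<^sup>2) * indicator (sector j (2 * \<delta>)) x \<partial>lborel) +
    ennreal (2 / ((1 - \<eta>)\<^sup>2 * \<delta>\<^sup>2)) * (\<integral>\<^sup>+x. ennreal ((v x)\<^sup>2) * indicator (sector j (2 * \<delta>)) x \<partial>lborel)"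
proof -
  have [measurable]: "v \<in> borel_measurable borel" "G \<in> borel_measurable borel"
    using v G by (auto intro: borel_measurable_continuous_onI)
  have d1: "\<delta> \<le> 2 * \<delta>" using \<delta> by simp
  have [measurable]: "slope \<in> borel_measurable borel"
    unfolding slope_def[abs_def] by (intro borel_measurable_continuous_onI continuous_intros)
  let ?I = "\<lambda>\<rho> p q. indicator {1 / j..\<rho> / slope p} q :: ennreal"
  let ?J = "\<lambda>p. indicator {-j..j} p :: ennreal"
  define Y where "Y p = (\<integral>\<^sup>+q. ennreal ((norm (G (curve p q)))\<^sup>2) * ennreal q * ?I (2 * \<delta>) p q * ?J p \<partial>lborel)" for p
  define Z where "Z p = (\<integral>\<^sup>+q. ennreal ((v (curve p q))\<^sup>2) * ennreal q * ?I (2 * \<delta>) p q * ?J p \<partial>lborel)" for p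
  \<comment> \<open>The indicators are rewritten over the pair \<open>(p, q)\<close>, which makes
    their joint measurability visible.\<close>
  have I: "?I \<rho> p q = indicator {z. 1 / j \<le> snd z \<and> snd z \<le> \<rho> / slope (fst z)} (p, q)" for \<rho> p q
    by (auto simp: indicator_def)
  have "{z \<in> space (borel \<Otimes>\<^sub>M borel). 1 / j \<le> snd z \<and> snd z \<le> \<rho> / slope (fst z)} \<in> sets (borel \<Otimes>\<^sub>M borel)" for \<rho>
    by measurable
  then have Im [measurable]: "{z. 1 / j \<le> snd z \<and> snd z \<le> \<rho> / slope (fst z)} \<in> sets (borel \<Otimes>\<^sub>M borel)" for \<rho>
    by (simp add: space_pair_measure)
  have [measurable]: "Y \<in> borel_measurable borel" "Z \<in> borel_measurable borel"
    unfolding Y_def[abs_def] Z_def[abs_def] I by measurable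
  let ?c1 = "ennreal (4 * ((1 + \<eta>) / (1 - \<eta>))\<^sup>2)" and ?c2 = "ennreal (2 / ((1 - \<eta>)\<^sup>2 * \<delta>\<^sup>2))"
  have "(\<integral>\<^sup>+x. ennreal ((v x)\<^sup>2 * hardy_weight a x) * indicator (sector j \<delta>) x \<partial>lborel) =
    (\<integral>\<^sup>+p. \<integral>\<^sup>+q. ennreal ((v (curve p q))\<^sup>2 * hardy_weight a (curve p q)) * ennreal q * ?I \<delta> p q * ?J p \<partial>lborel \<partial>lborel)"
    by (rule nn_integral_sector[OF _ j d1]) measurable
  also have "\<dots> \<le> (\<integral>\<^sup>+p. ?c1 * Y p + ?c2 * Z p \<partial>lborel)"
  proof (rule nn_integral_mono)
    fix p
    show "(\<integral>\<^sup>+q. ennreal ((v (curve p q))\<^sup>2 * hardy_weight a (curve p q)) * ennreal q * ?I \<delta> p q * ?J p \<partial>lborel) \<le> ?c1 * Y p + ?c2 * Z p"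
    proof (cases "\<bar>p\<bar> \<le> j")
      case True
      then have "p \<in> {-j..j}" by (simp add: abs_le_iff)
      then have J: "?J p = 1" by simp
      show ?thesis using hardy_curve[OF d v G j True] unfolding Y_def Z_def J mult_1_right .
    next
      case False
      then have "p \<notin> {-j..j}" by auto
      then have "?J p = 0" by simp
      then show ?thesis by simp
    qed
  qed
  also have "\<dots> = ?c1 * (\<integral>\<^sup>+p. Y p \<partial>lborel) + ?c2 * (\<integral>\<^sup>+p. Z p \<partial>lborel)"
    by (simp add: nn_integral_add nn_integral_cmult)
  also have "(\<integral>\<^sup>+p. Y p \<partial>lborel) = (\<integral>\<^sup>+x. ennreal ((norm (G x))\<^sup>2) * indicator (sector j (2 * \<delta>)) x \<partial>lborel)"
    unfolding Y_def by (rule nn_integral_sector[OF _ j order_refl, symmetric]) measurable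
  also have "(\<integral>\<^sup>+p. Z p \<partial>lborel) = (\<integral>\<^sup>+x. ennreal ((v x)\<^sup>2) * indicator (sector j (2 * \<delta>)) x \<partial>lborel)"
    unfolding Z_def by (rule nn_integral_sector[OF _ j order_refl, symmetric]) measurable
  finally show ?thesis .
qed

lemma sector_mono: "0 < j \<Longrightarrow> j \<le> k \<Longrightarrow> sector j \<rho> \<subseteq> sector k \<rho>"
proof
  fix x assume j: "0 < j" "j \<le> k" and x: "x \<in> sector j \<rho>"
  have "j * height x \<le> k * height x"
    using j sector_height[OF j(1) x] by (intro mult_right_mono) auto
  then show "x \<in> sector k \<rho>" using x by (auto simp: sector_def)
qed

text \<open>Straightening at most doubles the norm, because the vertical correction is at most
  \<open>\<eta> * \<bar>T x $ 1\<bar> \<le> norm x\<close>; this is the origin of the radius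
  \<open>\<delta> / 2\<close>.\<close>

lemma sector_exhaust:
  assumes x: "height x > 0" "norm x < \<delta> / 2"
  shows "\<exists>i. x \<in> sector (real (Suc i)) \<delta>"
proof -
  let ?t = "T x $ 1"
  have t: "\<bar>?t\<bar> \<le> norm x"
    using component_le_norm_cart[of "T x" 1] orthogonal_transformation_norm[OF T, of x] by simp
  have "straight x = T x + vec2 0 (- (\<gamma> ?t - \<gamma>' 0 * ?t))"
    unfolding straight_def height_def by (simp add: vec_eq_iff forall_2)
  then have "norm (straight x) \<le> norm x + \<bar>\<gamma> ?t - \<gamma>' 0 * ?t\<bar>"
    using norm_triangle_ineq[of "T x" "vec2 0 (- (\<gamma> ?t - \<gamma>' 0 * ?t))"]
    by (simp add: norm_vec2 orthogonal_transformation_norm[OF T])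
  also have "\<bar>\<gamma> ?t - \<gamma>' 0 * ?t\<bar> \<le> \<eta> * \<bar>?t\<bar>" using t x \<delta> by (intro \<gamma>_near) linarith
  also have "\<dots> \<le> 1 * norm x" using t \<eta> by (intro mult_mono) auto
  finally have s: "norm (straight x) \<le> \<delta>" using x by simp
  obtain i :: nat where i: "max (1 / height x) (\<bar>?t\<bar> / height x) < real i" using reals_Archimedean2 by blast
  then have "1 \<le> real (Suc i) * height x" "\<bar>?t\<bar> \<le> real (Suc i) * height x"
    using x(1) by (auto simp: field_simps)
  then show ?thesis using s by (auto simp: sector_def)
qed

text \<open>The bound \<open>B\<close> is the same for all sectors, so monotone convergence reaches
  all points above the graph near the origin.\<close>

lemma nn_integral_sector_limit:
  assumes [measurable]: "F \<in> borel_measurable borel"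
    and B: "\<And>i. (\<integral>\<^sup>+x. F x * indicator (sector (real (Suc i)) \<delta>) x \<partial>lborel) \<le> B"
  shows "(\<integral>\<^sup>+x. F x * indicator ({x. height x > 0} \<inter> ball 0 (\<delta> / 2)) x \<partial>lborel) \<le> (B::ennreal)"
proof -
  let ?S = "\<lambda>i. sector (real (Suc i)) \<delta>"
  have [measurable]: "?S i \<in> sets borel" for i using \<delta> by (intro sector_measurable) auto
  have "(\<integral>\<^sup>+x. F x * indicator ({x. height x > 0} \<inter> ball 0 (\<delta> / 2)) x \<partial>lborel) \<le>
    (\<integral>\<^sup>+x. (SUP i. F x * indicator (?S i) x) \<partial>lborel)"
  proof (rule nn_integral_mono)
    fix x
    show "F x * indicator ({x. height x > 0} \<inter> ball 0 (\<delta> / 2)) x \<le> (SUP i. F x * indicator (?S i) x)"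
    proof (cases "height x > 0 \<and> norm x < \<delta> / 2")
      case True
      then obtain i where "x \<in> ?S i" using sector_exhaust by blast
      then show ?thesis by (intro SUP_upper2[of i]) (auto simp: indicator_def)
    qed (auto simp: indicator_def)
  qed
  also have "\<dots> = (SUP i. \<integral>\<^sup>+x. F x * indicator (?S i) x \<partial>lborel)"
  proof (rule nn_integral_monotone_convergence_SUP)
    have "?S i \<subseteq> ?S k" if "i \<le> k" for i k using that by (intro sector_mono) auto
    then show "incseq (\<lambda>i x. F x * indicator (?S i) x)"
      by (auto simp: incseq_def le_fun_def indicator_def)
  qed measurable
  also have "\<dots> \<le> B" by (intro SUP_least B)
  finally show ?thesis .
qed

text \<open>The Hardy inequality for the constant function 1: the gradient term vanishes and the
  square integral is an area, so the weight itself is integrable.\<close>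

lemma weight_integrable_near:
  "(\<integral>\<^sup>+x. ennreal (hardy_weight a x) * indicator ({x. height x > 0} \<inter> ball 0 (\<delta> / 2)) x \<partial>lborel) < \<infinity>"
proof -
  let ?B = "ball (0::real^2) (3 * \<delta> + 1)"
  let ?c = "ennreal (2 / ((1 - \<eta>)\<^sup>2 * \<delta>\<^sup>2))"
  have "(\<integral>\<^sup>+x. ennreal (hardy_weight a x) * indicator ({x. height x > 0} \<inter> ball 0 (\<delta> / 2)) x \<partial>lborel) \<le> ?c * emeasure lborel ?B"
  proof (rule nn_integral_sector_limit)
    fix i
    let ?j = "real (Suc i)"
    have "(\<integral>\<^sup>+x. ennreal (hardy_weight a x) * indicator (sector ?j \<delta>) x \<partial>lborel) \<le>
      ?c * (\<integral>\<^sup>+x. indicator (sector ?j (2 * \<delta>)) x \<partial>lborel)"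
      using hardy_sector[of ?j "\<lambda>_. 1" "\<lambda>_. 0"] by simp
    also have "\<dots> \<le> ?c * (\<integral>\<^sup>+x. indicator ?B x \<partial>lborel)"
    proof (intro mult_left_mono nn_integral_mono)
      fix x
      have "norm x < 3 * \<delta> + 1" if "x \<in> sector ?j (2 * \<delta>)"
      proof -
        have "norm x \<le> (1 + \<eta>) * (2 * \<delta>)" using sector_norm[OF _ that] by simp
        also have "\<dots> \<le> (3/2) * (2 * \<delta>)" using \<eta> \<delta> by (intro mult_right_mono) auto
        finally show ?thesis by simp
      qed
      then show "(indicator (sector ?j (2 * \<delta>)) x :: ennreal) \<le> indicator ?B x"
        by (auto simp: indicator_def)
    qed auto
    finally show "(\<integral>\<^sup>+x. ennreal (hardy_weight a x) * indicator (sector ?j \<delta>) x \<partial>lborel) \<le> ?c * emeasure lborel ?B"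
      by simp
  qed measurable
  also have "\<dots> < \<infinity>"
    using emeasure_lborel_ball_finite[of "0::real^2" "3 * \<delta> + 1"] by (simp add: ennreal_mult_less_top)
  finally show ?thesis .
qed

text \<open>By the condition on \<open>r\<close> the sector of radius \<open>2 * \<delta>\<close> is
  a compact subset of the chart domain, so the inequality holds there for mollifications of small
  radius. Their square integrals and energies are at most those of \<open>u\<close> and
  \<open>g\<close>; Fatou's lemma and the exhaustion by sectors conclude.\<close>

lemma hardy_sob:
  assumes r: "(1 + \<eta>) * (2 * \<delta>) < r"
    and s: "sob {x \<in> ball 0 r. T x $ 2 > \<gamma> (T x $ 1)} u g"
  shows "(\<integral>\<^sup>+x. ennreal ((u x)\<^sup>2 * hardy_weight a x) * indicator (ball 0 (\<delta> / 2)) x \<partial>lborel) \<le>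
    ennreal (4 * ((1 + \<eta>) / (1 - \<eta>))\<^sup>2 * (LINT x|lborel. (norm (g x))\<^sup>2) +
      2 / ((1 - \<eta>)\<^sup>2 * \<delta>\<^sup>2) * (LINT x|lborel. (u x)\<^sup>2))"
proof -
  let ?D = "{x \<in> ball 0 r. T x $ 2 > \<gamma> (T x $ 1)}"
  have D: "?D = ball 0 r \<inter> {x. height x > 0}" by (auto simp: height_def)
  have b: "bounded ?D" by (rule bounded_subset[OF bounded_ball, of _ 0 r]) auto
  have o: "open ?D" unfolding D
    by (intro open_Int open_ball open_Collect_less continuous_intros height_continuous)
  obtain \<rho> :: "nat \<Rightarrow> real" where \<rho>: "\<And>n. \<rho> n > 0" "\<rho> \<longlonglongrightarrow> 0"
    and ae: "AE x in lborel. (\<lambda>n. moll (\<rho> n) u x) \<longlonglongrightarrow> u x"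
    using moll_AE_sequence[OF sob_integrable(1)[OF s b]] by blast
  note iu = sob_integrable(1)[OF s b] and ig = sob_integrable(2)[OF s b]
  note [measurable] = sobD(1,2)[OF s] moll_measurable[OF \<rho>(1) iu] moll_measurable[OF \<rho>(1) ig]
  define c1 where "c1 = 4 * ((1 + \<eta>) / (1 - \<eta>))\<^sup>2"
  define c2 where "c2 = 2 / ((1 - \<eta>)\<^sup>2 * \<delta>\<^sup>2)"
  have c: "c1 \<ge> 0" "c2 \<ge> 0" by (auto simp: c1_def c2_def)
  define B where "B = ennreal (c1 * (LINT x|lborel. (norm (g x))\<^sup>2) + c2 * (LINT x|lborel. (u x)\<^sup>2))"
  have "(\<integral>\<^sup>+x. ennreal ((u x)\<^sup>2 * hardy_weight a x) * indicator ({x. height x > 0} \<inter> ball 0 (\<delta> / 2)) x \<partial>lborel) \<le> B"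
  proof (rule nn_integral_sector_limit)
    fix i
    let ?j = "real (Suc i)"
    let ?S = "sector ?j \<delta>" and ?S2 = "sector ?j (2 * \<delta>)"
    have [measurable]: "?S \<in> sets borel" "?S2 \<in> sets borel" using \<delta> by auto
    have K: "compact ?S2" by (rule sector_compact) auto
    have KD: "?S2 \<subseteq> ?D"
      unfolding D using sector_norm[of ?j _ "2 * \<delta>"] sector_height[of ?j _ "2 * \<delta>"] r by fastforce
    have ev: "eventually (\<lambda>n. \<forall>x\<in>?S2. cball x (\<rho> n) \<subseteq> ?D) sequentially"
      by (rule eventually_cball_subset[OF K o KD \<rho>(2)])
    have bound: "(\<integral>\<^sup>+x. ennreal ((moll (\<rho> n) u x)\<^sup>2 * hardy_weight a x) * indicator ?S x \<partial>lborel) \<le> B"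
      if n: "\<forall>x\<in>?S2. cball x (\<rho> n) \<subseteq> ?D" for n
    proof -
      have "(\<integral>\<^sup>+x. ennreal ((moll (\<rho> n) u x)\<^sup>2 * hardy_weight a x) * indicator ?S x \<partial>lborel) \<le>
        ennreal c1 * (\<integral>\<^sup>+x. ennreal ((norm (moll (\<rho> n) g x))\<^sup>2) * indicator ?S2 x \<partial>lborel) +
        ennreal c2 * (\<integral>\<^sup>+x. ennreal ((moll (\<rho> n) u x)\<^sup>2) * indicator ?S2 x \<partial>lborel)"
        unfolding c1_def c2_def
        by (intro hardy_sector sob_moll_has_derivative[OF s b \<rho>(1)] moll_continuous \<rho> iu ig) (use n in auto)
      also have "\<dots> \<le> ennreal c1 * (\<integral>\<^sup>+x. ennreal ((norm (moll (\<rho> n) g x))\<^sup>2) \<partial>lborel) +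
        ennreal c2 * (\<integral>\<^sup>+x. ennreal ((moll (\<rho> n) u x)\<^sup>2) \<partial>lborel)"
        by (intro add_mono mult_left_mono nn_integral_mono) (auto simp: indicator_def)
      also have "\<dots> \<le> ennreal c1 * ennreal (LINT x|lborel. (norm (g x))\<^sup>2) + ennreal c2 * ennreal (LINT x|lborel. (u x)\<^sup>2)"
        by (intro add_mono mult_left_mono sob_moll_L2[OF s b \<rho>(1)]) auto
      also have "\<dots> = B"
        unfolding B_def using c by (simp add: ennreal_mult ennreal_plus)
      finally show ?thesis .
    qed
    have "(\<integral>\<^sup>+x. ennreal ((u x)\<^sup>2 * hardy_weight a x) * indicator ?S x \<partial>lborel) \<le>
      (\<integral>\<^sup>+x. liminf (\<lambda>n. ennreal ((moll (\<rho> n) u x)\<^sup>2 * hardy_weight a x) * indicator ?S x) \<partial>lborel)"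
    proof (rule nn_integral_mono_AE)
      show "AE x in lborel. ennreal ((u x)\<^sup>2 * hardy_weight a x) * indicator ?S x \<le>
        liminf (\<lambda>n. ennreal ((moll (\<rho> n) u x)\<^sup>2 * hardy_weight a x) * indicator ?S x)"
        using ae
      proof eventually_elim
        case (elim x)
        have "(\<lambda>n. ennreal ((moll (\<rho> n) u x)\<^sup>2 * hardy_weight a x) * indicator ?S x) \<longlonglongrightarrow>
          ennreal ((u x)\<^sup>2 * hardy_weight a x) * indicator ?S x"
          by (cases "x \<in> ?S") (auto intro!: tendsto_intros elim)
        from lim_imp_Liminf[OF _ this] show ?case by simp
      qed
    qed
    also have "\<dots> \<le> liminf (\<lambda>n. \<integral>\<^sup>+x. ennreal ((moll (\<rho> n) u x)\<^sup>2 * hardy_weight a x) * indicator ?S x \<partial>lborel)"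
      by (rule nn_integral_liminf) measurable
    also have "\<dots> \<le> liminf (\<lambda>n. B)"
      by (rule Liminf_mono) (use ev bound in \<open>auto elim: eventually_mono\<close>)
    also have "\<dots> = B" by (simp add: Liminf_const)
    finally show "(\<integral>\<^sup>+x. ennreal ((u x)\<^sup>2 * hardy_weight a x) * indicator ?S x \<partial>lborel) \<le> B" .
  qed measurable
  moreover have "(\<integral>\<^sup>+x. ennreal ((u x)\<^sup>2 * hardy_weight a x) * indicator (ball 0 (\<delta> / 2)) x \<partial>lborel) =
    (\<integral>\<^sup>+x. ennreal ((u x)\<^sup>2 * hardy_weight a x) * indicator ({x. height x > 0} \<inter> ball 0 (\<delta> / 2)) x \<partial>lborel)"
  proof (rule nn_integral_cong)
    fix x
    show "ennreal ((u x)\<^sup>2 * hardy_weight a x) * indicator (ball 0 (\<delta> / 2)) x =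
      ennreal ((u x)\<^sup>2 * hardy_weight a x) * indicator ({x. height x > 0} \<inter> ball 0 (\<delta> / 2)) x"
    proof (cases "height x > 0")
      case False
      then have "u x = 0" by (intro sobD(3)[OF s]) (auto simp: height_def)
      then show ?thesis by simp
    qed (auto simp: indicator_def)
  qed
  ultimately show ?thesis by (simp add: B_def c1_def c2_def)
qed

end

section \<open>From the chart to the whole domain\<close>

lemma smooth_fun_real_deriv:
  fixes \<gamma> :: "real \<Rightarrow> real"
  assumes "smooth_fun \<gamma>"
  obtains \<gamma>' where "\<And>t. (\<gamma> has_real_derivative \<gamma>' t) (at t)" "continuous_on UNIV \<gamma>'"
proof
  have d: "\<gamma> differentiable (at t)" and d': "dir_deriv 1 \<gamma> differentiable (at t)" for t
    using assms[unfolded smooth_fun_def, rule_format, of "[]" t]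
      assms[unfolded smooth_fun_def, rule_format, of "[1]" t] by auto
  show "(\<gamma> has_real_derivative dir_deriv 1 \<gamma> t) (at t)" for t
  proof -
    have F: "(\<gamma> has_derivative frechet_derivative \<gamma> (at t)) (at t)"
      using d frechet_derivative_works by blast
    then have "linear (frechet_derivative \<gamma> (at t))" by (rule has_derivative_linear)
    then have "frechet_derivative \<gamma> (at t) h = dir_deriv 1 \<gamma> t * h" for h
      using linear_scale[of "frechet_derivative \<gamma> (at t)" h 1] by (simp add: dir_deriv_def mult.commute)
    then have "frechet_derivative \<gamma> (at t) = (*) (dir_deriv 1 \<gamma> t)" by auto
    then show ?thesis using F by (simp add: has_field_derivative_def)
  qed
  show "continuous_on UNIV (dir_deriv 1 \<gamma>)"
    using d' by (auto intro!: continuous_at_imp_continuous_on differentiable_imp_continuous_within)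
qed

lemma hardy_chart:
  fixes T :: "real^2 \<Rightarrow> real^2" and \<gamma> :: "real \<Rightarrow> real"
  assumes T: "orthogonal_transformation T" and \<gamma>: "smooth_fun \<gamma>" and \<gamma>0: "\<gamma> 0 = 0"
    and r: "r > 0" and a: "a > 1" and \<epsilon>: "\<epsilon> > 0"
  obtains \<delta> C where "\<delta> > 0" "C \<ge> 0"
    "\<And>u g. sob {x \<in> ball 0 r. T x $ 2 > \<gamma> (T x $ 1)} u g \<Longrightarrow>
      (\<integral>\<^sup>+x. ennreal ((u x)\<^sup>2 * hardy_weight a x) * indicator (ball 0 \<delta>) x \<partial>lborel) \<le>
      ennreal ((4 + \<epsilon>) * (LINT x|lborel. (norm (g x))\<^sup>2) + C * (LINT x|lborel. (u x)\<^sup>2))"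
    "(\<integral>\<^sup>+x. ennreal (hardy_weight a x) * indicator ({x. T x $ 2 > \<gamma> (T x $ 1)} \<inter> ball 0 \<delta>) x \<partial>lborel) < \<infinity>"
proof -
  obtain \<gamma>' where \<gamma>': "\<And>t. (\<gamma> has_real_derivative \<gamma>' t) (at t)" "continuous_on UNIV \<gamma>'"
    using smooth_fun_real_deriv[OF \<gamma>] by blast
  \<comment> \<open>The value \<open>\<epsilon> / 64\<close> comes from \<open>4 * ((1 + \<eta>) /
    (1 - \<eta>))\<^sup>2 \<le> 4 * (1 + 4 * \<eta>)\<^sup>2 \<le> 4 + 64 * \<eta>\<close>, both
    steps using \<open>\<eta> \<le> 1/2\<close>.\<close>
  define \<eta> where "\<eta> = min (1/2) (\<epsilon> / 64)"
  have h\<eta>: "0 < \<eta>" "\<eta> \<le> 1/2" "64 * \<eta> \<le> \<epsilon>" using \<epsilon> by (auto simp: \<eta>_def)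
  have "isCont \<gamma>' 0" using \<gamma>'(2) by (simp add: continuous_on_eq_continuous_at)
  then obtain d where d: "d > 0" "\<And>t. \<bar>t\<bar> < d \<Longrightarrow> \<bar>\<gamma>' t - \<gamma>' 0\<bar> < \<eta>"
    using h\<eta>(1) unfolding continuous_at_eps_delta by (auto simp: dist_real_def)
  \<comment> \<open>Three requirements meet here: \<open>d\<close> controls the variation of the
    slope, \<open>r\<close> makes the sectors fit into the chart, and the last entry bounds the
    logarithm from below.\<close>
  define \<delta> where "\<delta> = min (d / 4) (min (r / 4) (a / (1 + \<eta>) / (2 * exp 1)))"
  have "\<delta> \<le> d / 4" unfolding \<delta>_def by (rule min.cobounded1)
  moreover have "\<delta> \<le> r / 4" unfolding \<delta>_def by (intro min.coboundedI2 min.cobounded1)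
  moreover have "\<delta> > 0" using d r a h\<eta> by (auto simp: \<delta>_def)
  ultimately have h\<delta>: "\<delta> > 0" "2 * \<delta> < d" "\<delta> \<le> r / 4" using d(1) by auto
  have small: "2 * \<delta> * exp 1 \<le> a / (1 + \<eta>)"
  proof -
    have "\<delta> \<le> a / (1 + \<eta>) / (2 * exp 1)" unfolding \<delta>_def by (intro min.coboundedI2 min.cobounded2)
    then show ?thesis by (subst (asm) pos_le_divide_eq) (auto simp: mult_ac)
  qed
  interpret boundary_chart T \<gamma> \<gamma>' a \<eta> \<delta>
  proof
    show "\<bar>\<gamma>' t - \<gamma>' 0\<bar> \<le> \<eta>" if "\<bar>t\<bar> \<le> 2 * \<delta>" for t using d(2)[of t] that h\<delta> by simp
  qed (use T \<gamma>' \<gamma>0 a h\<eta> h\<delta> small in auto)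
  have rr: "(1 + \<eta>) * (2 * \<delta>) < r"
  proof -
    have "(1 + \<eta>) * (2 * \<delta>) \<le> (3/2) * (r / 2)" using h\<eta> h\<delta> by (intro mult_mono) auto
    then show ?thesis using r by simp
  qed
  have const: "4 * ((1 + \<eta>) / (1 - \<eta>))\<^sup>2 \<le> 4 + \<epsilon>"
  proof -
    have "1 + \<eta> \<le> (1 + 4 * \<eta>) * (1 - \<eta>)"
      using mult_left_mono[OF h\<eta>(2), of "4 * \<eta>"] \<eta>(1) by (simp add: algebra_simps)
    then have "(1 + \<eta>) / (1 - \<eta>) \<le> 1 + 4 * \<eta>" using h\<eta> by (simp add: pos_divide_le_eq)
    then have "((1 + \<eta>) / (1 - \<eta>))\<^sup>2 \<le> (1 + 4 * \<eta>)\<^sup>2" using h\<eta> by (intro power_mono) auto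
    also have "\<dots> \<le> 1 + 16 * \<eta>"
      using mult_left_mono[OF h\<eta>(2), of "16 * \<eta>"] \<eta>(1) by (simp add: power2_eq_square algebra_simps)
    finally show ?thesis using h\<eta>(3) by simp
  qed
  show ?thesis
  proof (rule that[of "\<delta> / 2" "2 / ((1 - \<eta>)\<^sup>2 * \<delta>\<^sup>2)"])
    show "\<delta> / 2 > 0" using h\<delta> by simp
    show "0 \<le> 2 / ((1 - \<eta>)\<^sup>2 * \<delta>\<^sup>2)" by simp
    fix u g assume s: "sob {x \<in> ball 0 r. T x $ 2 > \<gamma> (T x $ 1)} u g"
    have "ennreal (4 * ((1 + \<eta>) / (1 - \<eta>))\<^sup>2 * (LINT x|lborel. (norm (g x))\<^sup>2) + 2 / ((1 - \<eta>)\<^sup>2 * \<delta>\<^sup>2) * (LINT x|lborel. (u x)\<^sup>2))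
      \<le> ennreal ((4 + \<epsilon>) * (LINT x|lborel. (norm (g x))\<^sup>2) + 2 / ((1 - \<eta>)\<^sup>2 * \<delta>\<^sup>2) * (LINT x|lborel. (u x)\<^sup>2))"
      by (intro ennreal_leI add_right_mono mult_right_mono const sob_integral_nonneg)
    with hardy_sob[OF rr s]
    show "(\<integral>\<^sup>+x. ennreal ((u x)\<^sup>2 * hardy_weight a x) * indicator (ball 0 (\<delta> / 2)) x \<partial>lborel) \<le>
      ennreal ((4 + \<epsilon>) * (LINT x|lborel. (norm (g x))\<^sup>2) + 2 / ((1 - \<eta>)\<^sup>2 * \<delta>\<^sup>2) * (LINT x|lborel. (u x)\<^sup>2))"
      by (rule order_trans)
  next
    have "{x. T x $ 2 > \<gamma> (T x $ 1)} = {x. height x > 0}" by (auto simp: height_def)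
    then show "(\<integral>\<^sup>+x. ennreal (hardy_weight a x) * indicator ({x. T x $ 2 > \<gamma> (T x $ 1)} \<inter> ball 0 (\<delta> / 2)) x \<partial>lborel) < \<infinity>"
      using weight_integrable_near by simp
  qed
qed

lemma smooth_fun_zero: "smooth_fun (\<lambda>x::real. 0)"
proof -
  have "bump_class 0 1 (\<lambda>x::real. 0)" by (rule bump_class.const)
  then show ?thesis by (rule bump_class_smooth)
qed

text \<open>An interior origin is treated as a common boundary point of two half planes.\<close>
lemma hardy_near_origin:
  fixes \<Omega> :: "(real^2) set"
  assumes dom: "smooth_bounded_domain \<Omega>" and 0: "0 \<in> closure \<Omega>" and a: "a > 1" and \<epsilon>: "\<epsilon> > 0"
  obtains \<delta> C where "\<delta> > 0" "C \<ge> 0"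
    "\<And>u g. sob \<Omega> u g \<Longrightarrow>
      (\<integral>\<^sup>+x. ennreal ((u x)\<^sup>2 * hardy_weight a x) * indicator (ball 0 \<delta>) x \<partial>lborel) \<le>
      ennreal ((4 + \<epsilon>) * (LINT x|lborel. (norm (g x))\<^sup>2) + C * (LINT x|lborel. (u x)\<^sup>2))"
    "(\<integral>\<^sup>+x. ennreal (hardy_weight a x) * indicator (\<Omega> \<inter> ball 0 \<delta>) x \<partial>lborel) < \<infinity>"
proof -
  have o: "open \<Omega>" and sb: "smooth_boundary \<Omega>" using dom by (auto simp: smooth_bounded_domain_def)
  show ?thesis
  proof (cases "0 \<in> \<Omega>")
    case False
    then have "0 \<in> frontier \<Omega>" using 0 o by (simp add: frontier_def interior_open)
    then obtain r and T :: "real^2 \<Rightarrow> real^2" and \<gamma> where r: "r > 0" and T: "orthogonal_transformation T"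
      and \<gamma>: "smooth_fun \<gamma>" and eq: "\<Omega> \<inter> ball 0 r = {x \<in> ball 0 r. T x $ 2 > \<gamma> (T x $ 1)}"
      using sb unfolding smooth_boundary_def by blast
    have T0: "T 0 = 0" by (rule linear_0[OF orthogonal_transformation_linear[OF T]])
    note Tc = orthogonal_continuous[OF T, of UNIV]
    have hc: "continuous_on UNIV (\<lambda>x. T x $ 2 - \<gamma> (T x $ 1))"
      by (intro continuous_intros Tc continuous_on_compose2[OF smooth_fun_continuous[OF \<gamma>], of _ "\<lambda>x. T x $ 1"]) auto
    \<comment> \<open>A boundary origin lies on the graph: a negative value of
      \<open>\<gamma>\<close> would put it inside the domain, a positive one would give it a
      neighbourhood disjoint from the domain.\<close>
    have "\<gamma> 0 = 0"
    proof (rule ccontr)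
      assume "\<gamma> 0 \<noteq> 0"
      then consider "\<gamma> 0 < 0" | "\<gamma> 0 > 0" by linarith
      then show False
      proof cases
        case 1
        then have "0 \<in> {x \<in> ball 0 r. T x $ 2 > \<gamma> (T x $ 1)}" using r T0 by simp
        then show False using False eq by blast
      next
        case 2
        let ?U = "ball 0 r \<inter> {x. T x $ 2 - \<gamma> (T x $ 1) < 0}"
        have "open ?U" by (intro open_Int open_ball open_Collect_less hc continuous_on_const)
        moreover have "0 \<in> ?U" using 2 r T0 by simp
        moreover have "?U \<inter> \<Omega> = {}"
        proof -
          have "x \<notin> \<Omega>" if "x \<in> ?U" for x
          proof
            assume "x \<in> \<Omega>"
            then have "x \<in> \<Omega> \<inter> ball 0 r" using that by blast
            then show False using that unfolding eq by auto
          qed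
          then show ?thesis by blast
        qed
        ultimately show False using 0 by (meson disjoint_iff closure_iff_nhds_not_empty subset_refl)
      qed
    qed
    from hardy_chart[OF T \<gamma> this r a \<epsilon>] obtain \<delta> C where dC: "\<delta> > 0" "C \<ge> 0"
      "\<And>u g. sob {x \<in> ball 0 r. T x $ 2 > \<gamma> (T x $ 1)} u g \<Longrightarrow>
      (\<integral>\<^sup>+x. ennreal ((u x)\<^sup>2 * hardy_weight a x) * indicator (ball 0 \<delta>) x \<partial>lborel) \<le>
      ennreal ((4 + \<epsilon>) * (LINT x|lborel. (norm (g x))\<^sup>2) + C * (LINT x|lborel. (u x)\<^sup>2))"
      "(\<integral>\<^sup>+x. ennreal (hardy_weight a x) * indicator ({x. T x $ 2 > \<gamma> (T x $ 1)} \<inter> ball 0 \<delta>) x \<partial>lborel) < \<infinity>"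
      by blast
    let ?\<delta> = "min \<delta> r"
    let ?D = "\<Omega> \<inter> ball 0 r"
    show ?thesis
    proof (rule that[of ?\<delta> C])
      show "?\<delta> > 0" using dC r by simp
      show "C \<ge> 0" by (rule dC)
      fix u g assume s: "sob \<Omega> u g"
      have D: "?D \<in> sets borel" using o by simp
      have sD: "sob {x \<in> ball 0 r. T x $ 2 > \<gamma> (T x $ 1)} (\<lambda>x. indicator ?D x * u x) (\<lambda>x. indicator ?D x *\<^sub>R g x)"
        using sob_restrict[OF s D Int_lower1] unfolding eq .
      have "(\<integral>\<^sup>+x. ennreal ((u x)\<^sup>2 * hardy_weight a x) * indicator (ball 0 ?\<delta>) x \<partial>lborel) \<le>
        (\<integral>\<^sup>+x. ennreal ((indicator ?D x * u x)\<^sup>2 * hardy_weight a x) * indicator (ball 0 \<delta>) x \<partial>lborel)"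
      proof (rule nn_integral_mono)
        fix x
        show "ennreal ((u x)\<^sup>2 * hardy_weight a x) * indicator (ball 0 ?\<delta>) x \<le>
          ennreal ((indicator ?D x * u x)\<^sup>2 * hardy_weight a x) * indicator (ball 0 \<delta>) x"
          using sobD(3)[OF s, of x] by (cases "x \<in> \<Omega>") (auto simp: indicator_def)
      qed
      also have "\<dots> \<le> ennreal ((4 + \<epsilon>) * (LINT x|lborel. (norm (indicator ?D x *\<^sub>R g x))\<^sup>2) + C * (LINT x|lborel. (indicator ?D x * u x)\<^sup>2))"
        by (rule dC(3)[OF sD])
      also have "\<dots> \<le> ennreal ((4 + \<epsilon>) * (LINT x|lborel. (norm (g x))\<^sup>2) + C * (LINT x|lborel. (u x)\<^sup>2))"
        using \<epsilon> dC(2) sobD(5,6)[OF s] sobD(5,6)[OF sD]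
        by (intro ennreal_leI add_mono mult_left_mono integral_mono) (auto simp: indicator_def)
      finally show "(\<integral>\<^sup>+x. ennreal ((u x)\<^sup>2 * hardy_weight a x) * indicator (ball 0 ?\<delta>) x \<partial>lborel) \<le>
        ennreal ((4 + \<epsilon>) * (LINT x|lborel. (norm (g x))\<^sup>2) + C * (LINT x|lborel. (u x)\<^sup>2))" .
    next
      have "(\<integral>\<^sup>+x. ennreal (hardy_weight a x) * indicator (\<Omega> \<inter> ball 0 ?\<delta>) x \<partial>lborel) \<le>
        (\<integral>\<^sup>+x. ennreal (hardy_weight a x) * indicator ({x. T x $ 2 > \<gamma> (T x $ 1)} \<inter> ball 0 \<delta>) x \<partial>lborel)"
      proof (intro nn_integral_mono mult_left_mono)
        fix x
        have "x \<in> \<Omega> \<inter> ball 0 ?\<delta> \<Longrightarrow> x \<in> \<Omega> \<inter> ball 0 r" by auto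
        then show "(indicator (\<Omega> \<inter> ball 0 ?\<delta>) x :: ennreal) \<le> indicator ({x. T x $ 2 > \<gamma> (T x $ 1)} \<inter> ball 0 \<delta>) x"
          unfolding eq by (auto simp: indicator_def)
      qed auto
      then show "(\<integral>\<^sup>+x. ennreal (hardy_weight a x) * indicator (\<Omega> \<inter> ball 0 ?\<delta>) x \<partial>lborel) < \<infinity>"
        using dC(4) by (rule le_less_trans)
    qed
  next
    case True
    then obtain r where r: "r > 0" "ball 0 r \<subseteq> \<Omega>" using o open_contains_ball by blast
    define P where "P = {x \<in> ball 0 r. (x::real^2) $ 2 > 0}"
    define N where "N = {x \<in> ball 0 r. (- x::real^2) $ 2 > 0}"
    \<comment> \<open>The identity and the point reflection serve as charts with zero boundary
      function, one for each half of the disc.\<close>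
    have T1: "orthogonal_transformation (\<lambda>x::real^2. x)" and T2: "orthogonal_transformation (uminus :: real^2 \<Rightarrow> real^2)"
      by (auto simp: orthogonal_transformation_def linear_uminus linear_id[unfolded id_def] linear_iff)
    obtain \<delta>1 C1 where 1: "\<delta>1 > 0" "C1 \<ge> 0"
      "\<And>u g. sob P u g \<Longrightarrow> (\<integral>\<^sup>+x. ennreal ((u x)\<^sup>2 * hardy_weight a x) * indicator (ball 0 \<delta>1) x \<partial>lborel) \<le>
      ennreal ((4 + \<epsilon>) * (LINT x|lborel. (norm (g x))\<^sup>2) + C1 * (LINT x|lborel. (u x)\<^sup>2))"
      "(\<integral>\<^sup>+x. ennreal (hardy_weight a x) * indicator ({x. x $ 2 > 0} \<inter> ball 0 \<delta>1) x \<partial>lborel) < \<infinity>"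
      using hardy_chart[OF T1 smooth_fun_zero refl r(1) a \<epsilon>] unfolding P_def by blast
    obtain \<delta>2 C2 where 2: "\<delta>2 > 0" "C2 \<ge> 0"
      "\<And>u g. sob N u g \<Longrightarrow> (\<integral>\<^sup>+x. ennreal ((u x)\<^sup>2 * hardy_weight a x) * indicator (ball 0 \<delta>2) x \<partial>lborel) \<le>
      ennreal ((4 + \<epsilon>) * (LINT x|lborel. (norm (g x))\<^sup>2) + C2 * (LINT x|lborel. (u x)\<^sup>2))"
      "(\<integral>\<^sup>+x. ennreal (hardy_weight a x) * indicator ({x. (- x) $ 2 > 0} \<inter> ball 0 \<delta>2) x \<partial>lborel) < \<infinity>"
      using hardy_chart[OF T2 smooth_fun_zero refl r(1) a \<epsilon>] unfolding N_def by blast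
    have coord: "continuous_on UNIV (\<lambda>x::real^2. x $ 2)" by (intro continuous_intros)
    have [measurable]: "ball (0::real^2) \<rho> \<in> sets borel" for \<rho> by simp
    have [measurable]: "(\<lambda>x::real^2. x $ 2) \<in> borel_measurable borel"
      by (rule borel_measurable_continuous_onI[OF coord])
    have PN: "P \<in> sets borel" "N \<in> sets borel" "P \<subseteq> \<Omega>" "N \<subseteq> \<Omega>" "P \<inter> N = {}"
      using r(2) unfolding P_def N_def by (auto simp: subset_iff)
    \<comment> \<open>The common boundary line of the half discs is a null set, so cutting along it
      loses nothing.\<close>
    have axis: "AE x in lborel. (x::real^2) $ 2 \<noteq> 0"
    proof -
      have "negligible {x::real^2. axis 2 1 \<bullet> x = 0}" by (rule negligible_hyperplane) simp
      moreover have "{x::real^2. axis 2 1 \<bullet> x = 0} = {x. x $ 2 = 0}" by (auto simp: inner_axis')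
      moreover have "{x::real^2. x $ 2 = 0} \<in> sets borel" by measurable
      ultimately have "{x::real^2. x $ 2 = 0} \<in> null_sets lborel"
        by (simp add: negligible_iff_null_sets null_sets_completion_iff)
      from AE_not_in[OF this] show ?thesis by simp
    qed
    let ?\<delta> = "min r (min \<delta>1 \<delta>2)"
    let ?C = "C1 + C2"
    show ?thesis
    proof (rule that[of ?\<delta> ?C])
      show "?\<delta> > 0" using 1 2 r by simp
      show "?C \<ge> 0" using 1 2 by simp
      fix u g assume s: "sob \<Omega> u g"
      note [measurable] = sobD(1,2)[OF s] PN(1,2)
      note sP = sob_restrict[OF s PN(1,3)] and sN = sob_restrict[OF s PN(2,4)]
      have "(\<integral>\<^sup>+x. ennreal ((u x)\<^sup>2 * hardy_weight a x) * indicator (ball 0 ?\<delta>) x \<partial>lborel) \<le>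
        (\<integral>\<^sup>+x. ennreal ((indicator P x * u x)\<^sup>2 * hardy_weight a x) * indicator (ball 0 \<delta>1) x +
           ennreal ((indicator N x * u x)\<^sup>2 * hardy_weight a x) * indicator (ball 0 \<delta>2) x \<partial>lborel)"
      proof (rule nn_integral_mono_AE)
        show "AE x in lborel. ennreal ((u x)\<^sup>2 * hardy_weight a x) * indicator (ball 0 ?\<delta>) x \<le>
           ennreal ((indicator P x * u x)\<^sup>2 * hardy_weight a x) * indicator (ball 0 \<delta>1) x +
           ennreal ((indicator N x * u x)\<^sup>2 * hardy_weight a x) * indicator (ball 0 \<delta>2) x"
          using axis
        proof eventually_elim
          case (elim x)
          show ?case
          proof (cases "x \<in> ball 0 ?\<delta>")
            case True
            then have "x \<in> P \<or> x \<in> N" using elim by (auto simp: P_def N_def)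
            then show ?thesis using True by (auto simp: indicator_def)
          qed simp
        qed
      qed
      also have "\<dots> = (\<integral>\<^sup>+x. ennreal ((indicator P x * u x)\<^sup>2 * hardy_weight a x) * indicator (ball 0 \<delta>1) x \<partial>lborel) +
           (\<integral>\<^sup>+x. ennreal ((indicator N x * u x)\<^sup>2 * hardy_weight a x) * indicator (ball 0 \<delta>2) x \<partial>lborel)"
        by (rule nn_integral_add) measurable
      also have "\<dots> \<le> ennreal ((4 + \<epsilon>) * (LINT x|lborel. (norm (indicator P x *\<^sub>R g x))\<^sup>2) + C1 * (LINT x|lborel. (indicator P x * u x)\<^sup>2)) +
          ennreal ((4 + \<epsilon>) * (LINT x|lborel. (norm (indicator N x *\<^sub>R g x))\<^sup>2) + C2 * (LINT x|lborel. (indicator N x * u x)\<^sup>2))"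
        by (intro add_mono 1(3)[OF sP] 2(3)[OF sN])
      also have "\<dots> = ennreal (((4 + \<epsilon>) * (LINT x|lborel. (norm (indicator P x *\<^sub>R g x))\<^sup>2) + C1 * (LINT x|lborel. (indicator P x * u x)\<^sup>2)) +
          ((4 + \<epsilon>) * (LINT x|lborel. (norm (indicator N x *\<^sub>R g x))\<^sup>2) + C2 * (LINT x|lborel. (indicator N x * u x)\<^sup>2)))"
        using \<epsilon> 1(2) 2(2)
        by (intro ennreal_plus[symmetric] add_nonneg_nonneg mult_nonneg_nonneg sob_integral_nonneg) auto
      also have "\<dots> \<le> ennreal ((4 + \<epsilon>) * (LINT x|lborel. (norm (g x))\<^sup>2) + ?C * (LINT x|lborel. (u x)\<^sup>2))"
      proof (rule ennreal_leI)
        \<comment> \<open>The half discs are disjoint, so the two gradient integrals add up to at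
          most the full one and the leading constant \<open>4 + \<epsilon>\<close> is not doubled;
          only the constant of the square integral grows.\<close>
        have "(LINT x|lborel. (norm (indicator P x *\<^sub>R g x))\<^sup>2) + (LINT x|lborel. (norm (indicator N x *\<^sub>R g x))\<^sup>2) =
          (LINT x|lborel. (norm (indicator P x *\<^sub>R g x))\<^sup>2 + (norm (indicator N x *\<^sub>R g x))\<^sup>2)"
          using sobD(6)[OF sP] sobD(6)[OF sN] by simp
        also have "\<dots> \<le> (LINT x|lborel. (norm (g x))\<^sup>2)"
        proof (rule integral_mono)
          show "integrable lborel (\<lambda>x. (norm (indicator P x *\<^sub>R g x))\<^sup>2 + (norm (indicator N x *\<^sub>R g x))\<^sup>2)"
            using sobD(6)[OF sP] sobD(6)[OF sN] by simp
          show "integrable lborel (\<lambda>x. (norm (g x))\<^sup>2)" by (rule sobD(6)[OF s])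
          show "(norm (indicator P x *\<^sub>R g x))\<^sup>2 + (norm (indicator N x *\<^sub>R g x))\<^sup>2 \<le> (norm (g x))\<^sup>2" for x
            using PN(5) by (auto simp: indicator_def)
        qed
        finally have G: "(4 + \<epsilon>) * ((LINT x|lborel. (norm (indicator P x *\<^sub>R g x))\<^sup>2) + (LINT x|lborel. (norm (indicator N x *\<^sub>R g x))\<^sup>2))
           \<le> (4 + \<epsilon>) * (LINT x|lborel. (norm (g x))\<^sup>2)" using \<epsilon> by (intro mult_left_mono) auto
        have U1: "C1 * (LINT x|lborel. (indicator P x * u x)\<^sup>2) \<le> C1 * (LINT x|lborel. (u x)\<^sup>2)"
          using 1(2) sobD(5)[OF s] sobD(5)[OF sP] by (intro mult_left_mono integral_mono) (auto simp: indicator_def)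
        have U2: "C2 * (LINT x|lborel. (indicator N x * u x)\<^sup>2) \<le> C2 * (LINT x|lborel. (u x)\<^sup>2)"
          using 2(2) sobD(5)[OF s] sobD(5)[OF sN] by (intro mult_left_mono integral_mono) (auto simp: indicator_def)
        show "(4 + \<epsilon>) * (LINT x|lborel. (norm (indicator P x *\<^sub>R g x))\<^sup>2) + C1 * (LINT x|lborel. (indicator P x * u x)\<^sup>2) +
          ((4 + \<epsilon>) * (LINT x|lborel. (norm (indicator N x *\<^sub>R g x))\<^sup>2) + C2 * (LINT x|lborel. (indicator N x * u x)\<^sup>2)) \<le>
          (4 + \<epsilon>) * (LINT x|lborel. (norm (g x))\<^sup>2) + ?C * (LINT x|lborel. (u x)\<^sup>2)"
          using G U1 U2 by (simp only: distrib_left distrib_right)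
      qed
      finally show "(\<integral>\<^sup>+x. ennreal ((u x)\<^sup>2 * hardy_weight a x) * indicator (ball 0 ?\<delta>) x \<partial>lborel) \<le>
        ennreal ((4 + \<epsilon>) * (LINT x|lborel. (norm (g x))\<^sup>2) + ?C * (LINT x|lborel. (u x)\<^sup>2))" .
    next
      have "(\<integral>\<^sup>+x. ennreal (hardy_weight a x) * indicator (\<Omega> \<inter> ball 0 ?\<delta>) x \<partial>lborel) \<le>
        (\<integral>\<^sup>+x. ennreal (hardy_weight a x) * indicator ({x. x $ 2 > 0} \<inter> ball 0 \<delta>1) x +
          ennreal (hardy_weight a x) * indicator ({x. (- x) $ 2 > 0} \<inter> ball 0 \<delta>2) x \<partial>lborel)"
      proof (rule nn_integral_mono_AE)
        show "AE x in lborel. ennreal (hardy_weight a x) * indicator (\<Omega> \<inter> ball 0 ?\<delta>) x \<le>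
          ennreal (hardy_weight a x) * indicator ({x. x $ 2 > 0} \<inter> ball 0 \<delta>1) x +
          ennreal (hardy_weight a x) * indicator ({x. (- x) $ 2 > 0} \<inter> ball 0 \<delta>2) x"
          using axis by eventually_elim (auto simp: indicator_def)
      qed
      also have "\<dots> = (\<integral>\<^sup>+x. ennreal (hardy_weight a x) * indicator ({x. x $ 2 > 0} \<inter> ball 0 \<delta>1) x \<partial>lborel) +
          (\<integral>\<^sup>+x. ennreal (hardy_weight a x) * indicator ({x. (- x) $ 2 > 0} \<inter> ball 0 \<delta>2) x \<partial>lborel)"
        by (rule nn_integral_add) (auto intro!: borel_measurable_times_ennreal borel_measurable_indicator sets.Int)
      also have "\<dots> < \<infinity>" using 1(4) 2(4) by simp
      finally show "(\<integral>\<^sup>+x. ennreal (hardy_weight a x) * indicator (\<Omega> \<inter> ball 0 ?\<delta>) x \<partial>lborel) < \<infinity>" .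
    qed
  qed
qed

text \<open>For \<open>norm x \<le> 1\<close> the logarithm is at least \<open>ln a\<close>, which
  is positive because \<open>a > 1\<close>; only the origin is then singular.\<close>

lemma hardy_weight_le:
  assumes "a > 1" "0 < \<delta>" "\<delta> \<le> norm x" "norm x \<le> 1"
  shows "hardy_weight a x \<le> 1 / (\<delta>\<^sup>2 * (ln a)\<^sup>2)"
proof -
  have "a * norm x \<le> a * 1" using assms by (intro mult_left_mono) auto
  moreover have "norm x > 0" using assms by linarith
  ultimately have "a \<le> a / norm x" by (simp only: pos_le_divide_eq mult_1_right)
  then have "ln a \<le> ln (a / norm x)" using assms by (subst ln_le_cancel_iff) auto
  moreover have "ln a > 0" using assms by simp
  ultimately have "\<delta>\<^sup>2 * (ln a)\<^sup>2 \<le> (norm x)\<^sup>2 * (ln (a / norm x))\<^sup>2"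
    using assms by (intro mult_mono power_mono) auto
  moreover have "0 < \<delta>\<^sup>2 * (ln a)\<^sup>2" using assms \<open>ln a > 0\<close> by simp
  ultimately show ?thesis unfolding hardy_weight_def by (intro divide_left_mono) (auto intro!: mult_pos_pos)
qed

text \<open>Away from the origin the weight is bounded and its contribution goes into the multiple
  of the square integral, so the leading constant is decided near the origin alone.\<close>

lemma hardy_domain:
  fixes \<Omega> :: "(real^2) set"
  assumes dom: "smooth_bounded_domain \<Omega>" and 0: "0 \<in> closure \<Omega>" and a: "a > 1" and \<epsilon>: "\<epsilon> > 0"
    and n1: "\<And>x. x \<in> \<Omega> \<Longrightarrow> norm x \<le> 1"
  obtains C where "C \<ge> 0"
    "\<And>u g. sob \<Omega> u g \<Longrightarrow> (\<integral>\<^sup>+x. ennreal ((u x)\<^sup>2 * hardy_weight a x) \<partial>lborel) \<le>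
      ennreal ((4 + \<epsilon>) * (LINT x|lborel. (norm (g x))\<^sup>2) + C * (LINT x|lborel. (u x)\<^sup>2))"
    "(\<integral>\<^sup>+x. ennreal (hardy_weight a x) * indicator \<Omega> x \<partial>lborel) < \<infinity>"
proof -
  have o: "open \<Omega>" and b: "bounded \<Omega>" using dom by (auto simp: smooth_bounded_domain_def)
  have [measurable]: "\<Omega> \<in> sets borel" "ball (0::real^2) \<rho> \<in> sets borel" for \<rho> using o by simp_all
  obtain \<delta> C where dC: "\<delta> > 0" "C \<ge> 0"
    "\<And>u g. sob \<Omega> u g \<Longrightarrow>
      (\<integral>\<^sup>+x. ennreal ((u x)\<^sup>2 * hardy_weight a x) * indicator (ball 0 \<delta>) x \<partial>lborel) \<le>
      ennreal ((4 + \<epsilon>) * (LINT x|lborel. (norm (g x))\<^sup>2) + C * (LINT x|lborel. (u x)\<^sup>2))"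
    "(\<integral>\<^sup>+x. ennreal (hardy_weight a x) * indicator (\<Omega> \<inter> ball 0 \<delta>) x \<partial>lborel) < \<infinity>"
    using hardy_near_origin[OF dom 0 a \<epsilon>] by blast
  define B where "B = 1 / (\<delta>\<^sup>2 * (ln a)\<^sup>2)"
  have B: "B \<ge> 0" "\<And>x. x \<in> \<Omega> \<Longrightarrow> x \<notin> ball 0 \<delta> \<Longrightarrow> hardy_weight a x \<le> B"
    unfolding B_def using a dC(1) n1 by (auto intro!: hardy_weight_le)
  show ?thesis
  proof (rule that[of "C + B"])
    show "C + B \<ge> 0" using dC B by simp
    fix u g assume s: "sob \<Omega> u g"
    note [measurable] = sobD(1)[OF s]
    let ?G = "LINT x|lborel. (norm (g x))\<^sup>2" and ?U = "LINT x|lborel. (u x)\<^sup>2"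
    have "(\<integral>\<^sup>+x. ennreal ((u x)\<^sup>2 * hardy_weight a x) \<partial>lborel) \<le>
      (\<integral>\<^sup>+x. ennreal ((u x)\<^sup>2 * hardy_weight a x) * indicator (ball 0 \<delta>) x + ennreal (B * (u x)\<^sup>2) \<partial>lborel)"
    proof (rule nn_integral_mono)
      fix x
      show "ennreal ((u x)\<^sup>2 * hardy_weight a x) \<le>
        ennreal ((u x)\<^sup>2 * hardy_weight a x) * indicator (ball 0 \<delta>) x + ennreal (B * (u x)\<^sup>2)"
      proof (cases "x \<in> ball 0 \<delta> \<or> x \<notin> \<Omega>")
        case True
        then show ?thesis using sobD(3)[OF s, of x] by (auto simp: indicator_def)
      next
        case False
        then have "(u x)\<^sup>2 * hardy_weight a x \<le> (u x)\<^sup>2 * B" using B(2) by (intro mult_left_mono) auto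
        then have "ennreal ((u x)\<^sup>2 * hardy_weight a x) \<le> ennreal (B * (u x)\<^sup>2)"
          by (intro ennreal_leI) (simp add: mult.commute)
        then show ?thesis using False by simp
      qed
    qed
    also have "\<dots> = (\<integral>\<^sup>+x. ennreal ((u x)\<^sup>2 * hardy_weight a x) * indicator (ball 0 \<delta>) x \<partial>lborel) + (\<integral>\<^sup>+x. ennreal (B * (u x)\<^sup>2) \<partial>lborel)"
      by (rule nn_integral_add) measurable
    also have "(\<integral>\<^sup>+x. ennreal (B * (u x)\<^sup>2) \<partial>lborel) = ennreal (B * ?U)"
      using B sobD(5)[OF s] by (subst nn_integral_eq_integral) auto
    also have "(\<integral>\<^sup>+x. ennreal ((u x)\<^sup>2 * hardy_weight a x) * indicator (ball 0 \<delta>) x \<partial>lborel) + ennreal (B * ?U) \<le>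
      ennreal ((4 + \<epsilon>) * ?G + C * ?U) + ennreal (B * ?U)"
      by (intro add_mono dC(3)[OF s]) auto
    also have "\<dots> = ennreal ((4 + \<epsilon>) * ?G + C * ?U + B * ?U)"
      using \<epsilon> dC(2) B(1)
      by (intro ennreal_plus[symmetric] add_nonneg_nonneg mult_nonneg_nonneg sob_integral_nonneg) auto
    also have "\<dots> = ennreal ((4 + \<epsilon>) * ?G + (C + B) * ?U)" by (simp add: algebra_simps)
    finally show "(\<integral>\<^sup>+x. ennreal ((u x)\<^sup>2 * hardy_weight a x) \<partial>lborel) \<le> ennreal ((4 + \<epsilon>) * ?G + (C + B) * ?U)" .
  next
    have "(\<integral>\<^sup>+x. ennreal (hardy_weight a x) * indicator \<Omega> x \<partial>lborel) \<le>
      (\<integral>\<^sup>+x. ennreal (hardy_weight a x) * indicator (\<Omega> \<inter> ball 0 \<delta>) x + ennreal B * indicator \<Omega> x \<partial>lborel)"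
    proof (rule nn_integral_mono)
      fix x
      show "ennreal (hardy_weight a x) * indicator \<Omega> x \<le>
        ennreal (hardy_weight a x) * indicator (\<Omega> \<inter> ball 0 \<delta>) x + ennreal B * indicator \<Omega> x"
        using B(2)[of x] by (auto simp: indicator_def ennreal_leI)
    qed
    also have "\<dots> = (\<integral>\<^sup>+x. ennreal (hardy_weight a x) * indicator (\<Omega> \<inter> ball 0 \<delta>) x \<partial>lborel) + ennreal B * emeasure lborel \<Omega>"
      by (simp add: nn_integral_add nn_integral_cmult)
    also have "\<dots> < \<infinity>"
      using dC(4) emeasure_bounded_finite[OF b] by (simp add: ennreal_mult_less_top)
    finally show "(\<integral>\<^sup>+x. ennreal (hardy_weight a x) * indicator \<Omega> x \<partial>lborel) < \<infinity>" .
  qed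
qed

section \<open>Representatives\<close>

text \<open>Three passages lead from the restricted complete measure to \<open>lborel\<close>: an
  almost everywhere change of function, absorption of the restriction because \<open>F\<close>
  vanishes outside, and removal of the completion.\<close>

lemma lebesgue_on_Borel:
  fixes F :: "'a::euclidean_space \<Rightarrow> 'b::euclidean_space"
  assumes \<Omega>: "\<Omega> \<in> sets borel" and F [measurable]: "F \<in> borel_measurable borel"
    and f: "f \<in> borel_measurable (lebesgue_on \<Omega>)" and z: "\<And>x. x \<notin> \<Omega> \<Longrightarrow> F x = 0"
    and ae: "AE x in lebesgue_on \<Omega>. f x = F x"
  shows "integrable (lebesgue_on \<Omega>) f \<longleftrightarrow> integrable lborel F"
    and "(LINT x|lebesgue_on \<Omega>. f x) = (LINT x|lborel. F x)"
proof -
  have O: "\<Omega> \<inter> space lebesgue \<in> sets lebesgue" using \<Omega> by auto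
  have Fm: "F \<in> borel_measurable lebesgue" by (rule measurable_completion) simp
  then have Fr: "F \<in> borel_measurable (lebesgue_on \<Omega>)" by (rule measurable_restrict_space1)
  have eq: "(\<lambda>x. indicator \<Omega> x *\<^sub>R F x) = F" using z by (auto simp: indicator_def fun_eq_iff)
  have "integrable (lebesgue_on \<Omega>) f \<longleftrightarrow> integrable (lebesgue_on \<Omega>) F"
    by (rule integrable_cong_AE[OF f Fr ae])
  also have "\<dots> \<longleftrightarrow> integrable lebesgue F" using integrable_restrict_space[OF O, of F] by (simp add: eq)
  also have "\<dots> \<longleftrightarrow> integrable lborel F" by (rule integrable_completion) simp
  finally show "integrable (lebesgue_on \<Omega>) f \<longleftrightarrow> integrable lborel F" .
  have "(LINT x|lebesgue_on \<Omega>. f x) = (LINT x|lebesgue_on \<Omega>. F x)"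
    by (rule integral_cong_AE[OF f Fr ae])
  also have "\<dots> = (LINT x|lebesgue. F x)" using integral_restrict_space[OF O, of F] by (simp add: eq)
  also have "\<dots> = (LINT x|lborel. F x)" by (rule integral_completion) simp
  finally show "(LINT x|lebesgue_on \<Omega>. f x) = (LINT x|lborel. F x)" .
qed

lemma nn_integral_lebesgue_on_Borel:
  fixes F :: "'a::euclidean_space \<Rightarrow> ennreal"
  assumes \<Omega>: "\<Omega> \<in> sets borel" and z: "\<And>x. x \<notin> \<Omega> \<Longrightarrow> F x = 0"
    and ae: "AE x in lebesgue_on \<Omega>. f x = F x"
  shows "(\<integral>\<^sup>+x. f x \<partial>lebesgue_on \<Omega>) = (\<integral>\<^sup>+x. F x \<partial>lborel)"
proof -
  have O: "\<Omega> \<inter> space lebesgue \<in> sets lebesgue" using \<Omega> by auto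
  have "(\<integral>\<^sup>+x. f x \<partial>lebesgue_on \<Omega>) = (\<integral>\<^sup>+x. F x \<partial>lebesgue_on \<Omega>)"
    by (rule nn_integral_cong_AE[OF ae])
  also have "\<dots> = (\<integral>\<^sup>+x. F x * indicator \<Omega> x \<partial>lebesgue)" by (rule nn_integral_restrict_space[OF O])
  also have "\<dots> = (\<integral>\<^sup>+x. F x \<partial>lebesgue)" using z by (intro nn_integral_cong) (auto simp: indicator_def)
  also have "\<dots> = (\<integral>\<^sup>+x. F x \<partial>lborel)" by (rule nn_integral_completion)
  finally show ?thesis .
qed

lemma AE_lebesgue_on_iff_lborel:
  assumes \<Omega>: "\<Omega> \<in> sets borel" and P: "{x. \<not> P x} \<in> sets borel" and z: "\<And>x. x \<notin> \<Omega> \<Longrightarrow> P x"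
  shows "(AE x in lebesgue_on \<Omega>. P x) \<longleftrightarrow> (AE x in lborel. P x)"
proof -
  have O: "\<Omega> \<inter> space lebesgue \<in> sets lebesgue" using \<Omega> by auto
  have "(AE x in lebesgue_on \<Omega>. P x) \<longleftrightarrow> (AE x in lebesgue. x \<in> \<Omega> \<longrightarrow> P x)"
    by (rule AE_restrict_space_iff[OF O])
  also have "\<dots> \<longleftrightarrow> (AE x in lebesgue. P x)" using z by (intro AE_cong) auto
  also have "\<dots> \<longleftrightarrow> (AE x in lborel. P x)" by (simp add: AE_completion_iff)
  finally show ?thesis .
qed

lemma real_Borel_representative:
  fixes u :: "'a::euclidean_space \<Rightarrow> real"
  assumes \<Omega>: "\<Omega> \<in> sets borel" and u: "u \<in> borel_measurable (lebesgue_on \<Omega>)"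
  obtains u' where "u' \<in> borel_measurable borel" "\<And>x. x \<notin> \<Omega> \<Longrightarrow> u' x = 0" "AE x in lebesgue_on \<Omega>. u x = u' x"
proof -
  have O: "\<Omega> \<inter> space lebesgue \<in> sets lebesgue" using \<Omega> by auto
  have "(\<lambda>x. indicator \<Omega> x *\<^sub>R u x) \<in> borel_measurable lebesgue"
    using u borel_measurable_restrict_space_iff[OF O, of u] by simp
  then obtain v where v: "v \<in> borel_measurable lborel" "AE x in lborel. indicator \<Omega> x *\<^sub>R u x = v x"
    using completion_ex_borel_measurable_real by blast
  show ?thesis
  proof (rule that[of "\<lambda>x. indicator \<Omega> x * v x"])
    show "(\<lambda>x. indicator \<Omega> x * v x) \<in> borel_measurable borel" using v(1) \<Omega> by simp
    have "AE x in lebesgue. indicator \<Omega> x *\<^sub>R u x = v x" using v(2) by (rule AE_completion)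
    then have "AE x in lebesgue. x \<in> \<Omega> \<longrightarrow> u x = indicator \<Omega> x * v x"
      by eventually_elim (auto simp: indicator_def split: if_splits)
    then show "AE x in lebesgue_on \<Omega>. u x = indicator \<Omega> x * v x"
      by (simp add: AE_restrict_space_iff[OF O])
  qed simp
qed

text \<open>Componentwise, as finitely many exceptional null sets can be united.\<close>

lemma Borel_representative:
  fixes g :: "'a::euclidean_space \<Rightarrow> 'b::euclidean_space"
  assumes \<Omega>: "\<Omega> \<in> sets borel" and g: "g \<in> borel_measurable (lebesgue_on \<Omega>)"
  obtains g' where "g' \<in> borel_measurable borel" "\<And>x. x \<notin> \<Omega> \<Longrightarrow> g' x = 0" "AE x in lebesgue_on \<Omega>. g x = g' x"
proof -
  have "\<exists>v. v \<in> borel_measurable borel \<and> (\<forall>x. x \<notin> \<Omega> \<longrightarrow> v x = 0) \<and> (AE x in lebesgue_on \<Omega>. g x \<bullet> i = v x)" for i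
  proof -
    have "(\<lambda>x. g x \<bullet> i) \<in> borel_measurable (lebesgue_on \<Omega>)" using g by simp
    from real_Borel_representative[OF \<Omega> this] show ?thesis by blast
  qed
  then obtain v where v: "\<And>i. v i \<in> borel_measurable borel" "\<And>i x. x \<notin> \<Omega> \<Longrightarrow> v i x = 0"
    "\<And>i. AE x in lebesgue_on \<Omega>. g x \<bullet> i = v i x" by metis
  show ?thesis
  proof (rule that[of "\<lambda>x. \<Sum>i\<in>Basis. v i x *\<^sub>R i"])
    show "(\<lambda>x. \<Sum>i\<in>Basis. v i x *\<^sub>R i) \<in> borel_measurable borel" using v(1) by measurable
    have "AE x in lebesgue_on \<Omega>. \<forall>i\<in>Basis. g x \<bullet> i = v i x"
      using v(3) by (intro AE_finite_allI) auto
    then show "AE x in lebesgue_on \<Omega>. g x = (\<Sum>i\<in>Basis. v i x *\<^sub>R i)"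
    proof eventually_elim
      case (elim x)
      have "g x = (\<Sum>i\<in>Basis. (g x \<bullet> i) *\<^sub>R i)" by (simp add: euclidean_representation)
      then show ?case using elim by simp
    qed
  qed (use v(2) in simp)
qed

lemma test_fun_continuous:
  assumes "test_fun \<Omega> \<phi>"
  shows "continuous_on UNIV \<phi>" "continuous_on UNIV (dir_deriv i \<phi>)"
    "\<exists>B>0. \<forall>x. \<bar>\<phi> x\<bar> \<le> B" "\<exists>B>0. \<forall>x. \<bar>dir_deriv i \<phi> x\<bar> \<le> B"
proof -
  have s: "smooth_fun \<phi>" and c: "compact (closure {x. \<phi> x \<noteq> 0})" using assms by (auto simp: test_fun_def)
  show c1: "continuous_on UNIV \<phi>" by (rule smooth_fun_continuous[OF s])
  have "dir_deriv i \<phi> differentiable (at x)" for x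
    using s[unfolded smooth_fun_def, rule_format, of "[i]" x] by simp
  then show c2: "continuous_on UNIV (dir_deriv i \<phi>)"
    by (auto intro!: continuous_at_imp_continuous_on differentiable_imp_continuous_within)
  let ?S = "closure {x. \<phi> x \<noteq> 0}"
  have t: "test_fun ?S \<phi>" using s c by (auto simp: test_fun_def)
  obtain R where R: "?S \<subseteq> ball 0 R" using bounded_subset_ballD[OF compact_imp_bounded[OF c]] by blast
  have z: "x \<notin> ?S" if "R \<le> norm x" for x using R that by auto
  show "\<exists>B>0. \<forall>x. \<bar>\<phi> x\<bar> \<le> B"
    using compact_support_uniform(2)[OF c1 test_fun_outside(1)[OF t z]] by simp
  show "\<exists>B>0. \<forall>x. \<bar>dir_deriv i \<phi> x\<bar> \<le> B"
    using compact_support_uniform(2)[OF c2 test_fun_outside(2)[OF t z]] by simp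
qed

lemma test_fun_measurable:
  assumes "test_fun \<Omega> \<phi>"
  shows "\<phi> \<in> borel_measurable borel" "dir_deriv i \<phi> \<in> borel_measurable borel"
  using test_fun_continuous(1,2)[OF assms] by (auto intro: borel_measurable_continuous_onI)

text \<open>Every clause on one side has the same integral on the other, since the functions agree
  almost everywhere. The variational argument can thus be carried out on \<open>lborel\<close>
  throughout.\<close>

lemma weak_grad_lborel:
  assumes o: "open \<Omega>" and um: "u \<in> borel_measurable (lebesgue_on \<Omega>)" and gm: "g \<in> borel_measurable (lebesgue_on \<Omega>)"
    and u' [measurable]: "u' \<in> borel_measurable borel" and g' [measurable]: "g' \<in> borel_measurable borel"
    and z: "\<And>x. x \<notin> \<Omega> \<Longrightarrow> u' x = 0" "\<And>x. x \<notin> \<Omega> \<Longrightarrow> g' x = 0"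
    and ae: "AE x in lebesgue_on \<Omega>. u x = u' x" "AE x in lebesgue_on \<Omega>. g x = g' x"
  shows "L2_on \<Omega> u \<and> has_weak_grad \<Omega> u g \<longleftrightarrow> sob \<Omega> u' g'"
proof -
  have \<Omega>: "\<Omega> \<in> sets borel" using o by simp
  have 1: "integrable (lebesgue_on \<Omega>) (\<lambda>x. (norm (u x))\<^sup>2) \<longleftrightarrow> integrable lborel (\<lambda>x. (u' x)\<^sup>2)"
  proof (rule lebesgue_on_Borel(1)[OF \<Omega>])
    show "AE x in lebesgue_on \<Omega>. (norm (u x))\<^sup>2 = (u' x)\<^sup>2" using ae(1) by eventually_elim simp
  qed (use um z in auto)
  have 2: "integrable (lebesgue_on \<Omega>) (\<lambda>x. (norm (g x))\<^sup>2) \<longleftrightarrow> integrable lborel (\<lambda>x. (norm (g' x))\<^sup>2)"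
  proof (rule lebesgue_on_Borel(1)[OF \<Omega>])
    show "AE x in lebesgue_on \<Omega>. (norm (g x))\<^sup>2 = (norm (g' x))\<^sup>2" using ae(2) by eventually_elim simp
  qed (use gm z in auto)
  have rm: "h \<in> borel_measurable (lebesgue_on \<Omega>)" if "h \<in> borel_measurable borel" for h :: "'a \<Rightarrow> real"
    by (rule measurable_restrict_space1[OF measurable_completion]) (use that in simp)
  have 3: "(LINT x|lebesgue_on \<Omega>. u x * dir_deriv i \<phi> x) = (LINT x|lborel. u' x * dir_deriv i \<phi> x)"
    if t: "test_fun \<Omega> \<phi>" for \<phi> i
  proof (rule lebesgue_on_Borel(2)[OF \<Omega>])
    note [measurable] = test_fun_measurable[OF t]
    show "(\<lambda>x. u' x * dir_deriv i \<phi> x) \<in> borel_measurable borel" by measurable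
    show "(\<lambda>x. u x * dir_deriv i \<phi> x) \<in> borel_measurable (lebesgue_on \<Omega>)"
      by (rule borel_measurable_times[OF um rm]) measurable
    show "AE x in lebesgue_on \<Omega>. u x * dir_deriv i \<phi> x = u' x * dir_deriv i \<phi> x" using ae(1) by eventually_elim simp
  qed (use z in auto)
  have 4: "(LINT x|lebesgue_on \<Omega>. (g x \<bullet> i) * \<phi> x) = (LINT x|lborel. (g' x \<bullet> i) * \<phi> x)"
    if t: "test_fun \<Omega> \<phi>" for \<phi> i
  proof (rule lebesgue_on_Borel(2)[OF \<Omega>])
    note [measurable] = test_fun_measurable[OF t]
    show "(\<lambda>x. (g' x \<bullet> i) * \<phi> x) \<in> borel_measurable borel" by measurable
    show "(\<lambda>x. (g x \<bullet> i) * \<phi> x) \<in> borel_measurable (lebesgue_on \<Omega>)"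
      by (rule borel_measurable_times[OF borel_measurable_inner[OF gm borel_measurable_const] rm]) measurable
    show "AE x in lebesgue_on \<Omega>. (g x \<bullet> i) * \<phi> x = (g' x \<bullet> i) * \<phi> x" using ae(2) by eventually_elim simp
  qed (use z in auto)
  show ?thesis
  proof
    assume "L2_on \<Omega> u \<and> has_weak_grad \<Omega> u g"
    then show "sob \<Omega> u' g'"
      unfolding L2_on_def has_weak_grad_def sob_def using 1 2 3 4 z u' g' by simp
  next
    assume "sob \<Omega> u' g'"
    then show "L2_on \<Omega> u \<and> has_weak_grad \<Omega> u g"
      unfolding L2_on_def has_weak_grad_def sob_def using 1 2 3 4 um gm by simp
  qed
qed

lemma weak_grad_imp_sob:
  assumes o: "open \<Omega>" and u: "L2_on \<Omega> u" and g: "has_weak_grad \<Omega> u g"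
  obtains u' g' where "sob \<Omega> u' g'" "AE x in lebesgue_on \<Omega>. u x = u' x" "AE x in lebesgue_on \<Omega>. g x = g' x"
proof -
  have \<Omega>: "\<Omega> \<in> sets borel" using o by simp
  have m: "u \<in> borel_measurable (lebesgue_on \<Omega>)" "g \<in> borel_measurable (lebesgue_on \<Omega>)"
    using u g by (auto simp: L2_on_def has_weak_grad_def)
  obtain u' where 1: "u' \<in> borel_measurable borel" "\<And>x. x \<notin> \<Omega> \<Longrightarrow> u' x = 0" "AE x in lebesgue_on \<Omega>. u x = u' x"
    using Borel_representative[OF \<Omega> m(1)] by blast
  obtain g' where 2: "g' \<in> borel_measurable borel" "\<And>x. x \<notin> \<Omega> \<Longrightarrow> g' x = 0" "AE x in lebesgue_on \<Omega>. g x = g' x"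
    using Borel_representative[OF \<Omega> m(2)] by blast
  show ?thesis
    using that[of u' g'] weak_grad_lborel[OF o m 1(1) 2(1) 1(2) 2(2) 1(3) 2(3)] u g 1 2 by blast
qed

lemma sob_imp_weak_grad:
  assumes o: "open \<Omega>" and s: "sob \<Omega> u g"
  shows "L2_on \<Omega> u" "has_weak_grad \<Omega> u g"
proof -
  note m = sobD(1,2)[OF s]
  have 1: "u \<in> borel_measurable (lebesgue_on \<Omega>)" "g \<in> borel_measurable (lebesgue_on \<Omega>)"
    by (rule measurable_restrict_space1[OF measurable_completion], use m in simp)+
  show "L2_on \<Omega> u" "has_weak_grad \<Omega> u g"
    using weak_grad_lborel[OF o 1 m sobD(3,4)[OF s]] s by auto
qed

text \<open>Testing with the kernel shows that at each point of the open set the mollified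
  components of \<open>g - h\<close> vanish for small radii, while they converge to the components
  almost everywhere. Consequently the choice made in \<open>weak_grad\<close> does not influence
  integrals.\<close>

lemma sob_unique:
  fixes \<Omega> :: "'a::euclidean_space set"
  assumes o: "open \<Omega>" and b: "bounded \<Omega>" and s: "sob \<Omega> u g" "sob \<Omega> v h" and ae: "AE x in lborel. u x = v x"
  shows "AE x in lborel. g x = h x"
proof -
  have "AE x in lborel. (g x - h x) \<bullet> i = 0" if i: "i \<in> Basis" for i
  proof -
    let ?f = "\<lambda>x. (g x - h x) \<bullet> i"
    note [measurable] = sobD(1,2)[OF s(1)] sobD(1,2)[OF s(2)]
    note ig = sob_integrable(2)[OF s(1) b] and ih = sob_integrable(2)[OF s(2) b]
    have f: "integrable lborel ?f" using ig ih by simp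
    obtain r :: "nat \<Rightarrow> real" where r: "\<And>n. r n > 0" "r \<longlonglongrightarrow> 0" "AE x in lborel. (\<lambda>n. moll (r n) ?f x) \<longlonglongrightarrow> ?f x"
      using moll_AE_sequence[OF f] by blast
    have zero: "moll \<rho> ?f x = 0" if \<rho>: "\<rho> > 0" "cball x \<rho> \<subseteq> \<Omega>" for \<rho> x
    proof -
      let ?p = "\<lambda>y. eta \<rho> (x - y)"
      note t = eta_test_fun[OF \<rho>]
      note [measurable] = test_fun_measurable[OF t]
      have i1: "integrable lborel (\<lambda>y. (g y \<bullet> i) * ?p y)" "integrable lborel (\<lambda>y. (h y \<bullet> i) * ?p y)"
        using moll_integrand_integrable[OF \<rho>(1), of "\<lambda>y. g y \<bullet> i" x] moll_integrand_integrable[OF \<rho>(1), of "\<lambda>y. h y \<bullet> i" x] ig ih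
        by (simp_all add: mult.commute)
      have "moll \<rho> ?f x = (LINT y|lborel. (g y \<bullet> i) * ?p y) - (LINT y|lborel. (h y \<bullet> i) * ?p y)"
        using i1 by (simp add: moll_def inner_diff_left right_diff_distrib mult.commute)
      also have "(LINT y|lborel. u y * dir_deriv i ?p y) = (LINT y|lborel. v y * dir_deriv i ?p y)"
      proof (rule integral_cong_AE)
        show "AE x in lborel. u x * dir_deriv i ?p x = v x * dir_deriv i ?p x" using ae by eventually_elim simp
      qed measurable
      then have "(LINT y|lborel. (g y \<bullet> i) * ?p y) = (LINT y|lborel. (h y \<bullet> i) * ?p y)"
        using sobD(7)[OF s(1) t i] sobD(7)[OF s(2) t i] by simp
      finally show ?thesis by simp
    qed
    show ?thesis using r(3)
    proof eventually_elim
      case (elim x)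
      show ?case
      proof (cases "x \<in> \<Omega>")
        case True
        then have "eventually (\<lambda>n. \<forall>x\<in>{x}. cball x (r n) \<subseteq> \<Omega>) sequentially"
          by (intro eventually_cball_subset r(2) o) auto
        then have "eventually (\<lambda>n. moll (r n) ?f x = 0) sequentially"
          by eventually_elim (use zero r(1) in auto)
        then have "(\<lambda>n. moll (r n) ?f x) \<longlonglongrightarrow> 0" by (rule tendsto_eventually)
        then show ?thesis using elim LIMSEQ_unique by blast
      next
        case False
        then show ?thesis using sobD(4)[OF s(1)] sobD(4)[OF s(2)] by simp
      qed
    qed
  qed
  then have "AE x in lborel. \<forall>i\<in>Basis. (g x - h x) \<bullet> i = 0" by (intro AE_finite_allI) auto
  then show ?thesis by eventually_elim (metis euclidean_eqI inner_diff_left right_minus_eq)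
qed

text \<open>The gradient selected by \<open>weak_grad\<close> may differ from \<open>h\<close>, and
  \<open>v\<close> may fail to be Borel; uniqueness almost everywhere reduces both integrals to
  those of the representative.\<close>

lemma rayleigh_eq:
  assumes o: "open \<Omega>" and b: "bounded \<Omega>" and s: "sob \<Omega> u g"
    and v: "L2_on \<Omega> v" "has_weak_grad \<Omega> v h" "AE x in lebesgue_on \<Omega>. v x = u x"
  shows "rayleigh a \<Omega> v = ennreal (LINT x|lborel. (norm (g x))\<^sup>2) / (\<integral>\<^sup>+x. ennreal ((u x)\<^sup>2 * hardy_weight a x) \<partial>lborel)"
proof -
  have \<Omega>: "\<Omega> \<in> sets borel" using o by simp
  have "has_weak_grad \<Omega> v (weak_grad \<Omega> v)"
    unfolding weak_grad_def by (rule someI[of "has_weak_grad \<Omega> v", OF v(2)])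
  from weak_grad_imp_sob[OF o v(1) this] obtain u' g' where u': "sob \<Omega> u' g'" "AE x in lebesgue_on \<Omega>. v x = u' x"
    "AE x in lebesgue_on \<Omega>. weak_grad \<Omega> v x = g' x" by blast
  note [measurable] = sobD(1,2)[OF s] sobD(1,2)[OF u'(1)]
  have "AE x in lebesgue_on \<Omega>. u' x = u x" using v(3) u'(2) by eventually_elim simp
  then have "AE x in lborel. u' x = u x"
    by (subst (asm) AE_lebesgue_on_iff_lborel[OF \<Omega>]) (use sobD(3)[OF s] sobD(3)[OF u'(1)] in \<open>auto\<close>)
  from sob_unique[OF o b u'(1) s this] have g: "AE x in lborel. g' x = g x" .
  have "(\<integral>\<^sup>+x. ennreal ((norm (weak_grad \<Omega> v x))\<^sup>2) \<partial>lebesgue_on \<Omega>) = (\<integral>\<^sup>+x. ennreal ((norm (g' x))\<^sup>2) \<partial>lborel)"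
  proof (rule nn_integral_lebesgue_on_Borel[OF \<Omega>])
    show "AE x in lebesgue_on \<Omega>. ennreal ((norm (weak_grad \<Omega> v x))\<^sup>2) = ennreal ((norm (g' x))\<^sup>2)"
      using u'(3) by eventually_elim simp
  qed (use sobD(4)[OF u'(1)] in simp)
  also have "\<dots> = (\<integral>\<^sup>+x. ennreal ((norm (g x))\<^sup>2) \<partial>lborel)"
    using g by (intro nn_integral_cong_AE) (auto elim: eventually_mono)
  also have "\<dots> = ennreal (LINT x|lborel. (norm (g x))\<^sup>2)"
    by (rule nn_integral_eq_integral[OF sobD(6)[OF s]]) auto
  finally have 1: "(\<integral>\<^sup>+x. ennreal ((norm (weak_grad \<Omega> v x))\<^sup>2) \<partial>lebesgue_on \<Omega>) = ennreal (LINT x|lborel. (norm (g x))\<^sup>2)" .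
  have 2: "(\<integral>\<^sup>+x. ennreal (\<bar>v x\<bar>\<^sup>2 * hardy_weight a x) \<partial>lebesgue_on \<Omega>) = (\<integral>\<^sup>+x. ennreal ((u x)\<^sup>2 * hardy_weight a x) \<partial>lborel)"
  proof (rule nn_integral_lebesgue_on_Borel[OF \<Omega>])
    show "AE x in lebesgue_on \<Omega>. ennreal (\<bar>v x\<bar>\<^sup>2 * hardy_weight a x) = ennreal ((u x)\<^sup>2 * hardy_weight a x)"
      using v(3) by eventually_elim simp
  qed (use sobD(3)[OF s] in simp)
  show ?thesis unfolding rayleigh_def 1 2 ..
qed

lemma admissible_imp_sob:
  assumes o: "open \<Omega>" and b: "bounded \<Omega>" and v: "v \<in> admissible a \<Omega>"
  obtains u g where "sob \<Omega> u g" "\<not> (AE x in lborel. u x = 0)"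
    "integrable lborel (\<lambda>x. u x * hardy_weight a x)" "(LINT x|lborel. u x * hardy_weight a x) = 0"
    "rayleigh a \<Omega> v = ennreal (LINT x|lborel. (norm (g x))\<^sup>2) / (\<integral>\<^sup>+x. ennreal ((u x)\<^sup>2 * hardy_weight a x) \<partial>lborel)"
proof -
  have \<Omega>: "\<Omega> \<in> sets borel" using o by simp
  obtain h where h: "L2_on \<Omega> v" "has_weak_grad \<Omega> v h" using v by (auto simp: admissible_def H1_def)
  have nz: "\<not> (AE x in lebesgue_on \<Omega>. v x = 0)"
    and hb: "has_bochner_integral (lebesgue_on \<Omega>) (\<lambda>x. v x * hardy_weight a x) 0" using v by (auto simp: admissible_def)
  obtain u g where u: "sob \<Omega> u g" "AE x in lebesgue_on \<Omega>. v x = u x" "AE x in lebesgue_on \<Omega>. h x = g x"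
    using weak_grad_imp_sob[OF o h] by blast
  note [measurable] = sobD(1,2)[OF u(1)]
  have vm: "v \<in> borel_measurable (lebesgue_on \<Omega>)" using h by (simp add: L2_on_def)
  have ae: "AE x in lebesgue_on \<Omega>. v x * hardy_weight a x = u x * hardy_weight a x" using u(2) by eventually_elim simp
  have m: "(\<lambda>x. v x * hardy_weight a x) \<in> borel_measurable (lebesgue_on \<Omega>)" using hb by (auto simp: has_bochner_integral_iff)
  note L = lebesgue_on_Borel[OF \<Omega> _ m _ ae]
  have z: "x \<notin> \<Omega> \<Longrightarrow> u x * hardy_weight a x = 0" for x using sobD(3)[OF u(1)] by simp
  show ?thesis
  proof (rule that[OF u(1)])
    show "\<not> (AE x in lborel. u x = 0)"
    proof
      assume "AE x in lborel. u x = 0"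
      then have "AE x in lebesgue_on \<Omega>. u x = 0"
        by (subst AE_lebesgue_on_iff_lborel[OF \<Omega>]) (use sobD(3)[OF u(1)] in auto)
      then have "AE x in lebesgue_on \<Omega>. v x = 0" using u(2) by eventually_elim simp
      then show False using nz by simp
    qed
    show "integrable lborel (\<lambda>x. u x * hardy_weight a x)"
      using hb L(1) z by (auto simp: has_bochner_integral_iff)
    show "(LINT x|lborel. u x * hardy_weight a x) = 0"
      using hb L(2) z by (auto simp: has_bochner_integral_iff)
    show "rayleigh a \<Omega> v = ennreal (LINT x|lborel. (norm (g x))\<^sup>2) / (\<integral>\<^sup>+x. ennreal ((u x)\<^sup>2 * hardy_weight a x) \<partial>lborel)"
      by (rule rayleigh_eq[OF o b u(1) h u(2)])
  qed
qed

lemma sob_imp_admissible: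
  assumes o: "open \<Omega>" and b: "bounded \<Omega>" and s: "sob \<Omega> u g" and nz: "\<not> (AE x in lborel. u x = 0)"
    and w: "integrable lborel (\<lambda>x. u x * hardy_weight a x)" "(LINT x|lborel. u x * hardy_weight a x) = 0"
  shows "u \<in> admissible a \<Omega>"
    "rayleigh a \<Omega> u = ennreal (LINT x|lborel. (norm (g x))\<^sup>2) / (\<integral>\<^sup>+x. ennreal ((u x)\<^sup>2 * hardy_weight a x) \<partial>lborel)"
proof -
  have \<Omega>: "\<Omega> \<in> sets borel" using o by simp
  note [measurable] = sobD(1,2)[OF s]
  note wg = sob_imp_weak_grad[OF o s]
  have z: "x \<notin> \<Omega> \<Longrightarrow> u x * hardy_weight a x = 0" for x using sobD(3)[OF s] by simp
  have m: "(\<lambda>x. u x * hardy_weight a x) \<in> borel_measurable (lebesgue_on \<Omega>)"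
    by (rule measurable_restrict_space1[OF measurable_completion]) simp
  note L = lebesgue_on_Borel[OF \<Omega> _ m z AE_I2[of _ "\<lambda>x. u x * hardy_weight a x = u x * hardy_weight a x", OF refl]]
  show "u \<in> admissible a \<Omega>"
    unfolding admissible_def H1_def
  proof (intro CollectI conjI exI)
    show "L2_on \<Omega> u" "has_weak_grad \<Omega> u g" by (rule wg)+
    show "\<not> (AE x in lebesgue_on \<Omega>. u x = 0)"
      using nz by (subst AE_lebesgue_on_iff_lborel[OF \<Omega>]) (use sobD(3)[OF s] in auto)
    show "has_bochner_integral (lebesgue_on \<Omega>) (\<lambda>x. u x * hardy_weight a x) 0"
      using w L by (auto simp: has_bochner_integral_iff)
  qed
  show "rayleigh a \<Omega> u = ennreal (LINT x|lborel. (norm (g x))\<^sup>2) / (\<integral>\<^sup>+x. ennreal ((u x)\<^sup>2 * hardy_weight a x) \<partial>lborel)"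
    by (rule rayleigh_eq[OF o b s wg]) simp
qed

text \<open>On a bounded set all functions involved are integrable, which justifies splitting the
  integrals: a Bochner integral is 0 by default when its integrand is not integrable.\<close>

lemma sob_lincomb:
  assumes b: "bounded \<Omega>" and s: "sob \<Omega> u g" "sob \<Omega> v h"
  shows "sob \<Omega> (\<lambda>x. c * u x + d * v x) (\<lambda>x. c *\<^sub>R g x + d *\<^sub>R h x)"
proof -
  note [measurable] = sobD(1,2)[OF s(1)] sobD(1,2)[OF s(2)]
  note I = sob_integrable[OF s(1) b] sob_integrable[OF s(2) b]
  have sq: "(norm (c *\<^sub>R x + d *\<^sub>R y))\<^sup>2 \<le> 2 * (c\<^sup>2 * (norm x)\<^sup>2) + 2 * (d\<^sup>2 * (norm y)\<^sup>2)" for x y :: "'z::real_normed_vector"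
  proof -
    have "norm (c *\<^sub>R x + d *\<^sub>R y) \<le> \<bar>c\<bar> * norm x + \<bar>d\<bar> * norm y"
      using norm_triangle_ineq[of "c *\<^sub>R x" "d *\<^sub>R y"] by simp
    then have "(norm (c *\<^sub>R x + d *\<^sub>R y))\<^sup>2 \<le> (\<bar>c\<bar> * norm x + \<bar>d\<bar> * norm y)\<^sup>2" by (rule power_mono) simp
    also have "\<dots> \<le> 2 * (\<bar>c\<bar> * norm x)\<^sup>2 + 2 * (\<bar>d\<bar> * norm y)\<^sup>2"
      using zero_le_power2[of "\<bar>c\<bar> * norm x - \<bar>d\<bar> * norm y"] unfolding power2_sum power2_diff by linarith
    finally show ?thesis by (simp add: power_mult_distrib)
  qed
  show ?thesis
    unfolding sob_def
  proof (intro conjI allI impI ballI)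
    show "integrable lborel (\<lambda>x. (c * u x + d * v x)\<^sup>2)"
    proof (rule Bochner_Integration.integrable_bound)
      show "integrable lborel (\<lambda>x. 2 * (c\<^sup>2 * (u x)\<^sup>2) + 2 * (d\<^sup>2 * (v x)\<^sup>2))"
        using sobD(5)[OF s(1)] sobD(5)[OF s(2)] by simp
      show "AE x in lborel. norm ((c * u x + d * v x)\<^sup>2) \<le> norm (2 * (c\<^sup>2 * (u x)\<^sup>2) + 2 * (d\<^sup>2 * (v x)\<^sup>2))"
        using sq[of "u _" "v _"] by (intro always_eventually allI) simp
    qed measurable
    show "integrable lborel (\<lambda>x. (norm (c *\<^sub>R g x + d *\<^sub>R h x))\<^sup>2)"
    proof (rule Bochner_Integration.integrable_bound)
      show "integrable lborel (\<lambda>x. 2 * (c\<^sup>2 * (norm (g x))\<^sup>2) + 2 * (d\<^sup>2 * (norm (h x))\<^sup>2))"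
        using sobD(6)[OF s(1)] sobD(6)[OF s(2)] by simp
      show "AE x in lborel. norm ((norm (c *\<^sub>R g x + d *\<^sub>R h x))\<^sup>2) \<le> norm (2 * (c\<^sup>2 * (norm (g x))\<^sup>2) + 2 * (d\<^sup>2 * (norm (h x))\<^sup>2))"
        using sq[of "g _" "h _"] by (intro always_eventually allI) simp
    qed measurable
    fix \<phi> :: "'a \<Rightarrow> real" and i :: 'a assume t: "test_fun \<Omega> \<phi>" and i: "i \<in> Basis"
    note [measurable] = test_fun_measurable[OF t]
    obtain B B' where B: "\<And>x. \<bar>\<phi> x\<bar> \<le> B" "\<And>x. \<bar>dir_deriv i \<phi> x\<bar> \<le> B'"
      using test_fun_continuous(3,4)[OF t] by metis
    have iu: "integrable lborel (\<lambda>x. f x * dir_deriv i \<phi> x)" if "integrable lborel f" for f :: "'a \<Rightarrow> real"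
      using integrable_bounded_scaleR[OF that, of "dir_deriv i \<phi>" B'] B(2) by (simp add: mult.commute)
    have ig: "integrable lborel (\<lambda>x. (f x \<bullet> i) * \<phi> x)" if "integrable lborel f" for f :: "'a \<Rightarrow> 'a"
      using integrable_bounded_scaleR[of lborel "\<lambda>x. f x \<bullet> i" \<phi> B] that B(1) by (simp add: mult.commute)
    have "(LINT x|lborel. (c * u x + d * v x) * dir_deriv i \<phi> x) =
      c * (LINT x|lborel. u x * dir_deriv i \<phi> x) + d * (LINT x|lborel. v x * dir_deriv i \<phi> x)"
      using iu[OF I(1)] iu[OF I(3)] by (simp add: distrib_right mult.assoc)
    also have "\<dots> = - (c * (LINT x|lborel. (g x \<bullet> i) * \<phi> x) + d * (LINT x|lborel. (h x \<bullet> i) * \<phi> x))"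
      using sobD(7)[OF s(1) t i] sobD(7)[OF s(2) t i] by simp
    also have "\<dots> = - (LINT x|lborel. ((c *\<^sub>R g x + d *\<^sub>R h x) \<bullet> i) * \<phi> x)"
      using ig[OF I(2)] ig[OF I(4)] by (simp add: inner_add_left distrib_right mult.assoc)
    finally show "(LINT x|lborel. (c * u x + d * v x) * dir_deriv i \<phi> x) = - (LINT x|lborel. ((c *\<^sub>R g x + d *\<^sub>R h x) \<bullet> i) * \<phi> x)" .
  qed (use sobD(3,4)[OF s(1)] sobD(3,4)[OF s(2)] in simp_all)
qed

section \<open>Completeness and minimizing sequences\<close>

text \<open>Young's inequality \<open>2 * p * q \<le> t * p\<^sup>2 + q\<^sup>2 / t\<close> with a
  free parameter. Letting the difference tend to 0 and then \<open>t\<close> compares squared norms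
  in the limit, in place of the triangle inequality in \<open>L\<^sup>2\<close>.\<close>

lemma square_add_le:
  fixes f h :: "'a \<Rightarrow> 'b::euclidean_space"
  assumes "integrable M (\<lambda>x. (norm (f x))\<^sup>2)" "integrable M (\<lambda>x. (norm (h x))\<^sup>2)" "integrable M (\<lambda>x. (norm (f x - h x))\<^sup>2)"
    and t: "t > 0"
  shows "(LINT x|M. (norm (f x))\<^sup>2) \<le> (1 + t) * (LINT x|M. (norm (h x))\<^sup>2) + (1 + 1 / t) * (LINT x|M. (norm (f x - h x))\<^sup>2)"
proof -
  have "(LINT x|M. (norm (f x))\<^sup>2) \<le> (LINT x|M. (1 + t) * (norm (h x))\<^sup>2 + (1 + 1 / t) * (norm (f x - h x))\<^sup>2)"
  proof (rule integral_mono)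
    fix x
    let ?p = "norm (h x)" and ?q = "norm (f x - h x)"
    have "norm (f x) \<le> ?p + ?q" using norm_triangle_ineq[of "h x" "f x - h x"] by simp
    then have "(norm (f x))\<^sup>2 \<le> (?p + ?q)\<^sup>2" by (rule power_mono) simp
    also have "\<dots> \<le> (1 + t) * ?p\<^sup>2 + (1 + 1 / t) * ?q\<^sup>2"
    proof -
      have "0 \<le> (t * ?p - ?q)\<^sup>2 / t" using t by simp
      also have "\<dots> = t * ?p\<^sup>2 - 2 * ?p * ?q + ?q\<^sup>2 / t" using t by (simp add: power2_eq_square field_simps)
      finally show ?thesis by (simp add: power2_eq_square algebra_simps)
    qed
    finally show "(norm (f x))\<^sup>2 \<le> (1 + t) * ?p\<^sup>2 + (1 + 1 / t) * ?q\<^sup>2" .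
  qed (use assms in auto)
  also have "\<dots> = (1 + t) * (LINT x|M. (norm (h x))\<^sup>2) + (1 + 1 / t) * (LINT x|M. (norm (f x - h x))\<^sup>2)"
    using assms by simp
  finally show ?thesis .
qed

lemma integrable_square_diff:
  fixes f h :: "'a \<Rightarrow> 'b::euclidean_space"
  assumes [measurable]: "f \<in> borel_measurable M" "h \<in> borel_measurable M"
    and "integrable M (\<lambda>x. (norm (f x))\<^sup>2)" "integrable M (\<lambda>x. (norm (h x))\<^sup>2)"
  shows "integrable M (\<lambda>x. (norm (f x - h x))\<^sup>2)"
proof (rule Bochner_Integration.integrable_bound)
  show "integrable M (\<lambda>x. 2 * (norm (f x))\<^sup>2 + 2 * (norm (h x))\<^sup>2)" using assms by simp
  show "AE x in M. norm ((norm (f x - h x))\<^sup>2) \<le> norm (2 * (norm (f x))\<^sup>2 + 2 * (norm (h x))\<^sup>2)"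
  proof (intro always_eventually allI)
    fix x
    have "(norm (f x - h x))\<^sup>2 \<le> (norm (f x) + norm (h x))\<^sup>2" by (intro power_mono norm_triangle_ineq4) simp
    also have "\<dots> \<le> 2 * (norm (f x))\<^sup>2 + 2 * (norm (h x))\<^sup>2"
      using zero_le_power2[of "norm (f x) - norm (h x)"] unfolding power2_sum power2_diff by linarith
    finally show "norm ((norm (f x - h x))\<^sup>2) \<le> norm (2 * (norm (f x))\<^sup>2 + 2 * (norm (h x))\<^sup>2)" by simp
  qed
qed measurable

lemma L1_norm_square_le:
  fixes f :: "'a::euclidean_space \<Rightarrow> 'b::euclidean_space"
  assumes "\<Omega> \<subseteq> ball 0 R" "\<And>x. x \<notin> \<Omega> \<Longrightarrow> f x = 0" "f \<in> borel_measurable borel" "integrable lborel (\<lambda>x. (norm (f x))\<^sup>2)"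
  shows "(LINT x|lborel. norm (f x))\<^sup>2 \<le> measure lborel (ball (0::'a) R) * (LINT x|lborel. (norm (f x))\<^sup>2)"
proof -
  have "integrable lborel f"
    by (rule integrable_of_square[of \<Omega>]) (use assms in \<open>auto intro: bounded_subset\<close>)
  then show ?thesis
    using L1_square_le[OF assms(1), of "\<lambda>x. norm (f x)", OF _ _ _ refl] assms by simp
qed

text \<open>The thresholds of the successive tolerances become indices; the maximum with the
  previous index and the successor make the sequence strictly increasing.\<close>

lemma fast_subsequence:
  fixes D :: "nat \<Rightarrow> nat \<Rightarrow> real" and e :: "nat \<Rightarrow> real"
  assumes "\<And>e. e > 0 \<Longrightarrow> \<exists>N. \<forall>m\<ge>N. \<forall>n\<ge>N. D m n < e" "\<And>k. e k > 0"
  obtains t :: "nat \<Rightarrow> nat" where "strict_mono t" "\<And>k. D (t (Suc k)) (t k) < e k"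
proof -
  have "\<forall>k. \<exists>N. \<forall>m\<ge>N. \<forall>n\<ge>N. D m n < e k" using assms by blast
  from choice[OF this] obtain N where "\<forall>k. \<forall>m\<ge>N k. \<forall>n\<ge>N k. D m n < e k" ..
  then have N: "D m n < e k" if "N k \<le> m" "N k \<le> n" for k m n using that by blast
  define t where "t = rec_nat (N 0) (\<lambda>k r. Suc (max r (N (Suc k))))"
  have t: "t 0 = N 0" "\<And>k. t (Suc k) = Suc (max (t k) (N (Suc k)))" by (simp_all add: t_def)
  have ge: "N k \<le> t k" for k by (cases k) (auto simp: t)
  have "strict_mono t" by (rule strict_mono_Suc_iff[THEN iffD2]) (auto simp: t)
  moreover have "D (t (Suc k)) (t k) < e k" for k
    using ge[of k] by (intro N) (auto simp: t)
  ultimately show ?thesis using that by blast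
qed

text \<open>Riesz-Fischer: consecutive differences along a fast subsequence have summable
  \<open>L\<^sup>1\<close> norms, so the subsequence converges almost everywhere; Fatou's lemma
  upgrades this to \<open>L\<^sup>2\<close> convergence of the whole sequence.\<close>

lemma L2_complete:
  fixes f :: "nat \<Rightarrow> 'a::euclidean_space \<Rightarrow> 'b::euclidean_space"
  assumes b: "bounded \<Omega>" and m [measurable]: "\<And>n. f n \<in> borel_measurable borel"
    and z: "\<And>n x. x \<notin> \<Omega> \<Longrightarrow> f n x = 0" and i: "\<And>n. integrable lborel (\<lambda>x. (norm (f n x))\<^sup>2)"
    and C: "\<And>e. e > 0 \<Longrightarrow> \<exists>N. \<forall>m\<ge>N. \<forall>n\<ge>N. (LINT x|lborel. (norm (f m x - f n x))\<^sup>2) < e"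
  obtains h where "h \<in> borel_measurable borel" "\<And>x. x \<notin> \<Omega> \<Longrightarrow> h x = 0" "integrable lborel (\<lambda>x. (norm (h x))\<^sup>2)"
    "(\<lambda>n. LINT x|lborel. (norm (f n x - h x))\<^sup>2) \<longlonglongrightarrow> 0"
proof -
  obtain R where R: "\<Omega> \<subseteq> ball 0 R" using b bounded_subset_ballD by blast
  define V where "V = measure lborel (ball (0::'a) R)"
  have V0: "V \<ge> 0" by (simp add: V_def)
  \<comment> \<open>The tolerance \<open>(1/4) ^ k\<close> for squared norms gives the summable
    \<open>(1/2) ^ k\<close> for norms.\<close>
  obtain t where t: "strict_mono t"
    "\<And>k. (LINT x|lborel. (norm (f (t (Suc k)) x - f (t k) x))\<^sup>2) < (1/4)^k"
    using fast_subsequence[of "\<lambda>m n. LINT x|lborel. (norm (f m x - f n x))\<^sup>2" "\<lambda>k. (1/4)^k"] C by auto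
  define d where "d k x = f (t (Suc k)) x - f (t k) x" for k x
  have dm [measurable]: "d k \<in> borel_measurable borel" for k unfolding d_def by measurable
  have dz: "x \<notin> \<Omega> \<Longrightarrow> d k x = 0" for k x using z by (simp add: d_def)
  have d2: "integrable lborel (\<lambda>x. (norm (d k x))\<^sup>2)" for k
    unfolding d_def by (rule integrable_square_diff) (use i in auto)
  have d1: "integrable lborel (d k)" for k by (rule integrable_of_square[OF b dm dz d2])
  have dn: "(LINT x|lborel. norm (d k x)) \<le> sqrt V * (1/2)^k" for k
  proof -
    have "(LINT x|lborel. norm (d k x))\<^sup>2 \<le> V * (LINT x|lborel. (norm (d k x))\<^sup>2)"
      unfolding V_def by (rule L1_norm_square_le[OF R dz dm d2])
    also have "\<dots> \<le> V * (1/4)^k" using t(2)[of k] V0 by (intro mult_left_mono) (auto simp: d_def)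
    also have "\<dots> = (sqrt V * (1/2)^k)\<^sup>2"
    proof -
      have "((1/2::real)^k)\<^sup>2 = ((1/2)\<^sup>2)^k" by (simp only: power_mult[symmetric] mult.commute)
      then have "((1/2::real)^k)\<^sup>2 = (1/4)^k" by (simp add: power2_eq_square)
      then show ?thesis using V0 by (simp add: power_mult_distrib)
    qed
    finally show ?thesis by (rule power2_le_imp_le) (simp add: V0)
  qed
  have "summable (\<lambda>k. sqrt V * (1/2::real)^k)" by (intro summable_mult summable_geometric) simp
  then have sum: "summable (\<lambda>k. LINT x|lborel. norm (d k x))"
    by (rule summable_comparison_test[rotated]) (use dn in \<open>auto intro!: Bochner_Integration.integral_nonneg\<close>)
  have "AE x in lborel. summable (\<lambda>k. norm (d k x))"
  proof -
    have "(\<integral>\<^sup>+x. (\<Sum>k. ennreal (norm (d k x))) \<partial>lborel) = (\<Sum>k. \<integral>\<^sup>+x. ennreal (norm (d k x)) \<partial>lborel)"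
      by (rule nn_integral_suminf) measurable
    also have "\<dots> = (\<Sum>k. ennreal (LINT x|lborel. norm (d k x)))"
      using d1 by (intro suminf_cong nn_integral_eq_integral) auto
    also have "\<dots> < top" using sum by (subst suminf_ennreal2) (auto intro!: Bochner_Integration.integral_nonneg)
    finally have "(\<integral>\<^sup>+x. (\<Sum>k. ennreal (norm (d k x))) \<partial>lborel) \<noteq> \<infinity>" by auto
    then have "AE x in lborel. (\<Sum>k. ennreal (norm (d k x))) \<noteq> \<infinity>"
      by (rule nn_integral_PInf_AE[rotated]) measurable
    then show ?thesis
      by eventually_elim (auto intro!: summable_suminf_not_top)
  qed
  then have conv: "AE x in lborel. convergent (\<lambda>k. f (t k) x)"
  proof eventually_elim
    case (elim x)
    then have "summable (\<lambda>k. d k x)" by (rule summable_norm_cancel)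
    then have "convergent (\<lambda>n. \<Sum>k<n. d k x)" by (simp add: summable_iff_convergent)
    moreover have "(\<Sum>k<n. d k x) = f (t n) x - f (t 0) x" for n
      by (induction n) (auto simp: d_def)
    ultimately have "convergent (\<lambda>n. f (t n) x - f (t 0) x)" by simp
    from convergent_add[OF this convergent_const[of "f (t 0) x"]] show ?case by simp
  qed
  \<comment> \<open>The value 0 where the sequence is not Cauchy is a default that keeps
    \<open>h\<close> total and measurable.\<close>
  define h where "h x = (if Cauchy (\<lambda>k. f (t k) x) then lim (\<lambda>k. f (t k) x) else 0)" for x
  have hm [measurable]: "h \<in> borel_measurable borel" unfolding h_def by measurable
  have hz: "x \<notin> \<Omega> \<Longrightarrow> h x = 0" for x using z by (simp add: h_def lim_const)
  have ae: "AE x in lborel. (\<lambda>k. f (t k) x) \<longlonglongrightarrow> h x"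
    using conv by eventually_elim (simp add: h_def Cauchy_convergent_iff convergent_LIMSEQ_iff)
  \<comment> \<open>Fatou in the second index: a Cauchy bound on \<open>f n - f m\<close> survives
    as \<open>m\<close> runs through the subsequence.\<close>
  have F: "(\<integral>\<^sup>+x. ennreal ((norm (f n x - h x))\<^sup>2) \<partial>lborel) \<le> ennreal e"
    if e: "\<And>m. m \<ge> N \<Longrightarrow> (LINT x|lborel. (norm (f n x - f m x))\<^sup>2) \<le> e" for n N e
  proof -
    have "(\<integral>\<^sup>+x. ennreal ((norm (f n x - h x))\<^sup>2) \<partial>lborel) \<le> (\<integral>\<^sup>+x. liminf (\<lambda>k. ennreal ((norm (f n x - f (t k) x))\<^sup>2)) \<partial>lborel)"
    proof (rule nn_integral_mono_AE)
      show "AE x in lborel. ennreal ((norm (f n x - h x))\<^sup>2) \<le> liminf (\<lambda>k. ennreal ((norm (f n x - f (t k) x))\<^sup>2))"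
        using ae
      proof eventually_elim
        case (elim x)
        have "(\<lambda>k. ennreal ((norm (f n x - f (t k) x))\<^sup>2)) \<longlonglongrightarrow> ennreal ((norm (f n x - h x))\<^sup>2)"
          by (intro tendsto_intros elim)
        from lim_imp_Liminf[OF _ this] show ?case by simp
      qed
    qed
    also have "\<dots> \<le> liminf (\<lambda>k. \<integral>\<^sup>+x. ennreal ((norm (f n x - f (t k) x))\<^sup>2) \<partial>lborel)"
      by (rule nn_integral_liminf) measurable
    also have "\<dots> \<le> liminf (\<lambda>k::nat. ennreal e)"
    proof (rule Liminf_mono)
      show "eventually (\<lambda>k. (\<integral>\<^sup>+x. ennreal ((norm (f n x - f (t k) x))\<^sup>2) \<partial>lborel) \<le> ennreal e) sequentially"
        using eventually_ge_at_top[of N]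
      proof eventually_elim
        case (elim k)
        have "integrable lborel (\<lambda>x. (norm (f n x - f (t k) x))\<^sup>2)" by (rule integrable_square_diff) (use i in auto)
        then have "(\<integral>\<^sup>+x. ennreal ((norm (f n x - f (t k) x))\<^sup>2) \<partial>lborel) = ennreal (LINT x|lborel. (norm (f n x - f (t k) x))\<^sup>2)"
          by (rule nn_integral_eq_integral) auto
        also have "\<dots> \<le> ennreal e"
          using elim seq_suble[OF t(1), of k] by (intro ennreal_leI e) simp
        finally show ?case .
      qed
    qed
    also have "\<dots> = ennreal e" by (simp add: Liminf_const)
    finally show ?thesis .
  qed
  have main: "\<exists>N. \<forall>n\<ge>N. integrable lborel (\<lambda>x. (norm (f n x - h x))\<^sup>2) \<and> (LINT x|lborel. (norm (f n x - h x))\<^sup>2) \<le> e"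
    if e: "e > 0" for e
  proof -
    obtain N where N: "\<And>m n. m \<ge> N \<Longrightarrow> n \<ge> N \<Longrightarrow> (LINT x|lborel. (norm (f m x - f n x))\<^sup>2) < e"
      using C[OF e] by blast
    have "integrable lborel (\<lambda>x. (norm (f n x - h x))\<^sup>2) \<and> (LINT x|lborel. (norm (f n x - h x))\<^sup>2) \<le> e" if n: "n \<ge> N" for n
    proof
      have le: "(\<integral>\<^sup>+x. ennreal ((norm (f n x - h x))\<^sup>2) \<partial>lborel) \<le> ennreal e"
        by (rule F[of N]) (use N n in \<open>auto intro: less_imp_le\<close>)
      show int: "integrable lborel (\<lambda>x. (norm (f n x - h x))\<^sup>2)"
        by (rule integrableI_bounded) (use le in \<open>auto intro: le_less_trans\<close>)
      have "ennreal (LINT x|lborel. (norm (f n x - h x))\<^sup>2) \<le> ennreal e"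
        using le nn_integral_eq_integral[OF int] by simp
      then show "(LINT x|lborel. (norm (f n x - h x))\<^sup>2) \<le> e" using e by (simp add: ennreal_le_iff)
    qed
    then show ?thesis by blast
  qed
  show ?thesis
  proof (rule that[OF hm hz])
    obtain n where n: "integrable lborel (\<lambda>x. (norm (f n x - h x))\<^sup>2)" using main[of 1] by auto
    \<comment> \<open>The limit is written as \<open>f n - (f n - h)\<close>, a difference of two
      square integrable functions.\<close>
    have "integrable lborel (\<lambda>x. (norm (f n x - (f n x - h x)))\<^sup>2)"
      by (rule integrable_square_diff) (use i n in auto)
    then show "integrable lborel (\<lambda>x. (norm (h x))\<^sup>2)" by simp
    show "(\<lambda>n. LINT x|lborel. (norm (f n x - h x))\<^sup>2) \<longlonglongrightarrow> 0"
    proof (rule LIMSEQ_I)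
      fix e :: real assume e: "e > 0"
      then obtain N where N: "\<And>n. n \<ge> N \<Longrightarrow> (LINT x|lborel. (norm (f n x - h x))\<^sup>2) \<le> e / 2"
        using main[of "e / 2"] by auto
      show "\<exists>no. \<forall>n\<ge>no. norm ((LINT x|lborel. (norm (f n x - h x))\<^sup>2) - 0) < e"
      proof (intro exI[of _ N] allI impI)
        fix n assume "n \<ge> N"
        have "0 \<le> (LINT x|lborel. (norm (f n x - h x))\<^sup>2)" by (intro Bochner_Integration.integral_nonneg) auto
        then show "norm ((LINT x|lborel. (norm (f n x - h x))\<^sup>2) - 0) < e" using N[OF \<open>n \<ge> N\<close>] e by simp
      qed
    qed
  qed
qed

lemma sob_diff:
  assumes "bounded \<Omega>" "sob \<Omega> u g" "sob \<Omega> v h"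
  shows "sob \<Omega> (\<lambda>x. u x - v x) (\<lambda>x. g x - h x)"
  using sob_lincomb[OF assms, of 1 "-1"] by simp

text \<open>On a bounded set \<open>L\<^sup>2\<close> convergence implies \<open>L\<^sup>1\<close>
  convergence, and test functions and their derivatives are bounded, so both sides of the defining
  identity pass to the limit.\<close>

lemma sob_limit:
  assumes b: "bounded \<Omega>" and s: "\<And>n. sob \<Omega> (u n) (g n)"
    and v: "v \<in> borel_measurable borel" "\<And>x. x \<notin> \<Omega> \<Longrightarrow> v x = 0" "integrable lborel (\<lambda>x. (v x)\<^sup>2)"
      "(\<lambda>n. LINT x|lborel. (u n x - v x)\<^sup>2) \<longlonglongrightarrow> 0"
    and h: "h \<in> borel_measurable borel" "\<And>x. x \<notin> \<Omega> \<Longrightarrow> h x = 0" "integrable lborel (\<lambda>x. (norm (h x))\<^sup>2)"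
      "(\<lambda>n. LINT x|lborel. (norm (g n x - h x))\<^sup>2) \<longlonglongrightarrow> 0"
  shows "sob \<Omega> v h"
proof -
  obtain R where R: "\<Omega> \<subseteq> ball 0 R" using b bounded_subset_ballD by blast
  define V where "V = measure lborel (ball (0::'a) R)"
  note [measurable] = v(1) h(1) sobD(1,2)[OF s]
  have conv: "(\<lambda>n. LINT x|lborel. f n x * \<phi> x) \<longlonglongrightarrow> (LINT x|lborel. k x * \<phi> x)"
    if fm [measurable]: "\<And>n. f n \<in> borel_measurable borel" "k \<in> borel_measurable borel"
      and fz: "\<And>n x. x \<notin> \<Omega> \<Longrightarrow> f n x = 0" "\<And>x. x \<notin> \<Omega> \<Longrightarrow> k x = 0"
      and f2: "\<And>n. integrable lborel (\<lambda>x. (f n x)\<^sup>2)" "integrable lborel (\<lambda>x. (k x)\<^sup>2)"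
      and lim: "(\<lambda>n. LINT x|lborel. (f n x - k x)\<^sup>2) \<longlonglongrightarrow> 0"
      and \<phi> [measurable]: "\<phi> \<in> borel_measurable borel" and B: "\<And>x. \<bar>\<phi> x\<bar> \<le> B"
    for f :: "nat \<Rightarrow> 'a \<Rightarrow> real" and k \<phi> B
  proof -
    have B0: "B \<ge> 0" using B[of 0] by linarith
    have d2: "integrable lborel (\<lambda>x. (f n x - k x)\<^sup>2)" for n
      using integrable_square_diff[of "f n" lborel k] f2 by simp
    have fi: "integrable lborel (f n)" for n
      using integrable_of_square[OF b fm(1)[of n] fz(1)[of _ n]] f2(1)[of n] by simp
    have ki: "integrable lborel k" using integrable_of_square[OF b fm(2) fz(2)] f2(2) by simp
    have p: "integrable lborel (\<lambda>x. q x * \<phi> x)" if "integrable lborel q" for q :: "'a \<Rightarrow> real"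
      using integrable_bounded_scaleR[OF that, of \<phi> B] B by (simp add: mult.commute)
    have "\<bar>(LINT x|lborel. f n x * \<phi> x) - (LINT x|lborel. k x * \<phi> x)\<bar> \<le> B * sqrt (V * (LINT x|lborel. (f n x - k x)\<^sup>2))" for n
    proof -
      have "\<bar>(LINT x|lborel. f n x * \<phi> x) - (LINT x|lborel. k x * \<phi> x)\<bar> = \<bar>LINT x|lborel. (f n x - k x) * \<phi> x\<bar>"
        using p[OF fi] p[OF ki] by (simp add: left_diff_distrib)
      also have "\<dots> \<le> (LINT x|lborel. \<bar>(f n x - k x) * \<phi> x\<bar>)" by (rule integral_abs_bound)
      also have "\<dots> \<le> (LINT x|lborel. B * \<bar>f n x - k x\<bar>)"
      proof (rule integral_mono)
        show "integrable lborel (\<lambda>x. \<bar>(f n x - k x) * \<phi> x\<bar>)" using p[of "\<lambda>x. f n x - k x"] fi ki by simp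
        show "integrable lborel (\<lambda>x. B * \<bar>f n x - k x\<bar>)" using fi ki by simp
        show "\<bar>(f n x - k x) * \<phi> x\<bar> \<le> B * \<bar>f n x - k x\<bar>" for x
          using mult_right_mono[OF B[of x], of "\<bar>f n x - k x\<bar>"] by (simp add: abs_mult mult.commute)
      qed
      also have "\<dots> = B * (LINT x|lborel. \<bar>f n x - k x\<bar>)" by simp
      also have "\<dots> \<le> B * sqrt (V * (LINT x|lborel. (f n x - k x)\<^sup>2))"
      proof (intro mult_left_mono B0 real_le_rsqrt)
        show "(LINT x|lborel. \<bar>f n x - k x\<bar>)\<^sup>2 \<le> V * (LINT x|lborel. (f n x - k x)\<^sup>2)"
          using L1_norm_square_le[OF R, of "\<lambda>x. f n x - k x"] fz d2[of n] by (simp add: V_def)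
      qed
      finally show ?thesis .
    qed
    moreover have "(\<lambda>n. B * sqrt (V * (LINT x|lborel. (f n x - k x)\<^sup>2))) \<longlonglongrightarrow> B * sqrt (V * 0)"
      by (intro tendsto_intros lim)
    then have "(\<lambda>n. B * sqrt (V * (LINT x|lborel. (f n x - k x)\<^sup>2))) \<longlonglongrightarrow> 0" by simp
    ultimately have "(\<lambda>n. (LINT x|lborel. f n x * \<phi> x) - (LINT x|lborel. k x * \<phi> x)) \<longlonglongrightarrow> 0"
      unfolding real_norm_def[symmetric] by (rule Lim_null_comparison[OF always_eventually[OF allI]])
    then show ?thesis by (rule LIM_zero_cancel)
  qed
  show ?thesis
    unfolding sob_def
  proof (intro conjI allI impI ballI)
    fix \<phi> :: "'a \<Rightarrow> real" and i :: 'a assume t: "test_fun \<Omega> \<phi>" and i: "i \<in> Basis"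
    note [measurable] = test_fun_measurable[OF t]
    obtain B B' where B: "\<And>x. \<bar>\<phi> x\<bar> \<le> B" "\<And>x. \<bar>dir_deriv i \<phi> x\<bar> \<le> B'"
      using test_fun_continuous(3,4)[OF t] by metis
    have 1: "(\<lambda>n. LINT x|lborel. u n x * dir_deriv i \<phi> x) \<longlonglongrightarrow> (LINT x|lborel. v x * dir_deriv i \<phi> x)"
      by (rule conv[OF _ _ _ _ _ _ v(4) _ B(2)]) (use v sobD[OF s] in auto)
    have sq: "(y \<bullet> i)\<^sup>2 \<le> (norm y)\<^sup>2" for y :: 'a
      using Basis_le_norm[OF i, of y] by (simp add: abs_le_square_iff[symmetric])
    have gi: "integrable lborel (\<lambda>x. (q x \<bullet> i)\<^sup>2)"
      if "integrable lborel (\<lambda>x. (norm (q x))\<^sup>2)" and [measurable]: "q \<in> borel_measurable borel" for q :: "'a \<Rightarrow> 'a"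
      by (rule Bochner_Integration.integrable_bound[OF that(1)]) (use sq in auto)
    have 2: "(\<lambda>n. LINT x|lborel. (g n x \<bullet> i) * \<phi> x) \<longlonglongrightarrow> (LINT x|lborel. (h x \<bullet> i) * \<phi> x)"
    proof (rule conv[OF _ _ _ _ _ _ _ _ B(1)])
      show "(\<lambda>n. LINT x|lborel. (g n x \<bullet> i - h x \<bullet> i)\<^sup>2) \<longlonglongrightarrow> 0"
      proof (rule Lim_null_comparison[OF _ h(4)])
        have "(LINT x|lborel. (g n x \<bullet> i - h x \<bullet> i)\<^sup>2) \<le> (LINT x|lborel. (norm (g n x - h x))\<^sup>2)" for n
        proof (rule integral_mono)
          have I: "integrable lborel (\<lambda>x. (norm (g n x - h x))\<^sup>2)"
            by (rule integrable_square_diff) (use h sobD(6)[OF s] in auto)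
          then show "integrable lborel (\<lambda>x. (norm (g n x - h x))\<^sup>2)" .
          show "integrable lborel (\<lambda>x. (g n x \<bullet> i - h x \<bullet> i)\<^sup>2)" using gi[OF I] by (simp add: inner_diff_left)
          show "(g n x \<bullet> i - h x \<bullet> i)\<^sup>2 \<le> (norm (g n x - h x))\<^sup>2" for x
            using sq[of "g n x - h x"] by (simp add: inner_diff_left)
        qed
        then show "eventually (\<lambda>n. norm (LINT x|lborel. (g n x \<bullet> i - h x \<bullet> i)\<^sup>2) \<le> (LINT x|lborel. (norm (g n x - h x))\<^sup>2)) sequentially"
          by (intro always_eventually allI) simp
      qed
    qed (use h sobD[OF s] gi in auto)
    have "(\<lambda>n. LINT x|lborel. u n x * dir_deriv i \<phi> x) \<longlonglongrightarrow> - (LINT x|lborel. (h x \<bullet> i) * \<phi> x)"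
      unfolding sobD(7)[OF s t i] by (rule tendsto_minus[OF 2])
    from LIMSEQ_unique[OF 1 this]
    show "(LINT x|lborel. v x * dir_deriv i \<phi> x) = - (LINT x|lborel. (h x \<bullet> i) * \<phi> x)" .
  qed (use v h in auto)
qed

text \<open>For each tolerance \<open>1 / real (Suc k)\<close> compactness supplies finitely many
  functionals, countably many in all. Along a diagonal subsequence all of them converge, and the
  quantitative bound applied to differences gives the Cauchy property.\<close>

lemma sob_bounded_subsequence:
  fixes \<Omega> :: "'a::euclidean_space set"
  assumes b: "bounded \<Omega>" and pc: "precompact_on \<Omega> \<Omega>" and s: "\<And>n. sob \<Omega> (u n) (g n)"
    and M: "\<And>n. (LINT x|lborel. (u n x)\<^sup>2) \<le> M" "\<And>n. (LINT x|lborel. (norm (g n x))\<^sup>2) \<le> M"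
  obtains t :: "nat \<Rightarrow> nat" where "strict_mono t"
    "\<And>e. e > 0 \<Longrightarrow> \<exists>N. \<forall>m\<ge>N. \<forall>n\<ge>N. (LINT x|lborel. (u (t m) x - u (t n) x)\<^sup>2) < e"
proof -
  obtain R where R: "\<Omega> \<subseteq> ball 0 R" using b bounded_subset_ballD by blast
  define V where "V = measure lborel (ball (0::'a) R)"
  have V0: "V \<ge> 0" by (simp add: V_def)
  have M0: "M \<ge> 0" using M(1)[of 0] sob_integral_nonneg(1)[of "u 0"] by linarith
  note [measurable] = sobD(1,2)[OF s]
  have "\<exists>\<Phi> C. functional_bound \<Omega> \<Omega> (1 / real (Suc k)) \<Phi> C" for k
    using pc unfolding precompact_on_def by simp
  then obtain \<Phi> C where \<Phi>: "\<And>k. functional_bound \<Omega> \<Omega> (1 / real (Suc k)) (\<Phi> k) (C k)" by metis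
  \<comment> \<open>The zero function makes \<open>F\<close> nonempty, as
    \<open>from_nat_into\<close> requires.\<close>
  define F where "F = insert (\<lambda>_. 0) (\<Union>k. \<Phi> k)"
  have cF: "countable F" unfolding F_def
    using functional_boundD(1)[OF \<Phi>] by (intro countable_insert countable_UN) (auto intro: countable_finite)
  define \<phi> where "\<phi> = from_nat_into F"
  have \<phi>F: "\<phi> k \<in> F" for k unfolding \<phi>_def by (rule from_nat_into) (simp add: F_def)
  have F: "f \<in> borel_measurable borel \<and> bounded (range f)" if "f \<in> F" for f
    using that functional_boundD(3)[OF \<Phi>] by (auto simp: F_def)
  note iu = sob_integrable(1)[OF s b]
  have Fi: "integrable lborel (\<lambda>x. u n x * f x)" if f: "f \<in> F" for f n
  proof -
    obtain B where "\<And>x. \<bar>f x\<bar> \<le> B" using F[OF f] by (auto simp: bounded_iff)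
    then show ?thesis using integrable_bounded_scaleR[OF iu[of n], of f B] F[OF f] by (simp add: mult.commute)
  qed
  have Fb: "bounded (range (\<lambda>n. LINT x|lborel. u n x * f x))" if f: "f \<in> F" for f
  proof -
    obtain B where B: "\<And>x. \<bar>f x\<bar> \<le> B" using F[OF f] by (auto simp: bounded_iff)
    have B0: "B \<ge> 0" using B[of 0] by linarith
    have "\<bar>LINT x|lborel. u n x * f x\<bar> \<le> B * sqrt (V * M)" for n
    proof -
      have "\<bar>LINT x|lborel. u n x * f x\<bar> \<le> (LINT x|lborel. \<bar>u n x * f x\<bar>)" by (rule integral_abs_bound)
      also have "\<dots> \<le> (LINT x|lborel. B * \<bar>u n x\<bar>)"
      proof (rule integral_mono)
        show "integrable lborel (\<lambda>x. \<bar>u n x * f x\<bar>)" using Fi[OF f] by simp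
        show "integrable lborel (\<lambda>x. B * \<bar>u n x\<bar>)" using iu by simp
        show "\<bar>u n x * f x\<bar> \<le> B * \<bar>u n x\<bar>" for x
          using mult_right_mono[OF B[of x], of "\<bar>u n x\<bar>"] by (simp add: abs_mult mult.commute)
      qed
      also have "\<dots> = B * (LINT x|lborel. \<bar>u n x\<bar>)" by simp
      also have "\<dots> \<le> B * sqrt (V * M)"
      proof (intro mult_left_mono B0 real_le_rsqrt)
        have "(LINT x|lborel. \<bar>u n x\<bar>)\<^sup>2 \<le> V * (LINT x|lborel. (u n x)\<^sup>2)"
          by (rule L1_square_le[OF R sobD(3)[OF s] iu sobD(5)[OF s] V_def])
        also have "\<dots> \<le> V * M" by (intro mult_left_mono M V0)
        finally show "(LINT x|lborel. \<bar>u n x\<bar>)\<^sup>2 \<le> V * M" .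
      qed
      finally show ?thesis .
    qed
    then show ?thesis by (auto simp: bounded_iff)
  qed
  interpret subseqs "\<lambda>k t. convergent (\<lambda>j. LINT x|lborel. u (t j) x * \<phi> k x)"
  proof
    fix k and t :: "nat \<Rightarrow> nat"
    have "bounded (range (\<lambda>j. LINT x|lborel. u (t j) x * \<phi> k x))"
      by (rule bounded_subset[OF Fb[OF \<phi>F[of k]]]) auto
    then obtain l r where "strict_mono r" "((\<lambda>j. LINT x|lborel. u (t j) x * \<phi> k x) \<circ> r) \<longlonglongrightarrow> l"
      using bounded_imp_convergent_subsequence by blast
    then show "\<exists>r'. strict_mono r' \<and> convergent (\<lambda>j. LINT x|lborel. u ((t \<circ> r') j) x * \<phi> k x)"
      by (auto simp: o_def convergent_def)
  qed
  let ?t = diagseq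
  have cv: "convergent (\<lambda>j. LINT x|lborel. u (?t j) x * \<phi> k x)" for k
  proof -
    have "convergent (\<lambda>j. LINT x|lborel. u ((?t \<circ> (+) (Suc k)) j) x * \<phi> k x)"
    proof (rule diagseq_holds)
      fix r :: "nat \<Rightarrow> nat" and t n
      assume "strict_mono r" "convergent (\<lambda>j. LINT x|lborel. u (t j) x * \<phi> n x)"
      from convergent_subseq_convergent[OF this(2,1)]
      show "convergent (\<lambda>j. LINT x|lborel. u ((t \<circ> r) j) x * \<phi> n x)" by (simp add: o_def)
    qed
    then have "convergent (\<lambda>j. LINT x|lborel. u (?t (j + Suc k)) x * \<phi> k x)" by (simp add: o_def add.commute)
    then show ?thesis by (subst (asm) convergent_ignore_initial_segment)
  qed
  have cvF: "Cauchy (\<lambda>j. LINT x|lborel. u (?t j) x * f x)" if f: "f \<in> F" for f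
  proof -
    obtain k where "f = \<phi> k" using from_nat_into_surj[OF cF f] unfolding \<phi>_def by metis
    then show ?thesis using cv by (simp add: Cauchy_convergent_iff)
  qed
  show ?thesis
  proof (rule that[OF subseq_diagseq])
    fix e :: real assume e: "e > 0"
    obtain k :: nat where k: "16 * M / e < real k" using reals_Archimedean2 by blast
    \<comment> \<open>Square integral and energy of a difference are each at most
      \<open>4 * M\<close>, whence \<open>8 * M\<close>.\<close>
    have k2: "1 / real (Suc k) * (8 * M) < e / 2"
      using k e by (simp add: field_simps)
    let ?S = "\<lambda>m n. \<Sum>f\<in>\<Phi> k. ((LINT x|lborel. u (?t m) x * f x) - (LINT x|lborel. u (?t n) x * f x))\<^sup>2"
    \<comment> \<open>The added 1 keeps \<open>c\<close> positive even if \<open>C k\<close> is 0 or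
      there are no functionals; \<open>\<rho>\<close> is then chosen with
      \<open>c * \<rho>\<^sup>2 = e / 2\<close>.\<close>
    define c where "c = C k * real (card (\<Phi> k)) + 1"
    have c: "c > 0" using functional_boundD(2)[OF \<Phi>, of k] by (simp add: c_def add_nonneg_pos)
    define \<rho> where "\<rho> = sqrt (e / (2 * c))"
    have \<rho>: "\<rho> > 0" "\<rho>\<^sup>2 = e / (2 * c)" using e c by (auto simp: \<rho>_def)
    have fin: "finite (\<Phi> k)" by (rule functional_boundD(1)[OF \<Phi>])
    have "\<forall>f\<in>\<Phi> k. \<exists>N. \<forall>m\<ge>N. \<forall>n\<ge>N. \<bar>(LINT x|lborel. u (?t m) x * f x) - (LINT x|lborel. u (?t n) x * f x)\<bar> < \<rho>"
    proof
      fix f assume "f \<in> \<Phi> k"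
      then have "f \<in> F" by (auto simp: F_def)
      from CauchyD[OF cvF[OF this] \<rho>(1)]
      show "\<exists>N. \<forall>m\<ge>N. \<forall>n\<ge>N. \<bar>(LINT x|lborel. u (?t m) x * f x) - (LINT x|lborel. u (?t n) x * f x)\<bar> < \<rho>" by simp
    qed
    from bchoice[OF this] obtain N where "\<forall>f\<in>\<Phi> k. \<forall>m\<ge>N f. \<forall>n\<ge>N f.
      \<bar>(LINT x|lborel. u (?t m) x * f x) - (LINT x|lborel. u (?t n) x * f x)\<bar> < \<rho>" ..
    then have N: "\<bar>(LINT x|lborel. u (?t m) x * f x) - (LINT x|lborel. u (?t n) x * f x)\<bar> < \<rho>"
      if "f \<in> \<Phi> k" "m \<ge> N f" "n \<ge> N f" for f m n using that by blast
    define N' where "N' = (\<Sum>f\<in>\<Phi> k. N f)"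
    have N': "N f \<le> N'" if "f \<in> \<Phi> k" for f unfolding N'_def by (rule member_le_sum) (use that fin in auto)
    show "\<exists>N. \<forall>m\<ge>N. \<forall>n\<ge>N. (LINT x|lborel. (u (?t m) x - u (?t n) x)\<^sup>2) < e"
    proof (intro exI[of _ N'] allI impI)
      fix m n assume mn: "N' \<le> m" "N' \<le> n"
      let ?d = "\<lambda>x. u (?t m) x - u (?t n) x" and ?gd = "\<lambda>x. g (?t m) x - g (?t n) x"
      have sd: "sob \<Omega> ?d ?gd" by (rule sob_diff[OF b s s])
      have quad: "(LINT x|lborel. (norm (p x - q x))\<^sup>2) \<le> 4 * M"
        if "p \<in> borel_measurable borel" "q \<in> borel_measurable borel"
           "integrable lborel (\<lambda>x. (norm (p x))\<^sup>2)" "integrable lborel (\<lambda>x. (norm (q x))\<^sup>2)"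
           "(LINT x|lborel. (norm (p x))\<^sup>2) \<le> M" "(LINT x|lborel. (norm (q x))\<^sup>2) \<le> M"
        for p q :: "'a \<Rightarrow> 'c::euclidean_space"
      proof -
        have "integrable lborel (\<lambda>x. (norm (p x - q x))\<^sup>2)" by (rule integrable_square_diff) (use that in auto)
        from square_add_le[OF this that(3), of 1] that(4-6) 
        show ?thesis by (simp add: norm_minus_commute)
      qed
      have D1: "(LINT x|lborel. (?d x)\<^sup>2) \<le> 4 * M"
        using quad[of "u (?t m)" "u (?t n)"] sobD[OF s] M by simp
      have D2: "(LINT x|lborel. (norm (?gd x))\<^sup>2) \<le> 4 * M"
        by (rule quad) (use sobD[OF s] M in auto)
      have S: "(\<Sum>f\<in>\<Phi> k. (LINT x|lborel. ?d x * f x)\<^sup>2) \<le> real (card (\<Phi> k)) * \<rho>\<^sup>2"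
      proof (rule sum_bounded_above)
        fix f assume f: "f \<in> \<Phi> k"
        then have fF: "f \<in> F" by (auto simp: F_def)
        have "(LINT x|lborel. ?d x * f x) = (LINT x|lborel. u (?t m) x * f x) - (LINT x|lborel. u (?t n) x * f x)"
          using Fi[OF fF] by (simp add: left_diff_distrib)
        moreover have "\<bar>(LINT x|lborel. u (?t m) x * f x) - (LINT x|lborel. u (?t n) x * f x)\<bar> \<le> \<bar>\<rho>\<bar>"
          using N[OF f] N'[OF f] mn by (intro order_trans[OF less_imp_le abs_ge_self]) auto
        ultimately show "(LINT x|lborel. ?d x * f x)\<^sup>2 \<le> \<rho>\<^sup>2" by (simp add: abs_le_square_iff)
      qed
      have "ennreal (LINT x|lborel. (?d x)\<^sup>2) = (\<integral>\<^sup>+x. ennreal ((?d x)\<^sup>2) \<partial>lborel)"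
        using sobD(5)[OF sd] by (subst nn_integral_eq_integral) auto
      also have "\<dots> = (\<integral>\<^sup>+x. ennreal ((?d x)\<^sup>2) * indicator \<Omega> x \<partial>lborel)"
        using sobD(3)[OF sd] by (intro nn_integral_cong) (auto simp: indicator_def)
      also have "\<dots> \<le> ennreal (1 / real (Suc k) * ((LINT x|lborel. (?d x)\<^sup>2) + (LINT x|lborel. (norm (?gd x))\<^sup>2)) +
          C k * (\<Sum>f\<in>\<Phi> k. (LINT x|lborel. ?d x * f x)\<^sup>2))"
        by (rule functional_boundD(4)[OF \<Phi> sd])
      also have "\<dots> \<le> ennreal (1 / real (Suc k) * (8 * M) + C k * (real (card (\<Phi> k)) * \<rho>\<^sup>2))"
        using D1 D2 functional_boundD(2)[OF \<Phi>, of k]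
        by (intro ennreal_leI add_mono mult_left_mono S) auto
      finally have "(LINT x|lborel. (?d x)\<^sup>2) \<le> 1 / real (Suc k) * (8 * M) + C k * (real (card (\<Phi> k)) * \<rho>\<^sup>2)"
        using functional_boundD(2)[OF \<Phi>, of k] M0
        by (subst (asm) ennreal_le_iff) (auto intro!: add_nonneg_nonneg mult_nonneg_nonneg)
      also have "C k * (real (card (\<Phi> k)) * \<rho>\<^sup>2) \<le> c * \<rho>\<^sup>2"
        by (simp add: c_def distrib_right)
      also have "c * \<rho>\<^sup>2 = e / 2" using c by (simp add: \<rho>(2))
      finally show "(LINT x|lborel. (?d x)\<^sup>2) < e" using k2 by linarith
    qed
  qed
qed

section \<open>Existence of a minimizer\<close>

locale hardy_problem =
  fixes \<Omega> :: "(real^2) set" and a :: real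
  assumes dom: "smooth_bounded_domain \<Omega>" and origin: "0 \<in> closure \<Omega>"
    and unit: "\<And>x. x \<in> \<Omega> \<Longrightarrow> norm x \<le> 1" and a: "a > 1"
begin

lemma open_domain: "open \<Omega>" and bounded_domain: "bounded \<Omega>"
  using dom by (auto simp: smooth_bounded_domain_def)

lemma weighted_integrable:
  assumes s: "sob \<Omega> u g"
  shows "integrable lborel (\<lambda>x. (u x)\<^sup>2 * hardy_weight a x)"
proof (rule integrableI_bounded)
  note [measurable] = sobD(1)[OF s]
  show "(\<lambda>x. (u x)\<^sup>2 * hardy_weight a x) \<in> borel_measurable lborel" by measurable
  obtain C where "\<And>u g. sob \<Omega> u g \<Longrightarrow> (\<integral>\<^sup>+x. ennreal ((u x)\<^sup>2 * hardy_weight a x) \<partial>lborel) \<le>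
      ennreal ((4 + 1) * (LINT x|lborel. (norm (g x))\<^sup>2) + C * (LINT x|lborel. (u x)\<^sup>2))"
    by (rule hardy_domain[OF dom origin a zero_less_one], erule unit, rule that, blast)
  from this[OF s] show "(\<integral>\<^sup>+x. ennreal (norm ((u x)\<^sup>2 * hardy_weight a x)) \<partial>lborel) < \<infinity>"
    by (auto simp: hardy_weight_nonneg intro: le_less_trans)
qed

lemma nn_weighted:
  assumes s: "sob \<Omega> u g"
  shows "(\<integral>\<^sup>+x. ennreal ((u x)\<^sup>2 * hardy_weight a x) \<partial>lborel) = ennreal (LINT x|lborel. (u x)\<^sup>2 * hardy_weight a x)"
  by (rule nn_integral_eq_integral[OF weighted_integrable[OF s]]) (simp add: hardy_weight_nonneg)

lemma hardy_real:
  assumes \<epsilon>: "\<epsilon> > 0"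
  obtains C where "C \<ge> 0" "\<And>u g. sob \<Omega> u g \<Longrightarrow> (LINT x|lborel. (u x)\<^sup>2 * hardy_weight a x) \<le>
      (4 + \<epsilon>) * (LINT x|lborel. (norm (g x))\<^sup>2) + C * (LINT x|lborel. (u x)\<^sup>2)"
proof -
  obtain C where C: "C \<ge> 0" "\<And>u g. sob \<Omega> u g \<Longrightarrow> (\<integral>\<^sup>+x. ennreal ((u x)\<^sup>2 * hardy_weight a x) \<partial>lborel) \<le>
      ennreal ((4 + \<epsilon>) * (LINT x|lborel. (norm (g x))\<^sup>2) + C * (LINT x|lborel. (u x)\<^sup>2))"
    by (rule hardy_domain[OF dom origin a \<epsilon>], erule unit, rule that, assumption, blast)
  show ?thesis
  proof (rule that[OF C(1)])
    fix u g assume s: "sob \<Omega> u g"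
    have "0 \<le> (4 + \<epsilon>) * (LINT x|lborel. (norm (g x))\<^sup>2) + C * (LINT x|lborel. (u x)\<^sup>2)"
      using \<epsilon> C(1) by (intro add_nonneg_nonneg mult_nonneg_nonneg sob_integral_nonneg) auto
    then show "(LINT x|lborel. (u x)\<^sup>2 * hardy_weight a x) \<le>
      (4 + \<epsilon>) * (LINT x|lborel. (norm (g x))\<^sup>2) + C * (LINT x|lborel. (u x)\<^sup>2)"
      using C(2)[OF s] unfolding nn_weighted[OF s] by (simp add: ennreal_le_iff)
  qed
qed

lemma weight_integrable: "integrable lborel (\<lambda>x. indicator \<Omega> x * hardy_weight a x)"
proof (rule integrableI_bounded)
  have [measurable]: "\<Omega> \<in> sets borel" using open_domain by simp
  show "(\<lambda>x. indicator \<Omega> x * hardy_weight a x) \<in> borel_measurable lborel" by measurable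
  have "(\<integral>\<^sup>+x. ennreal (norm (indicator \<Omega> x * hardy_weight a x)) \<partial>lborel) =
    (\<integral>\<^sup>+x. ennreal (hardy_weight a x) * indicator \<Omega> x \<partial>lborel)"
    by (intro nn_integral_cong) (auto simp: indicator_def hardy_weight_nonneg)
  also have "\<dots> < \<infinity>" by (rule hardy_domain[OF dom origin a zero_less_one unit])
  finally show "(\<integral>\<^sup>+x. ennreal (norm (indicator \<Omega> x * hardy_weight a x)) \<partial>lborel) < \<infinity>" .
qed

text \<open>Young's inequality with a free parameter. As the weight has finite mass, this makes the
  constraint functional well defined and continuous in the weighted norm.\<close>

lemma abs_weighted_le:
  assumes s: "sob \<Omega> u g" and t: "t > 0"
  shows "\<bar>u x * hardy_weight a x\<bar> \<le> t * (indicator \<Omega> x * hardy_weight a x) + (1 / t) * ((u x)\<^sup>2 * hardy_weight a x)"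
proof (cases "x \<in> \<Omega>")
  case True
  have "0 \<le> (\<bar>u x\<bar> - t)\<^sup>2 / t" using t by simp
  also have "\<dots> = (u x)\<^sup>2 / t + t - 2 * \<bar>u x\<bar>" using t by (simp add: power2_eq_square field_simps)
  finally have "2 * \<bar>u x\<bar> \<le> (u x)\<^sup>2 / t + t" by simp
  then have "\<bar>u x\<bar> \<le> t + (1 / t) * (u x)\<^sup>2" by simp
  from mult_right_mono[OF this hardy_weight_nonneg[of a x]] show ?thesis
    using True by (simp add: abs_mult hardy_weight_nonneg distrib_right)
next
  case False
  then show ?thesis using sobD(3)[OF s] by simp
qed

lemma linear_integrable:
  assumes s: "sob \<Omega> u g"
  shows "integrable lborel (\<lambda>x. u x * hardy_weight a x)"
proof (rule Bochner_Integration.integrable_bound)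
  note [measurable] = sobD(1)[OF s]
  show "(\<lambda>x. u x * hardy_weight a x) \<in> borel_measurable lborel" by measurable
  show "integrable lborel (\<lambda>x. 1 * (indicator \<Omega> x * hardy_weight a x) + (1 / 1) * ((u x)\<^sup>2 * hardy_weight a x))"
    using weight_integrable weighted_integrable[OF s] by simp
  show "AE x in lborel. norm (u x * hardy_weight a x) \<le>
      norm (1 * (indicator \<Omega> x * hardy_weight a x) + (1 / 1) * ((u x)\<^sup>2 * hardy_weight a x))"
  proof (intro always_eventually allI)
    fix x
    show "norm (u x * hardy_weight a x) \<le> norm (1 * (indicator \<Omega> x * hardy_weight a x) + (1 / 1) * ((u x)\<^sup>2 * hardy_weight a x))"
      using order_trans[OF abs_weighted_le[OF s zero_less_one, of x] abs_ge_self] unfolding real_norm_def .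
  qed
qed

text \<open>From \<open>ln y \<le> y\<close> at \<open>y = a / norm x\<close> follows
  \<open>norm x * ln (a / norm x) \<le> a\<close>. The origin is excluded because division by zero
  makes the weight 0 there.\<close>

lemma hardy_weight_ge:
  assumes "x \<in> \<Omega>" "x \<noteq> 0"
  shows "1 \<le> a\<^sup>2 * hardy_weight a x"
proof -
  let ?n = "norm x"
  have n: "?n > 0" "?n \<le> 1" using assms unit by auto
  have "1 < a / ?n" using n a by (simp add: pos_less_divide_eq)
  then have l: "ln (a / ?n) > 0" by simp
  have "ln (a / ?n) \<le> a / ?n" using n a by (intro ln_bound) simp
  then have "?n * ln (a / ?n) \<le> a" using n by (simp add: pos_le_divide_eq mult.commute)
  then have "(?n * ln (a / ?n))\<^sup>2 \<le> a\<^sup>2" using n l by (intro power_mono) auto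
  moreover have "0 < (?n * ln (a / ?n))\<^sup>2" using n l by (intro zero_less_power mult_pos_pos)
  ultimately show ?thesis unfolding hardy_weight_def by (simp add: power_mult_distrib pos_le_divide_eq)
qed

text \<open>The weight is bounded below off the origin, a null set. Normalizing the weighted
  integral thereby bounds the minimizing sequence in \<open>L\<^sup>2\<close>.\<close>

lemma L2_le_weighted:
  assumes s: "sob \<Omega> u g"
  shows "(LINT x|lborel. (u x)\<^sup>2) \<le> a\<^sup>2 * (LINT x|lborel. (u x)\<^sup>2 * hardy_weight a x)"
proof -
  have "AE x in lborel. x \<noteq> (0::real^2)" by (rule AE_lborel_singleton)
  then have "(LINT x|lborel. (u x)\<^sup>2) \<le> (LINT x|lborel. a\<^sup>2 * ((u x)\<^sup>2 * hardy_weight a x))"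
  proof (intro integral_mono_AE)
    assume ae: "AE x in lborel. x \<noteq> (0::real^2)"
    show "AE x in lborel. (u x)\<^sup>2 \<le> a\<^sup>2 * ((u x)\<^sup>2 * hardy_weight a x)"
      using ae
    proof eventually_elim
      case (elim x)
      show ?case
      proof (cases "x \<in> \<Omega>")
        case True
        from mult_left_mono[OF hardy_weight_ge[OF this elim], of "(u x)\<^sup>2"] show ?thesis by (simp add: mult_ac)
      next
        case False
        then show ?thesis using sobD(3)[OF s] by simp
      qed
    qed
  qed (use sobD(5)[OF s] weighted_integrable[OF s] in auto)
  then show ?thesis by simp
qed

lemma weighted_nonneg: "0 \<le> (LINT x|lborel. (u x)\<^sup>2 * hardy_weight a x)"
  by (intro Bochner_Integration.integral_nonneg) (auto simp: hardy_weight_nonneg)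

lemma weighted_pos:
  assumes s: "sob \<Omega> u g" and nz: "\<not> (AE x in lborel. u x = 0)"
  shows "0 < (LINT x|lborel. (u x)\<^sup>2 * hardy_weight a x)"
proof (rule ccontr)
  assume "\<not> 0 < (LINT x|lborel. (u x)\<^sup>2 * hardy_weight a x)"
  then have "(LINT x|lborel. (u x)\<^sup>2 * hardy_weight a x) = 0" using weighted_nonneg[of u] by linarith
  then have "(LINT x|lborel. (u x)\<^sup>2) = 0" using L2_le_weighted[OF s] sob_integral_nonneg(1)[of u] by simp
  then have "AE x in lborel. (u x)\<^sup>2 = 0" using integral_nonneg_eq_0_iff_AE[OF sobD(5)[OF s]] by simp
  then show False using nz by simp
qed

text \<open>The infimum as a quadratic inequality on the whole linear constraint space. Functions
  vanishing almost everywhere are not admissible and are treated apart, so that sums of members of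
  the minimizing sequence are covered in any case.\<close>

lemma hardy_lambda_le:
  assumes s: "sob \<Omega> u g" and W: "(LINT x|lborel. u x * hardy_weight a x) = 0"
    and lam: "hardy_lambda a \<Omega> = ennreal \<mu>" "\<mu> \<ge> 0"
  shows "\<mu> * (LINT x|lborel. (u x)\<^sup>2 * hardy_weight a x) \<le> (LINT x|lborel. (norm (g x))\<^sup>2)"
proof (cases "AE x in lborel. u x = 0")
  case True
  note [measurable] = sobD(1)[OF s]
  have "(LINT x|lborel. (u x)\<^sup>2 * hardy_weight a x) = (LINT x|(lborel :: (real^2) measure). 0)"
    by (rule integral_cong_AE) (use True in \<open>auto elim: eventually_mono\<close>)
  then show ?thesis using sob_integral_nonneg(2)[of g] by simp
next
  case False
  let ?N = "LINT x|lborel. (u x)\<^sup>2 * hardy_weight a x" and ?E = "LINT x|lborel. (norm (g x))\<^sup>2"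
  have N: "?N > 0" by (rule weighted_pos[OF s False])
  note ad = sob_imp_admissible[OF open_domain bounded_domain s False linear_integrable[OF s] W]
  have "ennreal \<mu> \<le> rayleigh a \<Omega> u"
    unfolding lam(1)[symmetric] hardy_lambda_def by (rule INF_lower[OF ad(1)])
  also have "\<dots> = ennreal (?E / ?N)"
    unfolding ad(2) nn_weighted[OF s] using N by (intro divide_ennreal sob_integral_nonneg)
  finally have "\<mu> \<le> ?E / ?N" using N sob_integral_nonneg(2)[of g] by (subst (asm) ennreal_le_iff) auto
  then show ?thesis using N by (simp add: pos_le_divide_eq)
qed

lemma minimizing_sequence:
  assumes lam: "hardy_lambda a \<Omega> = ennreal \<mu>" "\<mu> \<ge> 0" and e: "e > 0"
  shows "\<exists>u g. sob \<Omega> u g \<and> (LINT x|lborel. u x * hardy_weight a x) = 0 \<and>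
    (LINT x|lborel. (u x)\<^sup>2 * hardy_weight a x) = 1 \<and> (LINT x|lborel. (norm (g x))\<^sup>2) \<le> \<mu> + e"
proof -
  have "hardy_lambda a \<Omega> < ennreal (\<mu> + e)" using lam e by (simp add: ennreal_less_iff)
  then obtain v where v: "v \<in> admissible a \<Omega>" "rayleigh a \<Omega> v < ennreal (\<mu> + e)"
    unfolding hardy_lambda_def by (auto simp: INF_less_iff)
  obtain u g where u: "sob \<Omega> u g" "\<not> (AE x in lborel. u x = 0)" "(LINT x|lborel. u x * hardy_weight a x) = 0"
    "rayleigh a \<Omega> v = ennreal (LINT x|lborel. (norm (g x))\<^sup>2) / (\<integral>\<^sup>+x. ennreal ((u x)\<^sup>2 * hardy_weight a x) \<partial>lborel)"
    by (rule admissible_imp_sob[OF open_domain bounded_domain v(1)]) (rule that)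
  let ?N = "LINT x|lborel. (u x)\<^sup>2 * hardy_weight a x" and ?E = "LINT x|lborel. (norm (g x))\<^sup>2"
  have N: "?N > 0" by (rule weighted_pos[OF u(1,2)])
  have "ennreal (?E / ?N) < ennreal (\<mu> + e)"
    using v(2) N unfolding u(4) nn_weighted[OF u(1)] by (simp add: divide_ennreal sob_integral_nonneg)
  then have EN: "?E / ?N < \<mu> + e" using N sob_integral_nonneg(2)[of g] by (simp add: ennreal_less_iff)
  \<comment> \<open>Scaling by \<open>c\<close> normalizes the weighted integral; the constraint is
    homogeneous and the quotient does not change.\<close>
  define c where "c = 1 / sqrt ?N"
  have c: "c\<^sup>2 = 1 / ?N" using N by (simp add: c_def power_divide)
  show ?thesis
  proof (intro exI conjI)
    show "sob \<Omega> (\<lambda>x. c * u x + 0 * u x) (\<lambda>x. c *\<^sub>R g x + 0 *\<^sub>R g x)" by (rule sob_lincomb[OF bounded_domain u(1) u(1)])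
    show "(LINT x|lborel. (c * u x + 0 * u x) * hardy_weight a x) = 0" using u(3) by (simp add: mult.assoc)
    have "(LINT x|lborel. (c * u x + 0 * u x)\<^sup>2 * hardy_weight a x) = (LINT x|lborel. c\<^sup>2 * ((u x)\<^sup>2 * hardy_weight a x))"
      by (simp add: power_mult_distrib mult.assoc)
    also have "\<dots> = c\<^sup>2 * ?N" by simp
    finally show "(LINT x|lborel. (c * u x + 0 * u x)\<^sup>2 * hardy_weight a x) = 1" using c N by simp
    have "(LINT x|lborel. (norm (c *\<^sub>R g x + 0 *\<^sub>R g x))\<^sup>2) = (LINT x|lborel. c\<^sup>2 * (norm (g x))\<^sup>2)"
      by (simp add: power_mult_distrib)
    also have "\<dots> = c\<^sup>2 * ?E" by simp
    finally show "(LINT x|lborel. (norm (c *\<^sub>R g x + 0 *\<^sub>R g x))\<^sup>2) \<le> \<mu> + e" using c EN by simp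
  qed
qed

lemma parallelogram_weighted:
  assumes s: "sob \<Omega> u g" "sob \<Omega> v h"
  shows "(LINT x|lborel. (u x - v x)\<^sup>2 * hardy_weight a x) + (LINT x|lborel. (u x + v x)\<^sup>2 * hardy_weight a x) =
      2 * (LINT x|lborel. (u x)\<^sup>2 * hardy_weight a x) + 2 * (LINT x|lborel. (v x)\<^sup>2 * hardy_weight a x)"
    and "(LINT x|lborel. (norm (g x - h x))\<^sup>2) + (LINT x|lborel. (norm (g x + h x))\<^sup>2) =
      2 * (LINT x|lborel. (norm (g x))\<^sup>2) + 2 * (LINT x|lborel. (norm (h x))\<^sup>2)"
proof -
  have sm: "sob \<Omega> (\<lambda>x. u x - v x) (\<lambda>x. g x - h x)" by (rule sob_diff[OF bounded_domain s])
  have sp: "sob \<Omega> (\<lambda>x. u x + v x) (\<lambda>x. g x + h x)" using sob_lincomb[OF bounded_domain s, of 1 1] by simp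
  have "(LINT x|lborel. (u x - v x)\<^sup>2 * hardy_weight a x) + (LINT x|lborel. (u x + v x)\<^sup>2 * hardy_weight a x) =
      (LINT x|lborel. (u x - v x)\<^sup>2 * hardy_weight a x + (u x + v x)\<^sup>2 * hardy_weight a x)"
    using weighted_integrable[OF sm] weighted_integrable[OF sp] by simp
  also have "\<dots> = (LINT x|lborel. 2 * ((u x)\<^sup>2 * hardy_weight a x) + 2 * ((v x)\<^sup>2 * hardy_weight a x))"
    by (intro Bochner_Integration.integral_cong refl) (simp add: power2_eq_square algebra_simps)
  also have "\<dots> = 2 * (LINT x|lborel. (u x)\<^sup>2 * hardy_weight a x) + 2 * (LINT x|lborel. (v x)\<^sup>2 * hardy_weight a x)"
    using weighted_integrable[OF s(1)] weighted_integrable[OF s(2)] by simp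
  finally show "(LINT x|lborel. (u x - v x)\<^sup>2 * hardy_weight a x) + (LINT x|lborel. (u x + v x)\<^sup>2 * hardy_weight a x) =
      2 * (LINT x|lborel. (u x)\<^sup>2 * hardy_weight a x) + 2 * (LINT x|lborel. (v x)\<^sup>2 * hardy_weight a x)" .
  have "(LINT x|lborel. (norm (g x - h x))\<^sup>2) + (LINT x|lborel. (norm (g x + h x))\<^sup>2) =
      (LINT x|lborel. (norm (g x - h x))\<^sup>2 + (norm (g x + h x))\<^sup>2)"
    using sobD(6)[OF sm] sobD(6)[OF sp] by simp
  also have "\<dots> = (LINT x|lborel. 2 * (norm (g x))\<^sup>2 + 2 * (norm (h x))\<^sup>2)"
    by (intro Bochner_Integration.integral_cong refl) (simp add: power2_norm_eq_inner inner_add inner_diff inner_commute)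
  also have "\<dots> = 2 * (LINT x|lborel. (norm (g x))\<^sup>2) + 2 * (LINT x|lborel. (norm (h x))\<^sup>2)"
    using sobD(6)[OF s(1)] sobD(6)[OF s(2)] by simp
  finally show "(LINT x|lborel. (norm (g x - h x))\<^sup>2) + (LINT x|lborel. (norm (g x + h x))\<^sup>2) =
      2 * (LINT x|lborel. (norm (g x))\<^sup>2) + 2 * (LINT x|lborel. (norm (h x))\<^sup>2)" .
qed

lemma minimizer_exists:
  assumes lt: "hardy_lambda a \<Omega> < ennreal (1/4)"
  shows "\<exists>u\<in>admissible a \<Omega>. rayleigh a \<Omega> u = hardy_lambda a \<Omega>"
proof -
  let ?w = "hardy_weight a"
  let ?N = "\<lambda>u :: real^2 \<Rightarrow> real. LINT x|lborel. (u x)\<^sup>2 * ?w x"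
  let ?E = "\<lambda>g :: real^2 \<Rightarrow> real^2. LINT x|lborel. (norm (g x))\<^sup>2"
  let ?S = "\<lambda>u :: real^2 \<Rightarrow> real. LINT x|lborel. (u x)\<^sup>2"
  let ?W = "\<lambda>u :: real^2 \<Rightarrow> real. LINT x|lborel. u x * ?w x"
  obtain \<mu> where lam: "hardy_lambda a \<Omega> = ennreal \<mu>" "\<mu> \<ge> 0"
    using lt by (cases "hardy_lambda a \<Omega>") auto
  have lam4: "\<mu> < 1/4" using lt lam by (simp add: ennreal_less_iff)
  define Q where "Q n u g \<longleftrightarrow> sob \<Omega> u g \<and> ?W u = 0 \<and> ?N u = 1 \<and> ?E g \<le> \<mu> + 1 / real (Suc n)" for n :: nat and u g
  have "\<exists>u g. Q n u g" for n
    unfolding Q_def by (rule minimizing_sequence[OF lam]) simp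
  then obtain u g where "\<And>n. Q n (u n) (g n)" by metis
  then have u: "\<And>n. sob \<Omega> (u n) (g n)" "\<And>n. ?W (u n) = 0" "\<And>n. ?N (u n) = 1"
    "\<And>n. ?E (g n) \<le> \<mu> + 1 / real (Suc n)" unfolding Q_def by blast+
  \<comment> \<open>With weighted integral 1 the square integral is at most
    \<open>a\<^sup>2\<close>, and the energy is at most \<open>\<mu> + 1\<close>; the subsequence
    lemma takes one bound for both.\<close>
  define M where "M = max (a\<^sup>2) (\<mu> + 1)"
  have bound: "?S (u n) \<le> M" "?E (g n) \<le> M" for n
  proof -
    show "?S (u n) \<le> M" using L2_le_weighted[OF u(1)[of n]] u(3)[of n] by (simp add: M_def)
    have "1 / real (Suc n) \<le> 1" by simp
    then have "?E (g n) \<le> \<mu> + 1" using u(4)[of n] by linarith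
    then show "?E (g n) \<le> M" by (simp add: M_def)
  qed
  obtain t :: "nat \<Rightarrow> nat" where t: "strict_mono t"
    "\<And>e. e > 0 \<Longrightarrow> \<exists>N. \<forall>m\<ge>N. \<forall>n\<ge>N. ?S (\<lambda>x. u (t m) x - u (t n) x) < e"
  proof (rule sob_bounded_subsequence[of \<Omega> u g M, OF bounded_domain precompact_on_domain[OF dom] u(1) bound])
    fix t :: "nat \<Rightarrow> nat"
    assume "strict_mono t" and "\<And>e. e > 0 \<Longrightarrow> \<exists>N. \<forall>m\<ge>N. \<forall>n\<ge>N. ?S (\<lambda>x. u (t m) x - u (t n) x) < e"
    then show thesis by (rule that)
  qed
  define v where "v n = u (t n)" for n
  define h where "h n = g (t n)" for n
  have s: "sob \<Omega> (v n) (h n)" for n unfolding v_def h_def by (rule u(1))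
  have v: "?W (v n) = 0" "?N (v n) = 1" for n unfolding v_def by (rule u)+
  have hE: "?E (h n) \<le> \<mu> + 1 / real (Suc n)" for n
  proof -
    have "1 / real (Suc (t n)) \<le> 1 / real (Suc n)" using seq_suble[OF t(1), of n] by (simp add: frac_le)
    then show ?thesis using u(4)[of "t n"] unfolding h_def by linarith
  qed
  \<comment> \<open>\<open>\<mu> < 1/4\<close> leaves room for some \<epsilon> with
    \<open>\<epsilon> * \<mu> < 1 - 4 * \<mu>\<close>; dividing by \<open>\<mu> + 1/4\<close>
    instead of \<mu> also covers \<open>\<mu> = 0\<close>.\<close>
  define \<epsilon> where "\<epsilon> = 1 / (\<mu> + 1/4) * (1 - 4 * \<mu>)"
  have \<epsilon>: "\<epsilon> > 0" "(4 + \<epsilon>) * \<mu> < 1"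
  proof -
    show "\<epsilon> > 0" using lam lam4 by (simp add: \<epsilon>_def)
    have "\<epsilon> * \<mu> = (1 - 4 * \<mu>) * (\<mu> / (\<mu> + 1/4))" by (simp add: \<epsilon>_def)
    also have "\<dots> < (1 - 4 * \<mu>) * 1" using lam lam4 by (intro mult_strict_left_mono) (auto simp: pos_divide_less_eq)
    finally show "(4 + \<epsilon>) * \<mu> < 1" by (simp add: distrib_right)
  qed
  obtain C where C: "C \<ge> 0" "\<And>u g. sob \<Omega> u g \<Longrightarrow> ?N u \<le> (4 + \<epsilon>) * ?E g + C * ?S u"
    by (rule hardy_real[OF \<epsilon>(1)], rule that, assumption, blast)
  \<comment> \<open>The share of the weighted integral that remains after absorbing
    \<open>(4 + \<epsilon>) * \<mu>\<close> of it; its positivity is where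
    \<open>\<mu> < 1/4\<close> is decisive.\<close>
  define \<kappa> where "\<kappa> = 1 - (4 + \<epsilon>) * \<mu>"
  have \<kappa>: "\<kappa> > 0" using \<epsilon>(2) by (simp add: \<kappa>_def)
  let ?dv = "\<lambda>m n x. v m x - v n x" and ?dh = "\<lambda>m n x. h m x - h n x"
  \<comment> \<open>The sum satisfies the constraint, so its energy is at least \<mu> times its
    weighted integral, which is 4 minus that of the difference. In the parallelogram law for the
    energy the terms \<open>4 * \<mu>\<close> then cancel.\<close>
  have Ed: "?E (?dh m n) \<le> \<mu> * ?N (?dv m n) + 2 / real (Suc m) + 2 / real (Suc n)" for m n
  proof -
    have sp: "sob \<Omega> (\<lambda>x. v m x + v n x) (\<lambda>x. h m x + h n x)" using sob_lincomb[OF bounded_domain s s, of 1 m 1 n] by simp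
    have "?W (\<lambda>x. v m x + v n x) = 0"
      using linear_integrable[OF s[of m]] linear_integrable[OF s[of n]] v by (simp add: distrib_right)
    from hardy_lambda_le[OF sp this lam]
    have "\<mu> * ?N (\<lambda>x. v m x + v n x) \<le> ?E (\<lambda>x. h m x + h n x)" .
    moreover have par: "?N (?dv m n) + ?N (\<lambda>x. v m x + v n x) = 4"
      using parallelogram_weighted(1)[OF s s, of m n] v by simp
    have "\<mu> * ?N (?dv m n) + \<mu> * ?N (\<lambda>x. v m x + v n x) = 4 * \<mu>"
      unfolding distrib_left[symmetric] par by simp
    moreover have "?E (?dh m n) + ?E (\<lambda>x. h m x + h n x) = 2 * ?E (h m) + 2 * ?E (h n)"
      by (rule parallelogram_weighted(2)[OF s s])
    ultimately show ?thesis using hE[of m] hE[of n] by linarith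
  qed
  \<comment> \<open>The Hardy inequality for the difference with the energy bound inserted; the
    weighted integral on the right moves to the left and leaves the factor \<kappa>.\<close>
  have Nd: "\<kappa> * ?N (?dv m n) \<le> (4 + \<epsilon>) * (2 / real (Suc m) + 2 / real (Suc n)) + C * ?S (?dv m n)" for m n
  proof -
    have "?N (?dv m n) \<le> (4 + \<epsilon>) * ?E (?dh m n) + C * ?S (?dv m n)" by (rule C(2)[OF sob_diff[OF bounded_domain s s]])
    also have "(4 + \<epsilon>) * ?E (?dh m n) \<le> (4 + \<epsilon>) * (\<mu> * ?N (?dv m n) + 2 / real (Suc m) + 2 / real (Suc n))"
      using \<epsilon>(1) by (intro mult_left_mono Ed) auto
    finally show ?thesis by (simp add: \<kappa>_def algebra_simps)
  qed
  have small: "\<exists>N. \<forall>m\<ge>N. 2 / real (Suc m) < e" if "e > 0" for e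
  proof -
    have "(\<lambda>m. 2 * inverse (real (Suc m))) \<longlonglongrightarrow> 2 * 0" by (intro tendsto_intros LIMSEQ_inverse_real_of_nat)
    then have "eventually (\<lambda>m. 2 * inverse (real (Suc m)) < e) sequentially" using that by (intro order_tendstoD(2)) auto
    then show ?thesis by (simp add: eventually_sequentially divide_inverse)
  qed
  have CS: "\<exists>N. \<forall>m\<ge>N. \<forall>n\<ge>N. ?S (?dv m n) < e" if "e > 0" for e
    using t(2)[OF that] by (simp add: v_def)
  have CE: "\<exists>N. \<forall>m\<ge>N. \<forall>n\<ge>N. ?E (?dh m n) < e" if e: "e > 0" for e
  proof -
    \<comment> \<open>The second entry, together with the \<open>L\<^sup>2\<close> term, bounds the
      weighted integral of differences by \<open>e\<close>, which contributes at most
      \<open>e / 4\<close> to the energy; the first entry keeps the remaining \<open>2 * d\<close>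
      below \<open>e / 2\<close>.\<close>
    define d where "d = min (e / 4) (\<kappa> * e / (4 * (4 + \<epsilon>)))"
    have d: "d > 0" "d \<le> e / 4" "2 * (4 + \<epsilon>) * d \<le> \<kappa> * e / 2"
    proof -
      show "d > 0" using e \<kappa> \<epsilon> by (simp add: d_def)
      show "d \<le> e / 4" unfolding d_def by (rule min.cobounded1)
      have "d \<le> \<kappa> * e / (4 * (4 + \<epsilon>))" unfolding d_def by (rule min.cobounded2)
      then show "2 * (4 + \<epsilon>) * d \<le> \<kappa> * e / 2" using \<epsilon> by (simp add: pos_le_divide_eq mult_ac)
    qed
    obtain N1 where N1: "\<And>m. m \<ge> N1 \<Longrightarrow> 2 / real (Suc m) < d" using small[OF d(1)] by blast
    have "\<kappa> * e / (2 * (C + 1)) > 0" using \<kappa> e C(1) by simp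
    from CS[OF this] obtain N2 where "\<forall>m\<ge>N2. \<forall>n\<ge>N2. ?S (?dv m n) < \<kappa> * e / (2 * (C + 1))" ..
    then have N2: "?S (?dv m n) < \<kappa> * e / (2 * (C + 1))" if "m \<ge> N2" "n \<ge> N2" for m n using that by blast
    show ?thesis
    proof (intro exI[of _ "max N1 N2"] allI impI)
      fix m n assume mn: "max N1 N2 \<le> m" "max N1 N2 \<le> n"
      have 1: "2 / real (Suc m) < d" "2 / real (Suc n) < d" using N1 mn by auto
      have S: "C * ?S (?dv m n) \<le> \<kappa> * e / 2"
      proof -
        have "C * ?S (?dv m n) \<le> C * (\<kappa> * e / (2 * (C + 1)))"
          using N2[of m n] mn C(1) by (intro mult_left_mono) auto
        also have "\<dots> = \<kappa> * e / 2 * (C / (C + 1))" using C(1) by (simp add: field_simps)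
        also have "\<dots> \<le> \<kappa> * e / 2 * 1" using \<kappa> e C(1) by (intro mult_left_mono) auto
        finally show ?thesis by simp
      qed
      have "(4 + \<epsilon>) * (2 / real (Suc m) + 2 / real (Suc n)) \<le> (4 + \<epsilon>) * (2 * d)"
        using 1 \<epsilon>(1) by (intro mult_left_mono) auto
      also have "(4 + \<epsilon>) * (2 * d) = 2 * (4 + \<epsilon>) * d" by (simp only: mult_ac)
      finally have "(4 + \<epsilon>) * (2 / real (Suc m) + 2 / real (Suc n)) \<le> \<kappa> * e / 2"
        using d(3) by (rule order_trans)
      then have "\<kappa> * ?N (?dv m n) \<le> \<kappa> * e / 2 + \<kappa> * e / 2"
        using Nd[of m n] S by linarith
      also have "\<dots> = \<kappa> * e" by simp
      finally have "?N (?dv m n) \<le> e" using \<kappa> by simp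
      then have "\<mu> * ?N (?dv m n) \<le> 1/4 * e"
        using lam lam4 e weighted_nonneg[of "?dv m n"] by (intro mult_mono) auto
      then show "?E (?dh m n) < e" using Ed[of m n] 1 d(2) e by linarith
    qed
  qed
  obtain v0 where v0: "v0 \<in> borel_measurable borel" "\<And>x. x \<notin> \<Omega> \<Longrightarrow> v0 x = 0" "integrable lborel (\<lambda>x. (norm (v0 x))\<^sup>2)"
    "(\<lambda>n. LINT x|lborel. (norm (v n x - v0 x))\<^sup>2) \<longlonglongrightarrow> 0"
  proof (rule L2_complete[OF bounded_domain, of v])
    show "v n \<in> borel_measurable borel" for n by (rule sobD(1)[OF s])
    show "v n x = 0" if "x \<notin> \<Omega>" for n x by (rule sobD(3)[OF s that])
    show "integrable lborel (\<lambda>x. (norm (v n x))\<^sup>2)" for n using sobD(5)[OF s] by simp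
    show "\<exists>N. \<forall>m\<ge>N. \<forall>n\<ge>N. (LINT x|lborel. (norm (v m x - v n x))\<^sup>2) < e" if "e > 0" for e
      using CS[OF that] by simp
  qed (rule that)
  obtain h0 where h0: "h0 \<in> borel_measurable borel" "\<And>x. x \<notin> \<Omega> \<Longrightarrow> h0 x = 0" "integrable lborel (\<lambda>x. (norm (h0 x))\<^sup>2)"
    "(\<lambda>n. ?E (\<lambda>x. h n x - h0 x)) \<longlonglongrightarrow> 0"
  proof (rule L2_complete[OF bounded_domain, of h])
    show "h n \<in> borel_measurable borel" for n by (rule sobD(2)[OF s])
    show "h n x = 0" if "x \<notin> \<Omega>" for n x by (rule sobD(4)[OF s that])
    show "integrable lborel (\<lambda>x. (norm (h n x))\<^sup>2)" for n by (rule sobD(6)[OF s])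
  qed (rule CE, assumption, rule that)
  have limS: "(\<lambda>n. ?S (\<lambda>x. v n x - v0 x)) \<longlonglongrightarrow> 0" using v0(4) by simp
  have s0: "sob \<Omega> v0 h0"
    by (rule sob_limit[OF bounded_domain s v0(1,2) _ limS h0]) (use v0(3) in auto)
  have sd: "sob \<Omega> (\<lambda>x. v n x - v0 x) (\<lambda>x. h n x - h0 x)" for n by (rule sob_diff[OF bounded_domain s s0])
  \<comment> \<open>The Hardy inequality once more: convergence of the energy and of the square
    integral forces convergence in the weighted norm, so no mass is lost at the origin.\<close>
  have limN: "(\<lambda>n. ?N (\<lambda>x. v n x - v0 x)) \<longlonglongrightarrow> 0"
  proof (rule Lim_null_comparison)
    show "eventually (\<lambda>n. norm (?N (\<lambda>x. v n x - v0 x)) \<le> (4 + \<epsilon>) * ?E (\<lambda>x. h n x - h0 x) + C * ?S (\<lambda>x. v n x - v0 x)) sequentially"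
      using C(2)[OF sd] weighted_nonneg by (intro always_eventually allI) simp
    have "(\<lambda>n. (4 + \<epsilon>) * ?E (\<lambda>x. h n x - h0 x) + C * ?S (\<lambda>x. v n x - v0 x)) \<longlonglongrightarrow> (4 + \<epsilon>) * 0 + C * 0"
      by (intro tendsto_intros h0(4) limS)
    then show "(\<lambda>n. (4 + \<epsilon>) * ?E (\<lambda>x. h n x - h0 x) + C * ?S (\<lambda>x. v n x - v0 x)) \<longlonglongrightarrow> 0" by simp
  qed
  have W0: "?W v0 = 0"
  proof -
    let ?K = "LINT x|lborel. indicator \<Omega> x * ?w x"
    have K0: "?K \<ge> 0" by (intro Bochner_Integration.integral_nonneg) (auto simp: hardy_weight_nonneg)
    \<comment> \<open>The first term is independent of \<open>n\<close> and small with \<tau>, the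
      second vanishes in the limit for fixed \<tau>: \<open>n\<close> goes to infinity before \<tau>
      goes to 0.\<close>
    have bound: "\<bar>?W v0\<bar> \<le> \<tau> * ?K + (1 / \<tau>) * ?N (\<lambda>x. v n x - v0 x)" if \<tau>: "\<tau> > 0" for \<tau> n
    proof -
      have "?W (\<lambda>x. v n x - v0 x) = - ?W v0"
        using linear_integrable[OF s[of n]] linear_integrable[OF s0] v(1)[of n] by (simp add: left_diff_distrib)
      then have "\<bar>?W v0\<bar> = \<bar>?W (\<lambda>x. v n x - v0 x)\<bar>" by simp
      also have "\<dots> \<le> (LINT x|lborel. \<bar>(v n x - v0 x) * ?w x\<bar>)" by (rule integral_abs_bound)
      also have "\<dots> \<le> (LINT x|lborel. \<tau> * (indicator \<Omega> x * ?w x) + (1 / \<tau>) * ((v n x - v0 x)\<^sup>2 * ?w x))"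
        using linear_integrable[OF sd] weight_integrable weighted_integrable[OF sd] abs_weighted_le[OF sd \<tau>]
        by (intro integral_mono) auto
      also have "\<dots> = \<tau> * ?K + (1 / \<tau>) * ?N (\<lambda>x. v n x - v0 x)"
        using weight_integrable weighted_integrable[OF sd] by simp
      finally show ?thesis .
    qed
    have "\<bar>?W v0\<bar> \<le> \<tau> * ?K" if \<tau>: "\<tau> > 0" for \<tau>
    proof -
      have "(\<lambda>n. \<tau> * ?K + (1 / \<tau>) * ?N (\<lambda>x. v n x - v0 x)) \<longlonglongrightarrow> \<tau> * ?K + (1 / \<tau>) * 0"
        by (intro tendsto_intros limN)
      from LIMSEQ_le_const[OF this] bound[OF \<tau>] show ?thesis by auto
    qed
    then have "\<bar>?W v0\<bar> \<le> 0 + e" if "e > 0" for e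
    proof -
      have "\<bar>?W v0\<bar> \<le> e / (?K + 1) * ?K" using \<open>\<And>\<tau>. \<tau> > 0 \<Longrightarrow> \<bar>?W v0\<bar> \<le> \<tau> * ?K\<close>[of "e / (?K + 1)"] that K0 by simp
      also have "\<dots> \<le> e" using that K0 by (simp add: field_simps)
      finally show ?thesis by simp
    qed
    then have "\<bar>?W v0\<bar> \<le> 0" by (rule field_le_epsilon)
    then show ?thesis by simp
  qed
  \<comment> \<open>The lower bound suffices, since together with the upper bound on the energy it
    puts the quotient at most at \<mu>. The weight enters \<open>square_add_le\<close> through its
    square root.\<close>
  have N0: "?N v0 \<ge> 1"
  proof -
    have eq: "(norm (q * sqrt (?w x)))\<^sup>2 = q\<^sup>2 * ?w x" for q x
      using hardy_weight_nonneg[of a x] by (simp add: power_mult_distrib)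
    have "1 \<le> (1 + \<tau>) * ?N v0" if \<tau>: "\<tau> > 0" for \<tau>
    proof -
      have "1 \<le> (1 + \<tau>) * ?N v0 + (1 + 1 / \<tau>) * ?N (\<lambda>x. v n x - v0 x)" for n
        using square_add_le[of lborel "\<lambda>x. v n x * sqrt (?w x)" "\<lambda>x. v0 x * sqrt (?w x)" \<tau>]
          weighted_integrable[OF s[of n]] weighted_integrable[OF s0] weighted_integrable[OF sd[of n]] \<tau> v(2)[of n]
        unfolding left_diff_distrib[symmetric] eq by simp
      moreover have "(\<lambda>n. (1 + \<tau>) * ?N v0 + (1 + 1 / \<tau>) * ?N (\<lambda>x. v n x - v0 x)) \<longlonglongrightarrow> (1 + \<tau>) * ?N v0 + (1 + 1 / \<tau>) * 0"
        by (intro tendsto_intros limN)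
      ultimately show ?thesis using LIMSEQ_le_const by fastforce
    qed
    then have 1: "1 \<le> ?N v0 + \<tau> * ?N v0" if "\<tau> > 0" for \<tau> using that by (simp add: distrib_right)
    show ?thesis
    proof (rule field_le_epsilon)
      fix e :: real assume e: "e > 0"
      have "1 \<le> ?N v0 + e / (?N v0 + 1) * ?N v0" using 1[of "e / (?N v0 + 1)"] e weighted_nonneg[of v0] by simp
      also have "e / (?N v0 + 1) * ?N v0 \<le> e" using e weighted_nonneg[of v0] by (simp add: pos_divide_le_eq)
      finally show "1 \<le> ?N v0 + e" by simp
    qed
  qed
  \<comment> \<open>The same argument with the roles exchanged: the limit \<open>h0\<close> is
    compared with \<open>h n\<close>, and again \<tau> goes to 0 last.\<close>
  have E0: "?E h0 \<le> \<mu>"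
  proof -
    have 1: "?E h0 \<le> (1 + \<tau>) * \<mu>" if \<tau>: "\<tau> > 0" for \<tau>
    proof -
      have "?E h0 \<le> (1 + \<tau>) * (\<mu> + inverse (real (Suc n))) + (1 + 1 / \<tau>) * ?E (\<lambda>x. h n x - h0 x)" for n
      proof -
        have "?E h0 \<le> (1 + \<tau>) * ?E (h n) + (1 + 1 / \<tau>) * ?E (\<lambda>x. h0 x - h n x)"
          using sobD(6)[OF sd[of n]] by (intro square_add_le[OF sobD(6)[OF s0] sobD(6)[OF s] _ \<tau>]) (simp add: norm_minus_commute)
        also have "(1 + \<tau>) * ?E (h n) \<le> (1 + \<tau>) * (\<mu> + inverse (real (Suc n)))"
          using hE[of n] \<tau> by (intro mult_left_mono) (auto simp: divide_inverse)
        finally show ?thesis by (simp add: norm_minus_commute)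
      qed
      moreover have "(\<lambda>n. (1 + \<tau>) * (\<mu> + inverse (real (Suc n))) + (1 + 1 / \<tau>) * ?E (\<lambda>x. h n x - h0 x)) \<longlonglongrightarrow>
          (1 + \<tau>) * (\<mu> + 0) + (1 + 1 / \<tau>) * 0"
        by (intro tendsto_intros h0(4) LIMSEQ_inverse_real_of_nat)
      ultimately show ?thesis using LIMSEQ_le_const by fastforce
    qed
    show ?thesis
    proof (rule field_le_epsilon)
      fix e :: real assume e: "e > 0"
      have "?E h0 \<le> \<mu> + e * \<mu>" using 1[OF e] by (simp add: distrib_right)
      also have "\<dots> \<le> \<mu> + e * 1" using lam4 e by (intro add_left_mono mult_left_mono) auto
      finally show "?E h0 \<le> \<mu> + e" by simp
    qed
  qed
  have nz: "\<not> (AE x in lborel. v0 x = 0)"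
  proof
    assume ae: "AE x in lborel. v0 x = 0"
    note [measurable] = sobD(1)[OF s0]
    have "?N v0 = (LINT x|(lborel :: (real^2) measure). 0)"
      by (rule integral_cong_AE) (use ae in \<open>auto elim: eventually_mono\<close>)
    then show False using N0 by simp
  qed
  note ad = sob_imp_admissible[OF open_domain bounded_domain s0 nz linear_integrable[OF s0] W0]
  have "rayleigh a \<Omega> v0 = ennreal (?E h0 / ?N v0)"
    unfolding ad(2) nn_weighted[OF s0] using N0 by (intro divide_ennreal sob_integral_nonneg) auto
  also have "\<dots> \<le> ennreal \<mu>"
  proof (rule ennreal_leI)
    have "?E h0 / ?N v0 \<le> ?E h0 / 1" using N0 by (intro divide_left_mono sob_integral_nonneg) auto
    then show "?E h0 / ?N v0 \<le> \<mu>" using E0 by simp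
  qed
  finally have "rayleigh a \<Omega> v0 \<le> hardy_lambda a \<Omega>" by (simp add: lam)
  moreover have "hardy_lambda a \<Omega> \<le> rayleigh a \<Omega> v0" unfolding hardy_lambda_def by (rule INF_lower[OF ad(1)])
  ultimately show ?thesis using ad(1) by (intro bexI[of _ v0] order.antisym)
qed

end

theorem theorem2:
  fixes \<Omega> :: "(real^2) set" and a :: real
  assumes "smooth_bounded_domain \<Omega>"
    and "0 \<in> closure \<Omega>"
    and "(SUP x\<in>\<Omega>. norm x) = 1"
    and "a > 1"
    and "hardy_lambda a \<Omega> < ennreal (1/4)"
  shows "\<exists>u\<in>admissible a \<Omega>. rayleigh a \<Omega> u = hardy_lambda a \<Omega>"
proof -
  \<comment> \<open>Boundedness turns the prescribed supremum into a pointwise bound; a real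
    \<open>SUP\<close> over an unbounded set carries no such information.\<close>
  have "bdd_above (norm ` \<Omega>)"
    using assms(1) by (simp add: smooth_bounded_domain_def bounded_iff) (auto simp: bdd_above_def)
  then have "norm x \<le> 1" if "x \<in> \<Omega>" for x
    using cSUP_upper[OF that] assms(3) by metis
  then interpret hardy_problem \<Omega> a
    by unfold_locales (use assms in auto)
  show ?thesis by (rule minimizer_exists[OF assms(5)])
qed

end
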